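(* For each pair of coprime $m,n\in\mathbb{N}$ satisfying $$\frac12<\frac mn<1$$ there is a non-circular, strictly locally convex shrinker $x:\mathbb{S}^1\to\mathbb{R}^2$ of the area-preserving curve-shortening flow with tangent turning index $m$ whose image $x(\mathbb{S}^1)$ exhibits $n$-fold rotational symmetry.
   Context: For a smooth family of smooth immersions $X:\mathbb{S}^1\times[0,T)\to\mathbb{R}^2$, $T\in(0,\infty]$, let $\mathsf N(\cdot,t)$ be the unit normal obtained by rotating the unit tangent of $X(\cdot,t)$ by $+\pi/2$, $k(\cdot,t)$ the curvature with respect to $\mathsf N$ (positive for counterclockwise circles), $s(\cdot,t)$ arc length, $\operatorname{len}(t)$ the length, and $\bar k(t)=\frac{1}{\operatorname{len}(t)}\int_{\mathbb{S}^1}k(\cdot,t)\,ds(\cdot,t)=\frac{2\pi m}{\operatorname{len}(t)}$ the average curvature, where $m\in\mathbb{Z}$ is the tangent turning index (rotation number of the unit tangent). $X$ evolves by area-preserving curve-shortening flow (APCSF) if $\partial_tX=(k-\bar k)\mathsf N$ on $\mathbb{S}^1\times[0,T)$. $X$ evolves by homothety if there are $\psi\in C^1[0,T)$ and $x_\ast\in\mathbb{R}^2$ with $X(\mathbb{S}^1,t)=x_\ast+\psi(t)\,(X(\mathbb{S}^1,0)-x_\ast)$ for all $t\in[0,T)$. An APCSF-shrinker is an immersion $x:\mathbb{S}^1\to\mathbb{R}^2$ that is the initial datum $x=X(\cdot,0)$ of an APCSF evolution $X$ by homothety with $\dot\psi\le 0$. Strictly locally convex means that the curvature vanishes nowhere;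 non-circular means that the image is not a circle. *)

theory Defs
  imports "HOL-Complex_Analysis.Complex_Analysis"
begin

text \<open>
  The plane is \<^typ>\<open>complex\<close>, so rotation by \<open>+\<pi>/2\<close> is multiplication by \<open>\<i>\<close>, and the
  circle is \<open>sphere (0::complex) 1\<close> with angular coordinate \<open>u \<mapsto> cis u\<close>. Maps on the circle are
  total functions on \<^typ>\<open>complex\<close>; only their values on the unit circle are ever used.
\<close>

abbreviation unit_circle :: "complex set" where
  "unit_circle \<equiv> sphere 0 1"


subsection \<open>Smoothness\<close>

text \<open>
  Derivatives are taken within \<open>S\<close>, so on \<open>UNIV \<times> [0,T)\<close> they are one-sided in time at \<open>t = 0\<close>,
  and smoothness holds up to the initial time. For such \<open>S\<close> the derivative within \<open>S\<close> is unique,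
  so the existential quantifier involves no choice.
\<close>

primrec Ck_on :: "nat \<Rightarrow> 'a set \<Rightarrow> ('a::real_normed_vector \<Rightarrow> 'b::real_normed_vector) \<Rightarrow> bool" where
  "Ck_on 0 S f \<longleftrightarrow> continuous_on S f"
| "Ck_on (Suc k) S f \<longleftrightarrow>
     (\<exists>f'. (\<forall>x\<in>S. (f has_derivative f' x) (at x within S)) \<and> (\<forall>v. Ck_on k S (\<lambda>x. f' x v)))"

definition smooth_on :: "'a set \<Rightarrow> ('a::real_normed_vector \<Rightarrow> 'b::real_normed_vector) \<Rightarrow> bool" where
  "smooth_on S f \<longleftrightarrow> (\<forall>k. Ck_on k S f)"


subsection \<open>Geometry of immersed closed plane curves\<close>

definition circle_deriv :: "(complex \<Rightarrow> complex) \<Rightarrow> complex \<Rightarrow> complex" where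
  "circle_deriv f z = vector_derivative (\<lambda>u. f (z * cis u)) (at 0)"

definition smooth_immersion :: "(complex \<Rightarrow> complex) \<Rightarrow> bool" where
  "smooth_immersion x \<longleftrightarrow>
     smooth_on UNIV (\<lambda>u::real. x (cis u)) \<and> (\<forall>z\<in>unit_circle. circle_deriv x z \<noteq> 0)"

definition unit_tangent :: "(complex \<Rightarrow> complex) \<Rightarrow> complex \<Rightarrow> complex" where
  "unit_tangent x z = sgn (circle_deriv x z)"

definition unit_normal :: "(complex \<Rightarrow> complex) \<Rightarrow> complex \<Rightarrow> complex" where
  "unit_normal x z = \<i> * unit_tangent x z"

definition arc_length_deriv ::
    "(complex \<Rightarrow> complex) \<Rightarrow> (complex \<Rightarrow> complex) \<Rightarrow> complex \<Rightarrow> complex" where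
  "arc_length_deriv x f z = circle_deriv f z /\<^sub>R norm (circle_deriv x z)"

definition curvature :: "(complex \<Rightarrow> complex) \<Rightarrow> complex \<Rightarrow> real" where
  "curvature x z = arc_length_deriv x (unit_tangent x) z \<bullet> unit_normal x z"

definition arc_length_integral :: "(complex \<Rightarrow> complex) \<Rightarrow> (complex \<Rightarrow> real) \<Rightarrow> real" where
  "arc_length_integral x f = integral {0..2*pi} (\<lambda>u. f (cis u) * norm (circle_deriv x (cis u)))"

definition curve_length :: "(complex \<Rightarrow> complex) \<Rightarrow> real" where
  "curve_length x = arc_length_integral x (\<lambda>_. 1)"

definition average_curvature :: "(complex \<Rightarrow> complex) \<Rightarrow> real" where
  "average_curvature x = arc_length_integral x (curvature x) / curve_length x"

text \<open>
  The library's \<^const>\<open>winding_number\<close> is complex-valued; on the loop below, which avoids the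
  origin, its value is an integer.
\<close>

definition tangent_turning_index :: "(complex \<Rightarrow> complex) \<Rightarrow> complex" where
  "tangent_turning_index x = winding_number (unit_tangent x \<circ> circlepath 0 1) 0"

definition strictly_locally_convex :: "(complex \<Rightarrow> complex) \<Rightarrow> bool" where
  "strictly_locally_convex x \<longleftrightarrow> (\<forall>z\<in>unit_circle. curvature x z \<noteq> 0)"

definition non_circular :: "(complex \<Rightarrow> complex) \<Rightarrow> bool" where
  "non_circular x \<longleftrightarrow> \<not> (\<exists>c r. r > 0 \<and> x ` unit_circle = sphere c r)"

definition rotational_symmetry :: "nat \<Rightarrow> complex set \<Rightarrow> bool" where
  "rotational_symmetry n A \<longleftrightarrow> (\<exists>c. (\<lambda>p. c + cis (2 * pi / real n) * (p - c)) ` A = A)"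


subsection \<open>Area-preserving curve-shortening flow\<close>

definition time_interval :: "ereal \<Rightarrow> real set" where
  "time_interval T = {t. 0 \<le> t \<and> ereal t < T}"

text \<open>A time-dependent curve \<open>X\<close> is curried with time last: \<open>X z t\<close>.\<close>

definition smooth_family_of_immersions :: "ereal \<Rightarrow> (complex \<Rightarrow> real \<Rightarrow> complex) \<Rightarrow> bool" where
  "smooth_family_of_immersions T X \<longleftrightarrow>
     smooth_on (UNIV \<times> time_interval T) (\<lambda>(u::real, t). X (cis u) t) \<and>
     (\<forall>t\<in>time_interval T. smooth_immersion (\<lambda>z. X z t))"

definition APCSF :: "ereal \<Rightarrow> (complex \<Rightarrow> real \<Rightarrow> complex) \<Rightarrow> bool" where
  "APCSF T X \<longleftrightarrow>
     smooth_family_of_immersions T X \<and>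
     (\<forall>z\<in>unit_circle. \<forall>t\<in>time_interval T.
        (X z has_vector_derivative
           (curvature (\<lambda>w. X w t) z - average_curvature (\<lambda>w. X w t)) *\<^sub>R
             unit_normal (\<lambda>w. X w t) z)
          (at t within time_interval T))"

definition C1_with_deriv :: "ereal \<Rightarrow> (real \<Rightarrow> real) \<Rightarrow> (real \<Rightarrow> real) \<Rightarrow> bool" where
  "C1_with_deriv T \<psi> \<psi>' \<longleftrightarrow>
     (\<forall>t\<in>time_interval T. (\<psi> has_real_derivative \<psi>' t) (at t within time_interval T)) \<and>
     continuous_on (time_interval T) \<psi>'"

definition homothetic_with ::
    "ereal \<Rightarrow> (complex \<Rightarrow> real \<Rightarrow> complex) \<Rightarrow> (real \<Rightarrow> real) \<Rightarrow> complex \<Rightarrow> bool" where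
  "homothetic_with T X \<psi> c \<longleftrightarrow>
     (\<forall>t\<in>time_interval T.
        (\<lambda>z. X z t) ` unit_circle = (\<lambda>p. c + \<psi> t *\<^sub>R (p - c)) ` ((\<lambda>z. X z 0) ` unit_circle))"

definition APCSF_shrinker :: "(complex \<Rightarrow> complex) \<Rightarrow> bool" where
  "APCSF_shrinker x \<longleftrightarrow>
     smooth_immersion x \<and>
     (\<exists>T X \<psi> \<psi>' c. 0 < T \<and> APCSF T X \<and> (\<forall>z\<in>unit_circle. X z 0 = x z) \<and>
        C1_with_deriv T \<psi> \<psi>' \<and> homothetic_with T X \<psi> c \<and>
        (\<forall>t\<in>time_interval T. \<psi>' t \<le> 0))"

end

(*
  Parametrise a strictly locally convex curve by its tangent angle. It is a shrinker of zero signed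
  area if its curvature k solves, up to scaling, k'' + k = 1 + b / k with b > 0 and 1/k has mean 1;
  the support function is then h = (k - 1) / b. If k has period P = 2 pi m / n, the curve
  closes up after n periods with turning index m.

  Such a k exists variationally: the radius of curvature rho = 1/k maximises the entropy, the integral
  of ln rho over a period, at fixed length among curves of nonpositive area. This constraint set
  contains curves of finite entropy because P > pi makes the area of a point mass negative, and it
  excludes rho = 1, so k is not constant. To get a maximiser the problem is discretised to N points,
  where compactness is elementary; the Lagrange condition bounds k_N in the Lipschitz norm uniformly,
  so a subsequence converges. The limit is positive since a Lipschitz function with a zero has a
  reciprocal of infinite integral.

  The flow itself moves in the normal direction only, so the homothety has to be reparametrised by the
  flow of a scalar ODE.
*)
theory Submission
  imports Defs
begin

text \<open>A homothety scales signed area by the square of its factor while the flow preserves it,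
  so a curve that really shrinks has signed area zero: the integral of \<open>rho h\<close>
  vanishes. For such a homothety the normal velocity \<open>k\<close> minus its average is a
  positive multiple of \<open>h\<close>, and \<open>h'' + h = 1 / k\<close> turns this into the
  equation for \<open>k\<close>. Entropy is the right functional because its gradient in
  \<open>rho\<close> is \<open>1 / rho = k\<close>. The multiplier rule then reads
  \<open>k = a + b h\<close>, and pairing it with \<open>rho\<close> at zero area and normalised
  length forces \<open>a = 1\<close>. Since the period is prescribed from the start, no study of how
  the period of a solution depends on its amplitude is required. The obstacle is that
  \<open>b\<close> might degenerate to 0 or infinity as N grows. Two facts prevent this: the kernel
  has row sums close to 1, so the plain mean of \<open>h\<close> is at least 1/2 although its mean
  weighted by \<open>rho\<close> is 0; and a fixed competitor keeps the maximal entropy per point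
  bounded below.\<close>

section \<open>The discretised variational problem\<close>

text \<open>
  Testing with \<open>v = w - e h'\<close>, where \<open>w\<close> is the part of \<open>k\<close> orthogonal to \<open>1\<close> and \<open>h\<close>, gives
  \<open>|w|^2 \<le> e (k' . h')\<close> for every \<open>e > 0\<close>.
\<close>
lemma multiplier_of_one_sided_variations:
  fixes k h :: "nat \<Rightarrow> real"
  assumes N: "0 < N"
    and var: "\<And>v. (\<Sum>i<N. v i) = 0 \<Longrightarrow> (\<Sum>i<N. h i * v i) < 0 \<Longrightarrow> (\<Sum>i<N. k i * v i) \<le> 0"
    and nonconst: "i0 < N" "j0 < N" "h i0 \<noteq> h j0"
  obtains a b where "b \<ge> 0" "\<And>i. i < N \<Longrightarrow> k i = a + b * h i"
proof -
  define mh where "mh = (\<Sum>i<N. h i) / N"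
  define mk where "mk = (\<Sum>i<N. k i) / N"
  define h' where "h' = (\<lambda>i. h i - mh)"
  define k' where "k' = (\<lambda>i. k i - mk)"
  have h'0: "(\<Sum>i<N. h' i) = 0" and k'0: "(\<Sum>i<N. k' i) = 0"
    using N by (simp_all add: h'_def k'_def sum_subtractf mh_def mk_def)
  define S where "S = (\<Sum>i<N. (h' i)\<^sup>2)"
  define c where "c = (\<Sum>i<N. k' i * h' i)"
  define w where "w = (\<lambda>i. k' i - (c / S) * h' i)"
  define W where "W = (\<Sum>i<N. (w i)\<^sup>2)"
  have Spos: "S > 0"
  proof -
    have "\<exists>i<N. h' i \<noteq> 0" using nonconst unfolding h'_def by (metis right_minus_eq)
    then show ?thesis unfolding S_def by (auto intro!: sum_pos2)
  qed
  have w0: "(\<Sum>i<N. w i) = 0"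
    unfolding w_def sum_subtractf k'0 sum_distrib_left[symmetric] h'0 by simp
  have wh: "(\<Sum>i<N. h' i * w i) = 0"
  proof -
    have "(\<Sum>i<N. h' i * w i) = (\<Sum>i<N. k' i * h' i - (c / S) * (h' i)\<^sup>2)"
      by (rule sum.cong) (auto simp: w_def algebra_simps power2_eq_square)
    also have "\<dots> = c - c / S * S"
      unfolding sum_subtractf sum_distrib_left[symmetric] c_def[symmetric] S_def[symmetric] ..
    finally show ?thesis using Spos by simp
  qed
  have kw: "(\<Sum>i<N. k' i * w i) = W"
  proof -
    have "(\<Sum>i<N. k' i * w i) = (\<Sum>i<N. (w i)\<^sup>2 + (c / S) * (h' i * w i))"
      by (rule sum.cong) (auto simp: w_def algebra_simps power2_eq_square)
    also have "\<dots> = W"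
      unfolding sum.distrib sum_distrib_left[symmetric] wh W_def by simp
    finally show ?thesis .
  qed
  have key: "W \<le> e * c" if "e > 0" for e
  proof -
    define v where "v = (\<lambda>i. w i - e * h' i)"
    have v0: "(\<Sum>i<N. v i) = 0" by (simp add: v_def sum_subtractf w0 h'0 flip: sum_distrib_left)
    have "(\<Sum>i<N. h i * v i) = (\<Sum>i<N. h' i * w i - e * (h' i)\<^sup>2 + mh * v i)"
      by (rule sum.cong) (auto simp: v_def h'_def algebra_simps power2_eq_square)
    also have "\<dots> = - e * S"
      by (simp add: sum.distrib sum_subtractf wh S_def v0 flip: sum_distrib_left)
    finally have "(\<Sum>i<N. h i * v i) < 0" using that Spos by simp
    from var[OF v0 this] have le: "(\<Sum>i<N. k i * v i) \<le> 0" .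
    have "(\<Sum>i<N. k i * v i) = (\<Sum>i<N. k' i * w i - e * (k' i * h' i) + mk * v i)"
      by (rule sum.cong) (auto simp: v_def k'_def algebra_simps)
    also have "\<dots> = W - e * c"
      by (simp add: sum.distrib sum_subtractf kw c_def v0 flip: sum_distrib_left)
    finally show ?thesis using le by simp
  qed
  have W0: "W \<ge> 0" unfolding W_def by (simp add: sum_nonneg)
  have c0: "c \<ge> 0" using key[of 1] W0 by simp
  have "W \<le> 0"
  proof (rule ccontr)
    assume "\<not> W \<le> 0"
    then have "W > 0" by simp
    \<comment> \<open>Any positive \<open>e\<close> with \<open>e * c < W\<close> contradicts
      \<open>key\<close>; the added 1 keeps the quotient meaningful when
      \<open>c = 0\<close>.\<close>
    then have "W \<le> W / (2 * (c + 1)) * c" using c0 by (intro key) simp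
    then have "W * (2 * (c + 1)) \<le> W * c" using c0 by (simp add: field_simps)
    then show False using \<open>W > 0\<close> c0 by simp
  qed
  then have "W = 0" using W0 by simp
  then have weq: "w i = 0" if "i < N" for i
    using that unfolding W_def by (subst (asm) sum_nonneg_eq_0_iff) auto
  show ?thesis
  proof (rule that[of "c / S" "mk - c / S * mh"])
    show "c / S \<ge> 0" using c0 Spos by simp
    show "k i = mk - c / S * mh + c / S * h i" if "i < N" for i
      using weq[OF that] by (simp add: w_def k'_def h'_def algebra_simps)
  qed
qed

text \<open>Functions on all naturals stand for vectors of length N. Pinning the coordinates from N
  on to 0 makes the box a full product of compact sets, so Tychonoff applies.\<close>

lemma compact_box_nat_fun:
  fixes N :: nat and R :: real
  shows "compact {\<rho> :: nat \<Rightarrow> real. \<forall>i. \<rho> i \<in> (if i < N then {0..R} else {0})}"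
proof -
  have "compactin (product_topology (\<lambda>_::nat. euclidean :: real topology) UNIV)
          (PiE UNIV (\<lambda>i. if i < N then {0..R} else {0}))"
    by (subst compactin_PiE) auto
  also have "(PiE UNIV (\<lambda>i. if i < N then {0..R} else {0})) =
     {\<rho> :: nat \<Rightarrow> real. \<forall>i. \<rho> i \<in> (if i < N then {0..R} else {0})}"
    by (auto simp: PiE_def Pi_def)
  finally show ?thesis by (simp add: euclidean_product_topology)
qed

text \<open>
  The quadratic form in the last conjunct is the discretised enclosed area; relaxing the condition
  that it vanishes to \<open>\<le> 0\<close> makes the sign of its multiplier automatic.
\<close>
definition admissible :: "(nat \<Rightarrow> nat \<Rightarrow> real) \<Rightarrow> nat \<Rightarrow> real \<Rightarrow> (nat \<Rightarrow> real) \<Rightarrow> bool" where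
  "admissible Q N R \<sigma> \<longleftrightarrow> (\<forall>i<N. \<sigma> i > 0) \<and> (\<Sum>i<N. \<sigma> i) = R \<and>
     (\<Sum>i<N. \<Sum>j<N. Q i j * \<sigma> i * \<sigma> j) \<le> 0"

text \<open>Positivity is not a closed condition and \<open>ln\<close> is singular at 0. Therefore
  the product of the entries, which is continuous up to the boundary of the box, is maximised over
  nonnegative vectors; the given admissible vector makes the maximum positive, which forces every
  entry of the maximiser to be positive.\<close>

lemma admissible_maximizer:
  assumes adm0: "admissible Q N R \<rho>0"
  obtains \<rho> where "admissible Q N R \<rho>"
    "\<And>\<sigma>. admissible Q N R \<sigma> \<Longrightarrow> (\<Sum>i<N. ln (\<sigma> i)) \<le> (\<Sum>i<N. ln (\<rho> i))"
proof -
  define B where "B = {\<rho> :: nat \<Rightarrow> real. \<forall>i. \<rho> i \<in> (if i < N then {0..R} else {0})}"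
  define K where "K = B \<inter> {\<rho>. (\<Sum>i<N. \<rho> i) = R} \<inter> {\<rho>. (\<Sum>i<N. \<Sum>j<N. Q i j * \<rho> i * \<rho> j) \<le> 0}"
  have "compact B" unfolding B_def by (rule compact_box_nat_fun)
  moreover have "closed {\<rho> :: nat \<Rightarrow> real. (\<Sum>i<N. \<rho> i) = R}"
    by (intro closed_Collect_eq continuous_intros) simp_all
  moreover have "closed {\<rho> :: nat \<Rightarrow> real. (\<Sum>i<N. \<Sum>j<N. Q i j * \<rho> i * \<rho> j) \<le> 0}"
    by (intro closed_Collect_le continuous_intros) simp_all
  ultimately have compK: "compact K" unfolding K_def by (intro compact_Int_closed)
  have trunc: "(\<lambda>i. if i < N then \<sigma> i else 0) \<in> K" if "admissible Q N R \<sigma>" for \<sigma>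
  proof -
    have "\<sigma> i \<le> (\<Sum>i<N. \<sigma> i)" if "i < N" for i
      using that \<open>admissible Q N R \<sigma>\<close>
      by (intro member_le_sum) (auto simp: less_imp_le admissible_def)
    then show ?thesis using that by (auto simp: K_def B_def less_imp_le admissible_def)
  qed
  have "K \<noteq> {}" using trunc[OF adm0] by auto
  moreover have "continuous_on K (\<lambda>\<rho>. \<Prod>i<N. \<rho> i)"
    by (rule continuous_on_subset[OF _ subset_UNIV], intro continuous_intros) simp_all
  ultimately obtain \<rho> where \<rho>: "\<rho> \<in> K" and max: "\<And>\<sigma>. \<sigma> \<in> K \<Longrightarrow> (\<Prod>i<N. \<sigma> i) \<le> (\<Prod>i<N. \<rho> i)"
    using continuous_attains_sup[OF compK] by blast
  have "0 < (\<Prod>i<N. \<rho>0 i)" using adm0 by (intro prod_pos) (auto simp: admissible_def)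
  also have "\<dots> \<le> (\<Prod>i<N. \<rho> i)" using max[OF trunc[OF adm0]] by simp
  finally have prodpos: "0 < (\<Prod>i<N. \<rho> i)" .
  have rpos: "\<rho> i > 0" if "i < N" for i
  proof -
    have "\<rho> i \<noteq> 0" using prodpos that by (metis finite_lessThan lessThan_iff less_irrefl prod_zero)
    moreover have "\<rho> i \<ge> 0" using \<rho> that unfolding K_def B_def by auto (metis atLeastAtMost_iff)
    ultimately show ?thesis by simp
  qed
  show ?thesis
  proof (rule that[of \<rho>])
    show "(\<Sum>i<N. ln (\<sigma> i)) \<le> (\<Sum>i<N. ln (\<rho> i))" if \<sigma>: "admissible Q N R \<sigma>" for \<sigma>
    proof -
      have pos: "\<sigma> i > 0" if "i < N" for i using \<sigma> that by (simp add: admissible_def)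
      have "(\<Prod>i<N. \<sigma> i) \<le> (\<Prod>i<N. \<rho> i)" using max[OF trunc[OF \<sigma>]] by simp
      then have "ln (\<Prod>i<N. \<sigma> i) \<le> ln (\<Prod>i<N. \<rho> i)" using pos prodpos 
        by (subst ln_le_cancel_iff) (auto intro!: prod_pos)
      moreover have "ln (\<Prod>i<N. \<sigma> i) = (\<Sum>i<N. ln (\<sigma> i))" using pos by (intro ln_prod) force+
      moreover have "ln (\<Prod>i<N. \<rho> i) = (\<Sum>i<N. ln (\<rho> i))" using rpos by (intro ln_prod) force+
      ultimately show ?thesis by simp
    qed
  qed (use \<rho> rpos in \<open>auto simp: K_def admissible_def\<close>)
qed

text \<open>Here \<open>h\<close> plays the support function and \<open>q\<close> the signed area.
  Optimality gives \<open>1 / \<rho> i = a + b * h i\<close> with \<open>b \<ge> 0\<close>; positive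
  row sums then exclude constant \<open>h\<close> and \<open>b = 0\<close>, and optimality excludes
  a slack area constraint.\<close>

lemma discrete_euler_lagrange:
  fixes Q :: "nat \<Rightarrow> nat \<Rightarrow> real" and \<rho> :: "nat \<Rightarrow> real"
  assumes N: "0 < N"
    and sym: "\<And>i j. Q i j = Q j i"
    and row: "\<And>j. j < N \<Longrightarrow> (\<Sum>i<N. Q i j) > 0"
    and adm: "admissible Q N N \<rho>"
    and max: "\<And>\<sigma>. admissible Q N N \<sigma> \<Longrightarrow> (\<Sum>i<N. ln (\<sigma> i)) \<le> (\<Sum>i<N. ln (\<rho> i))"
  obtains b where "b > 0" "\<And>i. i < N \<Longrightarrow> 1 / \<rho> i = 1 + b * (\<Sum>j<N. Q i j * \<rho> j)"
    "(\<Sum>i<N. \<rho> i * (\<Sum>j<N. Q i j * \<rho> j)) = 0"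
proof -
  have pos: "\<And>i. i < N \<Longrightarrow> \<rho> i > 0" and sumN: "(\<Sum>i<N. \<rho> i) = N"
    and q_le: "(\<Sum>i<N. \<Sum>j<N. Q i j * \<rho> i * \<rho> j) \<le> 0"
    using adm by (auto simp: admissible_def)
  define h where "h = (\<lambda>i. \<Sum>j<N. Q i j * \<rho> j)"
  define q where "q = (\<lambda>\<sigma>. \<Sum>i<N. \<Sum>j<N. Q i j * \<sigma> i * \<sigma> j)"
  have qh: "q \<rho> = (\<Sum>i<N. \<rho> i * h i)"
    unfolding q_def h_def by (simp add: sum_distrib_left mult_ac)
  have qexp: "q (\<lambda>i. \<rho> i + e * v i) = q \<rho> + e * (2 * (\<Sum>i<N. h i * v i) + e * q v)" for e v
  proof -
    have "(\<Sum>i<N. \<Sum>j<N. Q i j * \<rho> i * v j) = (\<Sum>j<N. \<Sum>i<N. Q i j * \<rho> i * v j)" by (rule sum.swap)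
    also have "\<dots> = (\<Sum>i<N. h i * v i)" unfolding h_def
      by (simp add: sum_distrib_right) (subst sym, rule refl)
    finally have 1: "(\<Sum>i<N. \<Sum>j<N. Q i j * \<rho> i * v j) = (\<Sum>i<N. h i * v i)" .
    have 2: "(\<Sum>i<N. \<Sum>j<N. Q i j * v i * \<rho> j) = (\<Sum>i<N. h i * v i)" unfolding h_def
      by (simp add: sum_distrib_left mult_ac)
    have "q (\<lambda>i. \<rho> i + e * v i) = (\<Sum>i<N. \<Sum>j<N. Q i j * \<rho> i * \<rho> j + e * (Q i j * \<rho> i * v j)
        + e * (Q i j * v i * \<rho> j) + e * e * (Q i j * v i * v j))"
      unfolding q_def by (intro sum.cong refl) (simp add: algebra_simps)
    also have "\<dots> = q \<rho> + e * (\<Sum>i<N. \<Sum>j<N. Q i j * \<rho> i * v j) + e * (\<Sum>i<N. \<Sum>j<N. Q i j * v i * \<rho> j) + e * e * q v"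
      unfolding q_def by (simp add: sum.distrib sum_distrib_left)
    finally show ?thesis unfolding 1 2 by (simp add: algebra_simps)
  qed
  \<comment> \<open>A direction preserving length stays admissible for small positive steps if the
    area is strictly negative, by continuity, or if it decreases the area to first order. Along such
    a direction the entropy cannot increase.\<close>
  have var: "(\<Sum>i<N. (1 / \<rho> i) * v i) \<le> 0"
    if v0: "(\<Sum>i<N. v i) = 0" and neg: "q \<rho> < 0 \<or> (\<Sum>i<N. h i * v i) < 0" for v
  proof (rule ccontr)
    assume "\<not> ?thesis"
    then have p: "(\<Sum>i<N. (1 / \<rho> i) * v i) > 0" by simp
    have der: "((\<lambda>e. \<Sum>i<N. ln (\<rho> i + e * v i)) has_real_derivative (\<Sum>i<N. (1 / \<rho> i) * v i)) (at 0)"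
      using pos by (auto intro!: derivative_eq_intros sum.cong)
    have E1: "\<forall>\<^sub>F e in at_right 0. (\<Sum>i<N. ln (\<rho> i)) < (\<Sum>i<N. ln (\<rho> i + e * v i))"
      using DERIV_pos_inc_right[OF der p] unfolding eventually_at_right_field
      by (auto intro!: exI[of _ _])
    have E2: "\<forall>\<^sub>F e in at_right 0. \<forall>i\<in>{..<N}. \<rho> i + e * v i > 0"
    proof (intro eventually_ball_finite ballI)
      fix i assume i: "i \<in> {..<N}"
      have "((\<lambda>e. \<rho> i + e * v i) \<longlongrightarrow> \<rho> i + 0 * v i) (at_right 0)" by (intro tendsto_intros)
      then show "\<forall>\<^sub>F e in at_right 0. \<rho> i + e * v i > 0" 
        using pos i by (auto intro: order_tendstoD(1))
    qed auto
    have E3: "\<forall>\<^sub>F e in at_right 0. q (\<lambda>i. \<rho> i + e * v i) \<le> 0"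
    proof (cases "q \<rho> < 0")
      case True
      have "((\<lambda>e. q \<rho> + e * (2 * (\<Sum>i<N. h i * v i) + e * q v)) \<longlongrightarrow>
          q \<rho> + 0 * (2 * (\<Sum>i<N. h i * v i) + 0 * q v)) (at_right 0)" by (intro tendsto_intros)
      from order_tendstoD(2)[OF this, of 0] True show ?thesis
        unfolding qexp by (auto elim: eventually_mono)
    next
      case False
      have "((\<lambda>e. 2 * (\<Sum>i<N. h i * v i) + e * q v) \<longlongrightarrow>
          2 * (\<Sum>i<N. h i * v i) + 0 * q v) (at_right 0)" by (intro tendsto_intros)
      from order_tendstoD(2)[OF this, of 0] False neg 
      have "\<forall>\<^sub>F e in at_right 0. 2 * (\<Sum>i<N. h i * v i) + e * q v < 0" by auto
      moreover have "\<forall>\<^sub>F e :: real in at_right 0. e > 0" by (simp add: eventually_at_right_less)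
      ultimately show ?thesis unfolding qexp
      proof eventually_elim
        case (elim e)
        then have "e * (2 * (\<Sum>i<N. h i * v i) + e * q v) \<le> 0" by (intro mult_nonneg_nonpos) auto
        then show ?case using q_le unfolding q_def by linarith
      qed
    qed
    from eventually_happens'[OF _ eventually_conj[OF E1 eventually_conj[OF E2 E3]]]
    obtain e where e: "(\<Sum>i<N. ln (\<rho> i)) < (\<Sum>i<N. ln (\<rho> i + e * v i))"
      "\<And>i. i < N \<Longrightarrow> \<rho> i + e * v i > 0" "q (\<lambda>i. \<rho> i + e * v i) \<le> 0" by auto
    have "(\<Sum>i<N. \<rho> i + e * v i) = N"
      by (simp add: sum.distrib sumN v0 flip: sum_distrib_left)
    then have "admissible Q N N (\<lambda>i. \<rho> i + e * v i)"
      using e(2,3) by (simp add: admissible_def q_def)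
    from max[OF this] e(1) show False by simp
  qed
  have sumh: "(\<Sum>i<N. h i) > 0"
  proof -
    have "(\<Sum>i<N. h i) = (\<Sum>j<N. (\<Sum>i<N. Q i j) * \<rho> j)"
      unfolding h_def sum_distrib_right by (rule sum.swap)
    also have "\<dots> > 0" using row pos N by (intro sum_pos) auto
    finally show ?thesis .
  qed
  \<comment> \<open>A constant \<open>h\<close> would be positive because its sum is, and then the
    area \<open>q \<rho> = N * h 0\<close> would be positive as well.\<close>
  have "\<exists>i0<N. \<exists>j0<N. h i0 \<noteq> h j0"
  proof (rule ccontr)
    assume "\<not> ?thesis"
    then have c: "h i = h 0" if "i < N" for i using that N by blast
    have "(\<Sum>i<N. h i) = (\<Sum>i<N. h 0)" by (rule sum.cong[OF refl]) (rule c, simp)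
    then have "(\<Sum>i<N. h i) = N * h 0" by simp
    then have "h 0 > 0" using sumh N by (simp add: zero_less_mult_iff)
    have "q \<rho> = (\<Sum>i<N. \<rho> i * h 0)" unfolding qh
      by (rule sum.cong[OF refl], rule arg_cong[where f = "\<lambda>x. _ * x"], rule c) simp
    also have "\<dots> = N * h 0" by (simp add: sumN flip: sum_distrib_right)
    also have "\<dots> > 0" using \<open>h 0 > 0\<close> N by simp
    finally show False using q_le unfolding q_def by linarith
  qed
  then obtain i0 j0 where ij: "i0 < N" "j0 < N" "h i0 \<noteq> h j0" by blast
  have "(\<Sum>i<N. (1 / \<rho> i) * v i) \<le> 0" if "(\<Sum>i<N. v i) = 0" "(\<Sum>i<N. h i * v i) < 0" for v
    using var that by blast
  from multiplier_of_one_sided_variations[OF N this ij]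
  obtain a b where b0: "b \<ge> 0" and ab: "\<And>i. i < N \<Longrightarrow> 1 / \<rho> i = a + b * h i" by metis
  have qneg: "q \<rho> \<le> 0" using q_le unfolding q_def .
  \<comment> \<open>With \<open>b = 0\<close> all entries coincide, the length constraint makes them
    1, and the area equals the positive sum of \<open>h\<close>.\<close>
  have "b \<noteq> 0"
  proof
    assume "b = 0"
    then have c: "\<rho> i = 1 / a" if "i < N" for i using ab[OF that] pos[OF that] \<open>b = 0\<close> by (metis add_0_right divide_divide_eq_right div_by_1 mult_1 mult_zero_left)
    have "real N = N / a" using c sumN by simp
    then have "a \<noteq> 0" using N by (intro notI) simp
    then have "1 / a = 1" using N \<open>real N = N / a\<close> by (simp add: field_simps)
    then have "q \<rho> = (\<Sum>i<N. h i)" unfolding qh using c by simp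
    then show False using sumh qneg by simp
  qed
  then have bpos: "b > 0" using b0 by simp
  \<comment> \<open>If the constraint were slack, mass could be moved freely between any two
    indices. That makes \<open>1 / \<rho>\<close> constant, hence \<open>h\<close> too because
    \<open>b > 0\<close>.\<close>
  have q0: "q \<rho> = 0"
  proof (rule ccontr)
    assume "q \<rho> \<noteq> 0"
    then have neg: "q \<rho> < 0" using qneg by simp
    have "1 / \<rho> i0 \<le> 1 / \<rho> j0" if ij: "i0 < N" "j0 < N" "i0 \<noteq> j0" for i0 j0
    proof -
      define v :: "nat \<Rightarrow> real" where "v = (\<lambda>i. (if i = i0 then 1 else 0) - (if i = j0 then 1 else 0))"
      have v0: "(\<Sum>i<N. v i) = 0" using ij by (simp add: v_def sum_subtractf)
      have "(\<Sum>i<N. (1 / \<rho> i) * v i) =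
          (\<Sum>i<N. (if i = i0 then 1 / \<rho> i else 0) - (if i = j0 then 1 / \<rho> i else 0))"
        by (intro sum.cong) (auto simp: v_def)
      also have "\<dots> = 1 / \<rho> i0 - 1 / \<rho> j0" using ij by (simp add: sum_subtractf)
      finally show ?thesis using var[OF v0 disjI1[OF neg]] by linarith
    qed
    from this[of i0 j0] this[of j0 i0] have "1 / \<rho> i0 = 1 / \<rho> j0" using ij by force
    then show False using ab[OF ij(1)] ab[OF ij(2)] ij(3) bpos by simp
  qed
  \<comment> \<open>Multiplying the multiplier equation by \<open>\<rho> i\<close> and summing gives
    \<open>N = a * N + b * q \<rho>\<close>.\<close>
  have a1: "a = 1"
  proof -
    have "real N = (\<Sum>i<N. \<rho> i * (1 / \<rho> i))" using pos by (simp add: less_imp_neq[symmetric])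
    also have "\<dots> = (\<Sum>i<N. \<rho> i * a + b * (\<rho> i * h i))"
      using ab by (intro sum.cong) (auto simp: algebra_simps)
    also have "\<dots> = N * a + b * q \<rho>"
      unfolding qh by (simp add: sum.distrib sumN flip: sum_distrib_left sum_distrib_right)
    finally show ?thesis using q0 N by simp
  qed
  show ?thesis
    using that[OF bpos] ab a1 q0 unfolding qh h_def by auto
qed

text \<open>A small \<open>b\<close> puts \<open>\<rho>\<close> close to 1, so the sum of
  \<open>\<rho> i * h i\<close> would be close to the sum of \<open>h i\<close> and could not
  vanish. The first threshold keeps \<open>1 + b * h i\<close> above 1/2, hence
  \<open>\<rho> i \<le> 2\<close>; the second keeps the error \<open>2 * b * H^2\<close> per index
  below 1/2.\<close>

lemma multiplier_lower_bound:
  fixes k h \<rho> :: "nat \<Rightarrow> real"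
  assumes N: "0 < N" and b: "b > 0" and pos: "\<And>i. i < N \<Longrightarrow> \<rho> i > 0"
    and k: "\<And>i. i < N \<Longrightarrow> 1 / \<rho> i = 1 + b * h i"
    and hb: "\<And>i. i < N \<Longrightarrow> \<bar>h i\<bar> \<le> H" and H: "H > 0"
    and q0: "(\<Sum>i<N. \<rho> i * h i) = 0"
    and sumh: "(\<Sum>i<N. h i) \<ge> N / 2"
  shows "min (1 / (2 * H)) (1 / (4 * H\<^sup>2)) \<le> b"
proof (rule ccontr)
  assume "\<not> ?thesis"
  then have "b < 1 / (2 * H)" "b < 1 / (4 * H\<^sup>2)" by auto
  then have b1: "b * H < 1 / 2" and b2: "b * H\<^sup>2 < 1 / 4" using H by (auto simp: field_simps)
  have "h i - \<rho> i * h i \<le> 2 * b * H\<^sup>2" if "i < N" for i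
  proof -
    have "b * \<bar>h i\<bar> \<le> b * H" using hb[OF that] b by simp
    then have "\<bar>b * h i\<bar> \<le> b * H" using b by (simp add: abs_mult)
    then have kk: "1 + b * h i \<ge> 1 / 2" using b1 by linarith
    have rho: "\<rho> i = 1 / (1 + b * h i)" using k[OF that] pos[OF that] by (metis inverse_eq_divide inverse_inverse_eq)
    then have "\<rho> i \<le> 2" using kk by (simp add: divide_le_eq)
    have "h i - \<rho> i * h i = \<rho> i * (b * (h i)\<^sup>2)"
      using kk unfolding rho by (simp add: field_simps power2_eq_square)
    also have "\<dots> \<le> 2 * (b * H\<^sup>2)" using \<open>\<rho> i \<le> 2\<close> pos[OF that] b hb[OF that]
      by (intro mult_mono) (auto simp: power2_le_iff_abs_le intro!: mult_left_mono abs_le_square_iff[THEN iffD1] )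
    finally show ?thesis by simp
  qed
  then have "(\<Sum>i<N. h i - \<rho> i * h i) \<le> (\<Sum>i<N. 2 * b * H\<^sup>2)" by (intro sum_mono) auto
  then have "real N / 2 \<le> N * (2 * b * H\<^sup>2)" using sumh q0 by (simp add: sum_subtractf)
  then have "b * H\<^sup>2 \<ge> 1 / 4" using N by simp
  then show False using b2 by simp
qed

text \<open>Where \<open>h\<close> exceeds 1/4, \<open>-ln (\<rho> i)\<close> is at least
  \<open>L = ln (1 + b / 4)\<close>. Since \<open>h\<close> is bounded by \<open>H\<close> and has
  mean at least 1/2, this happens for a fixed fraction of the indices, so a large \<open>b\<close>
  would push the entropy below its bound.\<close>

lemma multiplier_upper_bound:
  fixes h \<rho> :: "nat \<Rightarrow> real"
  assumes N: "0 < N" and b: "b > 0" and pos: "\<And>i. i < N \<Longrightarrow> \<rho> i > 0"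
    and sumN: "(\<Sum>i<N. \<rho> i) = N"
    and k: "\<And>i. i < N \<Longrightarrow> 1 / \<rho> i = 1 + b * h i"
    and hb: "\<And>i. i < N \<Longrightarrow> \<bar>h i\<bar> \<le> H" and H: "H \<ge> 1 / 4"
    and sumh: "(\<Sum>i<N. h i) \<ge> N / 2"
    and ent: "(\<Sum>i<N. ln (\<rho> i)) \<ge> - (C * N)"
  shows "b \<le> 4 * exp (4 * H * (C + 1))"
proof -
  define L where "L = ln (1 + b / 4)"
  have L: "L \<ge> 0" unfolding L_def using b by simp
  \<comment> \<open>A Markov-type weight: the factor of \<open>L\<close> is at most 1 where
    \<open>h i \<ge> 1 / 4\<close> and negative elsewhere. The term \<open>\<rho> i\<close>, whose
    sum is N, absorbs the indices with \<open>ln (\<rho> i) > 0\<close>.\<close>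
  have pt: "(h i - 1 / 4) / H * L - \<rho> i \<le> - ln (\<rho> i)" if "i < N" for i
  proof (cases "h i \<ge> 1 / 4")
    case True
    have "- ln (\<rho> i) = ln (1 + b * h i)" using pos[OF that] k[OF that] 
      by (metis ln_inverse inverse_eq_divide)
    also have "\<dots> \<ge> L" unfolding L_def using b True by (subst ln_le_cancel_iff) (auto simp: add_pos_pos)
    finally have "L \<le> - ln (\<rho> i)" .
    moreover have "(h i - 1 / 4) / H * L \<le> 1 * L"
      using hb[OF that] True H L by (intro mult_right_mono) (auto simp: field_simps)
    ultimately show ?thesis using pos[OF that] by simp
  next
    case False
    have "ln (\<rho> i) \<le> \<rho> i - 1" using ln_le_minus_one[OF pos[OF that]] .
    moreover have "(h i - 1 / 4) / H * L \<le> 0"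
      using False H L by (intro mult_nonpos_nonneg) (auto simp: field_simps)
    ultimately show ?thesis by simp
  qed
  have "(\<Sum>i<N. (h i - 1 / 4) / H * L - \<rho> i) \<le> (\<Sum>i<N. - ln (\<rho> i))" by (intro sum_mono pt) auto
  also have "\<dots> \<le> C * N" using ent by (simp add: sum_negf)
  also have "(\<Sum>i<N. (h i - 1 / 4) / H * L - \<rho> i) = ((\<Sum>i<N. h i) - N / 4) / H * L - N"
    by (simp add: sum_subtractf sumN flip: sum_distrib_right sum_divide_distrib)
  finally have 1: "((\<Sum>i<N. h i) - N / 4) / H * L \<le> (C + 1) * N" by (simp add: algebra_simps)
  have "(N / 4) / H * L \<le> ((\<Sum>i<N. h i) - N / 4) / H * L"
    using sumh H L by (intro mult_right_mono divide_right_mono) auto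
  with 1 have "(N / 4) / H * L \<le> (C + 1) * N" by linarith
  then have "N * L \<le> N * (4 * H * (C + 1))" using H by (simp add: field_simps)
  then have "L \<le> 4 * H * (C + 1)" using N by (subst (asm) mult_le_cancel_left_pos) auto
  then have "1 + b / 4 \<le> exp (4 * H * (C + 1))" unfolding L_def using b 
    by (smt (verit) exp_le_cancel_iff exp_ln divide_pos_pos)
  then show ?thesis by linarith
qed

text \<open>
  The competitor \<open>\<rho>0\<close> below, nearly a point mass at index \<open>0\<close>, has entropy at least \<open>N ln \<eta>\<close>; this is
  what makes the bounds on \<open>b\<close> independent of \<open>N\<close>.
\<close>
lemma discrete_solution:
  fixes Q :: "nat \<Rightarrow> nat \<Rightarrow> real"
  assumes N: "0 < N"
    and sym: "\<And>i j. Q i j = Q j i"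
    and bound: "\<And>i j. i < N \<Longrightarrow> j < N \<Longrightarrow> \<bar>Q i j\<bar> \<le> H / N"
    and neg: "Q 0 0 \<le> - (g / N)" and g: "g > 0"
    and row: "\<And>j. j < N \<Longrightarrow> (\<Sum>i<N. Q i j) \<ge> 1 / 2"
  obtains \<rho> :: "nat \<Rightarrow> real" and b :: real where "\<And>i. i < N \<Longrightarrow> \<rho> i > 0" "(\<Sum>i<N. \<rho> i) = N"
    "\<And>i. i < N \<Longrightarrow> 1 / \<rho> i = 1 + b * (\<Sum>j<N. Q i j * \<rho> j)"
    "min (1 / (2 * H)) (1 / (4 * H\<^sup>2)) \<le> b" "b \<le> 4 * exp (4 * H * (1 - ln (g / (12 * H))))"
proof -
  have gH: "g \<le> H"
  proof -
    have "g / N \<le> H / N" using bound[of 0 0] neg N by auto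
    then show ?thesis using N by (simp add: divide_le_cancel)
  qed
  have H0: "H > 0" using gH g by simp
  have H12: "H \<ge> 1 / 2"
  proof -
    have "1 / 2 \<le> (\<Sum>i<N. Q i 0)" using row[of 0] N by simp
    also have "\<dots> \<le> (\<Sum>i<N. H / N)" using bound[of _ 0] N by (intro sum_mono) (auto dest: abs_le_D1)
    also have "\<dots> = H" using N by simp
    finally show ?thesis .
  qed
  \<comment> \<open>A background \<open>\<eta>\<close> is added to a point mass of size
    \<open>(1 - \<eta>) * N\<close>. The background contributes to the area at most multiples of
    \<open>\<eta> * H\<close>, while the self-interaction of the mass contributes
    \<open>-g = -12 * (\<eta> * H)\<close> times \<open>(1 - \<eta>)^2\<close>, both up to a factor
    N. The factor 12 leaves room because \<open>12 * (11 / 12)^2 > 2\<close>.\<close>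
  define \<eta> where "\<eta> = g / (12 * H)"
  have \<eta>: "0 < \<eta>" "\<eta> \<le> 1 / 12" "12 * (\<eta> * H) = g" using gH g H0 by (auto simp: \<eta>_def field_simps)
  define \<rho>0 where "\<rho>0 = (\<lambda>i::nat. \<eta> + (if i = 0 then (1 - \<eta>) * N else 0))"
  have pos0: "\<rho>0 i > 0" for i using \<eta> N by (auto simp: \<rho>0_def add_pos_nonneg)
  have "(\<Sum>i<N. \<rho>0 i) = N * \<eta> + (1 - \<eta>) * N" using N by (simp add: \<rho>0_def sum.distrib)
  then have sum0: "(\<Sum>i<N. \<rho>0 i) = N" by (simp add: algebra_simps)
  have rowpos: "(\<Sum>i<N. Q i j) > 0" if "j < N" for j using row[OF that] by simp
  have rowH: "(\<Sum>i<N. Q i j) \<le> H" if "j < N" for j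
  proof -
    have "(\<Sum>i<N. Q i j) \<le> (\<Sum>i<N. H / N)" using bound[of _ j] that by (intro sum_mono) (auto dest: abs_le_D1)
    also have "\<dots> = H" using N by simp
    finally show ?thesis .
  qed
  have q0: "(\<Sum>i<N. \<Sum>j<N. Q i j * \<rho>0 i * \<rho>0 j) \<le> 0"
  proof -
    have e1: "(\<Sum>j<N. Q i j * \<rho>0 j) = \<eta> * (\<Sum>j<N. Q j i) + (1 - \<eta>) * N * Q i 0" for i
    proof -
      have "(\<Sum>j<N. Q i j * \<rho>0 j) = (\<Sum>j<N. \<eta> * Q j i + (if j = 0 then (1 - \<eta>) * N * Q i 0 else 0))"
        by (intro sum.cong refl) (auto simp: \<rho>0_def algebra_simps sym[of i])
      then show ?thesis using N by (simp add: sum.distrib flip: sum_distrib_left)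
    qed
    define s where "s = (\<Sum>j<N. Q j 0)"
    have "(\<Sum>i<N. \<Sum>j<N. Q i j * \<rho>0 i * \<rho>0 j) = (\<Sum>i<N. \<rho>0 i * (\<Sum>j<N. Q i j * \<rho>0 j))"
      by (simp add: sum_distrib_left mult_ac)
    also have "\<dots> = (\<Sum>i<N. \<eta> * (\<eta> * (\<Sum>j<N. Q j i)) + \<eta> * ((1 - \<eta>) * N) * Q i 0
        + (if i = 0 then (1 - \<eta>) * N * (\<eta> * s + (1 - \<eta>) * N * Q 0 0) else 0))"
      unfolding e1 by (intro sum.cong refl) (auto simp: \<rho>0_def algebra_simps s_def)
    also have "\<dots> = \<eta> * (\<eta> * (\<Sum>i<N. \<Sum>j<N. Q j i)) + \<eta> * ((1 - \<eta>) * N) * s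
        + (1 - \<eta>) * N * (\<eta> * s + (1 - \<eta>) * N * Q 0 0)"
      using N by (simp add: sum.distrib s_def flip: sum_distrib_left)
    also have "\<dots> \<le> \<eta> * (\<eta> * (\<Sum>i<N. H)) + \<eta> * ((1 - \<eta>) * N) * H
        + (1 - \<eta>) * N * (\<eta> * H + (1 - \<eta>) * N * (- (g / N)))"
      using \<eta> rowH neg N unfolding s_def
      by (intro add_mono mult_left_mono sum_mono) auto
    also have "\<dots> = N * (\<eta> * (\<eta> * H) + 2 * (1 - \<eta>) * (\<eta> * H) - (1 - \<eta>) * (1 - \<eta>) * (12 * (\<eta> * H)))"
      unfolding \<eta>(3) using N by (simp add: field_simps)
    also have "\<dots> = N * (\<eta> * H) * (\<eta> + 2 * (1 - \<eta>) - 12 * ((1 - \<eta>) * (1 - \<eta>)))"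
      by (simp add: algebra_simps)
    also have "\<dots> \<le> 0"
    proof (rule mult_nonneg_nonpos)
      define Z where "Z = (1 - \<eta>) * (1 - \<eta>)"
      have "Z \<ge> (11 / 12) * (11 / 12)" unfolding Z_def using \<eta> by (intro mult_mono) auto
      then have "\<eta> + 2 * (1 - \<eta>) - 12 * Z \<le> 0" using \<eta>(1,2) by simp
      then show "\<eta> + 2 * (1 - \<eta>) - 12 * ((1 - \<eta>) * (1 - \<eta>)) \<le> 0" unfolding Z_def .
    qed (use \<eta> H0 in simp)
    finally show ?thesis .
  qed
  have adm0: "admissible Q N N \<rho>0" using pos0 sum0 q0 by (simp add: admissible_def)
  obtain \<rho> where adm: "admissible Q N N \<rho>"
    and max: "\<And>\<sigma>. admissible Q N N \<sigma> \<Longrightarrow> (\<Sum>i<N. ln (\<sigma> i)) \<le> (\<Sum>i<N. ln (\<rho> i))"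
    by (rule admissible_maximizer[OF adm0]) blast
  have pos: "\<And>i. i < N \<Longrightarrow> \<rho> i > 0" and sumN: "(\<Sum>i<N. \<rho> i) = N"
    using adm by (auto simp: admissible_def)
  obtain b where b: "b > 0" and k: "\<And>i. i < N \<Longrightarrow> 1 / \<rho> i = 1 + b * (\<Sum>j<N. Q i j * \<rho> j)"
    and A0: "(\<Sum>i<N. \<rho> i * (\<Sum>j<N. Q i j * \<rho> j)) = 0"
    by (rule discrete_euler_lagrange[OF N sym rowpos adm max]) blast+
  \<comment> \<open>Every entry of the competitor is at least \<open>\<eta>\<close>, and
    \<open>\<eta>\<close> is independent of N.\<close>
  have "- (- ln \<eta> * N) = (\<Sum>i<N. ln \<eta>)" by simp
  also have "\<dots> \<le> (\<Sum>i<N. ln (\<rho>0 i))" using \<eta> by (intro sum_mono) (auto simp: \<rho>0_def add_pos_nonneg)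
  also have "\<dots> \<le> (\<Sum>i<N. ln (\<rho> i))" by (rule max[OF adm0])
  finally have ent: "- (- ln \<eta> * N) \<le> (\<Sum>i<N. ln (\<rho> i))" .
  have hb: "\<bar>\<Sum>j<N. Q i j * \<rho> j\<bar> \<le> H" if "i < N" for i
  proof -
    have "\<bar>\<Sum>j<N. Q i j * \<rho> j\<bar> \<le> (\<Sum>j<N. \<bar>Q i j * \<rho> j\<bar>)" by (rule sum_abs)
    also have "\<dots> = (\<Sum>j<N. \<bar>Q i j\<bar> * \<rho> j)"
      using pos by (intro sum.cong refl) (simp add: abs_mult less_imp_le)
    also have "\<dots> \<le> (\<Sum>j<N. H / N * \<rho> j)"
      using bound[OF that] pos by (intro sum_mono mult_right_mono) (simp_all add: less_imp_le)
    also have "\<dots> = H" unfolding sum_distrib_left[symmetric] sumN using N by simp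
    finally show ?thesis .
  qed
  have sumh: "(\<Sum>i<N. \<Sum>j<N. Q i j * \<rho> j) \<ge> N / 2"
  proof -
    have "real N / 2 = (\<Sum>j<N. 1 / 2 * \<rho> j)" unfolding sum_distrib_left[symmetric] sumN by simp
    also have "\<dots> \<le> (\<Sum>j<N. (\<Sum>i<N. Q i j) * \<rho> j)"
      using row pos by (intro sum_mono mult_right_mono) (auto simp: less_imp_le)
    also have "\<dots> = (\<Sum>i<N. \<Sum>j<N. Q i j * \<rho> j)" unfolding sum_distrib_right by (rule sum.swap)
    finally show ?thesis .
  qed
  show ?thesis
  proof (rule that[OF pos sumN k])
    show "min (1 / (2 * H)) (1 / (4 * H\<^sup>2)) \<le> b"
      using multiplier_lower_bound[OF N b pos k hb H0 A0 sumh] .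
    have "b \<le> 4 * exp (4 * H * (- ln \<eta> + 1))"
      using H12 by (intro multiplier_upper_bound[OF N b pos sumN k hb _ sumh ent]) auto
    then show "b \<le> 4 * exp (4 * H * (1 - ln (g / (12 * H))))" by (simp add: \<eta>_def)
  qed auto
qed

section \<open>Passage to the limit\<close>

text \<open>
  Green's function of \<open>h'' + h\<close> for period \<open>P\<close>, valid for arguments in \<open>[0, P]\<close>. It is negative on the
  diagonal exactly because \<open>P > \<pi>\<close> (and \<open>P < 2 \<pi>\<close>).
\<close>
definition periodic_green :: "real \<Rightarrow> real \<Rightarrow> real \<Rightarrow> real" where
  "periodic_green P t s = cos (\<bar>t - s\<bar> - P / 2) / (2 * sin (P / 2))"

text \<open>The quantitative form serves the row sums of the discretised kernel, which have to be
  controlled for all rows with one N.\<close>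

lemma riemann_sum_error:
  fixes f :: "real \<Rightarrow> real" and P :: real and N :: nat
  assumes cont: "continuous_on {0..P} f" and P: "0 < P" and N: "0 < N"
    and mod: "\<And>x y. x \<in> {0..P} \<Longrightarrow> y \<in> {0..P} \<Longrightarrow> \<bar>x - y\<bar> \<le> P / real N \<Longrightarrow> \<bar>f x - f y\<bar> \<le> e"
  shows "\<bar>integral {0..P} f - P / N * (\<Sum>i<N. f (real i * P / real N))\<bar> \<le> e * P"
proof -
  have "\<bar>integral {0..j * P / N} f - P / N * (\<Sum>i<j. f (real i * P / real N))\<bar> \<le> e * (j * P / N)" if "j \<le> N" for j :: nat
    using that
  proof (induction j)
    case 0
    then show ?case by simp
  next
    case (Suc j)
    define a where "a = j * P / N"
    define b where "b = Suc j * P / N"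
    have ab: "0 \<le> a" "b = a + P / N" "b \<le> P"
      using P N Suc.prems by (auto simp: a_def b_def field_simps) 
        (metis mult_right_mono of_nat_Suc of_nat_mono less_imp_le add.commute distrib_right mult.commute mult_1)
    have le: "a \<le> b" using ab P N by simp
    have cont': "continuous_on {0..b} f" "continuous_on {a..b} f"
      using ab by (auto intro: continuous_on_subset[OF cont])
    have split: "integral {0..b} f = integral {0..a} f + integral {a..b} f"
      using Henstock_Kurzweil_Integration.integral_combine[OF ab(1) le integrable_continuous_real[OF cont'(1)]] by simp
    have "integral {a..b} (\<lambda>x. f x - f a) = integral {a..b} f - integral {a..b} (\<lambda>x. f a)"
      by (intro integral_diff integrable_continuous_real cont' continuous_intros)
    also have "integral {a..b} (\<lambda>x. f a) = (b - a) * f a" using le by simp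
    also have "b - a = P / N" using ab(2) by simp
    finally have "integral {a..b} f - P / N * f a = integral {a..b} (\<lambda>x. f x - f a)" by simp
    moreover have "norm (integral {a..b} (\<lambda>x. f x - f a)) \<le> e * (b - a)"
    proof (rule integral_bound[OF le])
      fix t assume t: "t \<in> {a..b}"
      show "norm (f t - f a) \<le> e"
        unfolding real_norm_def by (rule mod) (use t ab(1,3) ab(2) in auto)
    qed (intro continuous_intros cont')
    ultimately have step: "\<bar>integral {a..b} f - P / N * f a\<bar> \<le> e * (P / N)" using ab by simp
    have IH: "\<bar>integral {0..a} f - P / N * (\<Sum>i<j. f (real i * P / real N))\<bar> \<le> e * a"
      using Suc unfolding a_def by simp
    have "P / N * (\<Sum>i<Suc j. f (real i * P / real N)) = P / N * (\<Sum>i<j. f (real i * P / real N)) + P / N * f a"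
      by (simp add: a_def algebra_simps)
    then have "\<bar>integral {0..b} f - P / N * (\<Sum>i<Suc j. f (real i * P / real N))\<bar> \<le> e * a + e * (P / N)"
      using step IH split by linarith
    also have "\<dots> = e * b" using ab by (simp add: algebra_simps)
    finally show ?case unfolding b_def .
  qed
  from this[of N] show ?thesis using N by simp
qed

lemma riemann_sum_tendsto:
  fixes f :: "real \<Rightarrow> real" and P :: real
  assumes cont: "continuous_on {0..P} f" and P: "0 < P" 
  shows "(\<lambda>N. P / real N * (\<Sum>i<N. f (real i * P / real N))) \<longlonglongrightarrow> integral {0..P} f"
proof (rule LIMSEQ_I)
  fix r :: real assume r: "0 < r"
  have "uniformly_continuous_on {0..P} f" by (rule compact_uniformly_continuous[OF cont]) simp
  then obtain d where d: "d > 0" "\<And>x y. x \<in> {0..P} \<Longrightarrow> y \<in> {0..P} \<Longrightarrow> dist y x < d \<Longrightarrow> dist (f y) (f x) < r / (2 * P)"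
    unfolding uniformly_continuous_on_def using r P by (metis divide_pos_pos mult_pos_pos zero_less_numeral)
  obtain M where M: "P / d < real M" using reals_Archimedean2 by blast
  have M0: "M > 0" using M P d by (metis divide_pos_pos less_trans of_nat_0_less_iff)
  have "norm (P / real N * (\<Sum>i<N. f (real i * P / real N)) - integral {0..P} f) < r" if "N \<ge> M" for N
  proof -
    have "P < real M * d" using M d(1) by (simp add: pos_divide_less_eq)
    also have "\<dots> \<le> real N * d" using that d(1) by (simp add: mult_right_mono)
    finally have N: "N > 0" "P / real N < d" using that M0 by (simp_all add: pos_divide_less_eq mult.commute)
    have "\<bar>integral {0..P} f - P / N * (\<Sum>i<N. f (real i * P / real N))\<bar> \<le> r / (2 * P) * P"
      using d N by (intro riemann_sum_error cont P) (force simp: dist_real_def)+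
    also have "\<dots> < r" using P r by simp
    finally show ?thesis by (simp add: abs_minus_commute)
  qed
  then show "\<exists>no. \<forall>n\<ge>no. norm (P / real n * (\<Sum>i<n. f (real i * P / real n)) - integral {0..P} f) < r" by blast
qed

section \<open>Estimates for the periodic Green's function\<close>

lemma periodic_green_commute: "periodic_green P t s = periodic_green P s t"
  by (simp add: periodic_green_def abs_minus_commute)

lemma continuous_on_periodic_green [continuous_intros]:
  fixes f g :: "'a::t2_space \<Rightarrow> real"
  assumes "continuous_on A f" "continuous_on A g"
  shows "continuous_on A (\<lambda>x. periodic_green P (f x) (g x))"
proof (cases "sin (P / 2) = 0")
  case False
  then show ?thesis unfolding periodic_green_def by (intro continuous_intros assms) simp_all
qed (simp add: periodic_green_def)

lemma abs_cos_diff_le: "\<bar>cos x - cos y\<bar> \<le> \<bar>x - y\<bar>" for x y :: real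
proof -
  have "norm (cos x - cos y) \<le> 1 * norm (x - y)"
    by (rule differentiable_bound[of UNIV cos "\<lambda>x h. - sin x * h"])
      (auto intro!: derivative_eq_intros onorm_le simp: has_field_derivative_def[symmetric] abs_mult mult_left_le_one_le)
  then show ?thesis by simp
qed

context
  fixes P :: real
  assumes P: "pi < P" "P < 2 * pi"
begin

lemma sin_half_period: "sin (P / 2) > 0"
  using P by (intro sin_gt_zero) auto

lemma periodic_green_bound: "\<bar>periodic_green P t s\<bar> \<le> 1 / (2 * sin (P / 2))"
  using sin_half_period by (simp add: periodic_green_def abs_mult divide_right_mono)

lemma periodic_green_lipschitz:
  "\<bar>periodic_green P t s - periodic_green P t' s\<bar> \<le> 1 / (2 * sin (P / 2)) * \<bar>t - t'\<bar>"
proof -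
  have "\<bar>cos (\<bar>t - s\<bar> - P / 2) - cos (\<bar>t' - s\<bar> - P / 2)\<bar> \<le> \<bar>t - t'\<bar>"
    using abs_cos_diff_le[of "\<bar>t - s\<bar> - P / 2" "\<bar>t' - s\<bar> - P / 2"] by linarith
  then show ?thesis using sin_half_period
    by (simp add: periodic_green_def flip: diff_divide_distrib) (simp add: divide_right_mono)
qed

lemma periodic_green_diag_neg: "periodic_green P 0 0 < 0"
proof -
  have "cos (P / 2) < cos (pi / 2)" using P by (subst cos_mono_less_eq) auto
  then show ?thesis using sin_half_period by (simp add: periodic_green_def divide_less_0_iff)
qed

text \<open>The constant 1 solves \<open>h'' + h = 1\<close>, so its Green's function has to
  integrate to 1. The verification splits at the kink \<open>s = t\<close>. For the discretisation
  this means row sums close to 1.\<close>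

lemma integral_periodic_green:
  assumes t: "t \<in> {0..P}"
  shows "integral {0..P} (periodic_green P t) = 1"
proof -
  define S where "S = 2 * sin (P / 2)"
  have S: "S > 0" using sin_half_period by (simp add: S_def)
  have "((\<lambda>s. cos (t - s - P / 2) / S) has_integral (- sin (t - t - P / 2) / S - (- sin (t - 0 - P / 2) / S))) {0..t}"
    using t S by (intro fundamental_theorem_of_calculus)
      (auto intro!: derivative_eq_intros simp: has_real_derivative_iff_has_vector_derivative[symmetric])
  then have 1: "(periodic_green P t has_integral (sin (P / 2) + sin (t - P / 2)) / S) {0..t}"
    by (subst has_integral_cong[of _ _ "\<lambda>s. cos (t - s - P / 2) / S"]) 
       (auto simp: periodic_green_def S_def add_divide_distrib)
  have "((\<lambda>s. cos (s - t - P / 2) / S) has_integral (sin (P - t - P / 2) / S - sin (t - t - P / 2) / S)) {t..P}"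
    using t S by (intro fundamental_theorem_of_calculus)
      (auto intro!: derivative_eq_intros simp: has_real_derivative_iff_has_vector_derivative[symmetric])
  moreover have "sin (P - t - P / 2) = - sin (t - P / 2)"
    by (subst sin_minus[symmetric], rule arg_cong[of _ _ sin]) simp
  ultimately have 2: "(periodic_green P t has_integral (sin (P / 2) - sin (t - P / 2)) / S) {t..P}"
    by (subst has_integral_cong[of _ _ "\<lambda>s. cos (s - t - P / 2) / S"]) 
       (auto simp: periodic_green_def S_def diff_divide_distrib)
  have "(periodic_green P t has_integral (sin (P / 2) + sin (t - P / 2)) / S + (sin (P / 2) - sin (t - P / 2)) / S) {0..P}"
    using t by (intro has_integral_combine[OF _ _ 1 2]) auto
  also have "(sin (P / 2) + sin (t - P / 2)) / S + (sin (P / 2) - sin (t - P / 2)) / S = 1"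
    using S unfolding S_def by (simp flip: add_divide_distrib)
  finally show ?thesis by (rule integral_unique)
qed

end

text \<open>On an interval of length \<open>P / 2\<close> starting or ending at \<open>p\<close> the
  integral is \<open>ln (1 + M * P / (2 * e)) / M\<close>, which is unbounded as \<open>e\<close>
  tends to 0. Since \<open>p\<close> may be an end point, the side on which such an interval fits
  into \<open>[0, P]\<close> is chosen by cases.\<close>

lemma reciprocal_lipschitz_integral_unbounded:
  fixes M P p C :: real
  assumes M: "M > 0" and P: "P > 0" and p: "p \<in> {0..P}"
    and bound: "\<And>e. e > 0 \<Longrightarrow> integral {0..P} (\<lambda>t. 1 / (M * \<bar>t - p\<bar> + e)) \<le> C"
  shows False
proof -
  \<comment> \<open>Solves \<open>M * P / (2 * e) = exp (M * C)\<close>; the 1 inside the logarithm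
    then makes the inequality strict.\<close>
  define e where "e = M * P / (2 * exp (M * C))"
  have e: "e > 0" using M P by (simp add: e_def)
  have den: "M * \<bar>t - p\<bar> + e > 0" for t using M e by (intro add_nonneg_pos) auto
  define f where "f = (\<lambda>t. 1 / (M * \<bar>t - p\<bar> + e))"
  have cont: "continuous_on A f" for A unfolding f_def
    using den by (intro continuous_intros) (auto simp: less_imp_neq[symmetric])
  have f0: "f t \<ge> 0" for t using den[of t] by (simp add: f_def less_imp_le)
  have val: "ln (1 + M * P / (2 * e)) / M > C"
  proof -
    have "M * P / (2 * e) = exp (M * C)" using M P by (simp add: e_def)
    then have "ln (1 + M * P / (2 * e)) > ln (exp (M * C))" by (simp add: ln_less_cancel_iff[symmetric] add_pos_pos del: ln_exp)
    then show ?thesis using M by (simp add: field_simps)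
  qed
  have lnv: "(ln (M * (P / 2) + e) - ln e) / M = ln (1 + M * P / (2 * e)) / M"
  proof -
    have "1 + M * P / (2 * e) = (M * (P / 2) + e) / e" using e by (simp add: field_simps)
    moreover have "ln ((M * (P / 2) + e) / e) = ln (M * (P / 2) + e) - ln e"
      using e M P add_pos_pos[of "M * (P / 2)" e] by (simp add: ln_div)
    ultimately show ?thesis by simp
  qed
  have "\<exists>a b. 0 \<le> a \<and> a \<le> b \<and> b \<le> P \<and> integral {a..b} f = ln (1 + M * P / (2 * e)) / M"
  proof (cases "p \<le> P / 2")
    case True
    have "((\<lambda>t. 1 / (M * (t - p) + e)) has_integral (ln (M * (p + P / 2 - p) + e) / M - ln (M * (p - p) + e) / M)) {p..p + P / 2}"
      using P M e den by (intro fundamental_theorem_of_calculus)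
       (auto intro!: derivative_eq_intros add_nonneg_pos simp: has_real_derivative_iff_has_vector_derivative[symmetric])
    then have "(f has_integral (ln (M * (p + P / 2 - p) + e) / M - ln (M * (p - p) + e) / M)) {p..p + P / 2}"
      by (subst has_integral_cong[of _ _ "\<lambda>t. 1 / (M * (t - p) + e)"]) (auto simp: f_def)
    then have "integral {p..p + P / 2} f = ln (1 + M * P / (2 * e)) / M"
      unfolding lnv[symmetric] by (intro integral_unique) (simp add: diff_divide_distrib)
    then show ?thesis using True p P by (intro exI[of _ p] exI[of _ "p + P / 2"]) auto
  next
    case False
    have "((\<lambda>t. 1 / (M * (p - t) + e)) has_integral (- ln (M * (p - p) + e) / M - (- ln (M * (p - (p - P / 2)) + e) / M))) {p - P / 2..p}"
      using P M e den by (intro fundamental_theorem_of_calculus)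
       (auto intro!: derivative_eq_intros add_nonneg_pos simp: has_real_derivative_iff_has_vector_derivative[symmetric])
    then have "(f has_integral (- ln (M * (p - p) + e) / M - (- ln (M * (p - (p - P / 2)) + e) / M))) {p - P / 2..p}"
      by (subst has_integral_cong[of _ _ "\<lambda>t. 1 / (M * (p - t) + e)"]) (auto simp: f_def)
    then have "integral {p - P / 2..p} f = ln (1 + M * P / (2 * e)) / M"
      unfolding lnv[symmetric] by (intro integral_unique) (simp add: diff_divide_distrib)
    then show ?thesis using False p P by (intro exI[of _ "p - P / 2"] exI[of _ p]) auto
  qed
  then obtain a b where ab: "0 \<le> a" "a \<le> b" "b \<le> P" "integral {a..b} f = ln (1 + M * P / (2 * e)) / M" by blast
  have "integral {a..b} f \<le> integral {0..P} f"
    using ab f0 by (intro integral_subset_le integrable_continuous_real cont) auto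
  with ab val bound[OF e] show False unfolding f_def by linarith
qed

section \<open>Uniform discretisation and compactness\<close>

context
  fixes P :: real
  assumes P: "pi < P" "P < 2 * pi"
begin

text \<open>The point is the order of quantifiers: \<open>\<beta>\<close> and \<open>B\<close>
  depend on the kernel only and not on N.\<close>

lemma discretized_equation:
  obtains \<beta> B :: real and N0 :: nat where "\<beta> > 0" "N0 > 0"
    "\<And>N. N \<ge> N0 \<Longrightarrow> \<exists>(\<rho> :: nat \<Rightarrow> real) b. (\<forall>i<N. \<rho> i > 0) \<and> (\<Sum>i<N. \<rho> i) = N \<and> \<beta> \<le> b \<and> b \<le> B \<and>
       (\<forall>i<N. 1 / \<rho> i = 1 + b * (\<Sum>j<N. P / N * periodic_green P (i * P / N) (j * P / N) * \<rho> j))"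
proof -
  define g0 where "g0 = 1 / (2 * sin (P / 2))"
  have g0: "g0 > 0" using sin_half_period[OF P] by (simp add: g0_def)
  have P0: "P > 0" using P pi_gt_zero by linarith
  define H where "H = P * g0"
  define g where "g = - (P * periodic_green P 0 0)"
  have g: "g > 0" unfolding g_def using P0 periodic_green_diag_neg[OF P] by (simp add: mult_pos_neg)
  have H: "H > 0" unfolding H_def using P0 g0 by simp
  \<comment> \<open>From this size on the quadrature error \<open>g0 * (P / N) * P\<close> is at
    most 1/2, so the row sums, close to the exact value 1, are at least 1/2.\<close>
  obtain N0 :: nat where N0: "real N0 > 2 * P * P * g0" using reals_Archimedean2 by blast
  have "0 < 2 * P * P * g0" using P0 g0 by simp
  then have N0pos: "N0 > 0" using N0 by (metis less_trans of_nat_0_less_iff)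
  show ?thesis
  proof (rule that[of "min (1 / (2 * H)) (1 / (4 * H\<^sup>2))" N0 "4 * exp (4 * H * (1 - ln (g / (12 * H))))"])
    show "min (1 / (2 * H)) (1 / (4 * H\<^sup>2)) > 0" using H by simp
    show "N0 > 0" by fact
    fix N :: nat assume NN0: "N \<ge> N0"
    then have N: "N > 0" using N0pos by simp
    define Q where "Q = (\<lambda>(i::nat) (j::nat). P / N * periodic_green P (i * P / N) (j * P / N))"
    have bound: "\<bar>Q i j\<bar> \<le> H / N" for i j
      using periodic_green_bound[OF P, of "i * P / N" "j * P / N"] P0 N
      unfolding Q_def H_def g0_def[symmetric] abs_mult by (simp add: divide_right_mono)
    have row: "(\<Sum>i<N. Q i j) \<ge> 1 / 2" if j: "j < N" for j
    proof -
      define s where "s = j * P / N"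
      have s: "s \<in> {0..P}" using j N P0 by (auto simp: s_def field_simps)
      have "\<bar>integral {0..P} (periodic_green P s) - P / N * (\<Sum>i<N. periodic_green P s (i * P / N))\<bar> \<le> (g0 * (P / N)) * P"
      proof (rule riemann_sum_error)
        fix x y assume "\<bar>x - y\<bar> \<le> P / real N"
        then have "g0 * \<bar>x - y\<bar> \<le> g0 * (P / N)" using g0 by (intro mult_left_mono) auto
        then show "\<bar>periodic_green P s x - periodic_green P s y\<bar> \<le> g0 * (P / N)"
          using periodic_green_lipschitz[OF P, of x s y] unfolding g0_def[symmetric]
          by (simp add: periodic_green_commute[of P s])
      qed (use N P0 in \<open>auto intro!: continuous_intros\<close>)
      moreover have "(g0 * (P / N)) * P \<le> 1 / 2"
      proof -
        have "2 * P * P * g0 \<le> N" using N0 NN0 by linarith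
        then show ?thesis using N by (simp add: field_simps)
      qed
      moreover have "P / N * (\<Sum>i<N. periodic_green P s (i * P / N)) = (\<Sum>i<N. Q i j)"
        unfolding Q_def s_def sum_distrib_left by (subst periodic_green_commute) rule
      ultimately show ?thesis using integral_periodic_green[OF P s] by linarith
    qed
    have Qsym: "Q i j = Q j i" for i j unfolding Q_def by (subst periodic_green_commute) rule
    have Q00: "Q 0 0 \<le> - (g / N)" by (simp add: Q_def g_def)
    obtain \<rho> :: "nat \<Rightarrow> real" and b :: real where *: "\<And>i. i < N \<Longrightarrow> \<rho> i > 0" "(\<Sum>i<N. \<rho> i) = N"
      "\<And>i. i < N \<Longrightarrow> 1 / \<rho> i = 1 + b * (\<Sum>j<N. Q i j * \<rho> j)"
      "min (1 / (2 * H)) (1 / (4 * H\<^sup>2)) \<le> b" "b \<le> 4 * exp (4 * H * (1 - ln (g / (12 * H))))"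
      by (rule discrete_solution[OF N Qsym bound Q00 g row]) blast+
    then show "\<exists>(\<rho> :: nat \<Rightarrow> real) b. (\<forall>i<N. \<rho> i > 0) \<and> (\<Sum>i<N. \<rho> i) = N \<and> min (1 / (2 * H)) (1 / (4 * H\<^sup>2)) \<le> b \<and>
       b \<le> 4 * exp (4 * H * (1 - ln (g / (12 * H)))) \<and>
       (\<forall>i<N. 1 / \<rho> i = 1 + b * (\<Sum>j<N. P / N * periodic_green P (i * P / N) (j * P / N) * \<rho> j))"
      unfolding Q_def by (intro exI[of _ \<rho>] exI[of _ b]) blast
  qed
qed

text \<open>Arzela-Ascoli applied to the discrete curvatures, with a further subsequence for the
  multipliers. The delicate point is positivity of the limit, without which the sums over
  \<open>1 / k\<close> could not be passed to the limit.\<close>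

lemma integral_equation_solution:
  obtains k :: "real \<Rightarrow> real" and b :: real where "b > 0" "continuous_on {0..P} k"
    "\<And>t. t \<in> {0..P} \<Longrightarrow> k t > 0"
    "\<And>t. t \<in> {0..P} \<Longrightarrow> k t = 1 + b * integral {0..P} (\<lambda>s. periodic_green P t s / k s)"
    "integral {0..P} (\<lambda>s. 1 / k s) = P"
proof -
  have P0: "P > 0" using P pi_gt_zero by linarith
  define g0 where "g0 = 1 / (2 * sin (P / 2))"
  have g0: "g0 > 0" using sin_half_period[OF P] by (simp add: g0_def)
  obtain \<beta> B :: real and N0 :: nat where \<beta>: "\<beta> > 0" and N0: "N0 > 0" and ex:
    "\<And>N. N \<ge> N0 \<Longrightarrow> \<exists>(\<rho> :: nat \<Rightarrow> real) b. (\<forall>i<N. \<rho> i > 0) \<and> (\<Sum>i<N. \<rho> i) = N \<and> \<beta> \<le> b \<and> b \<le> B \<and>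
       (\<forall>i<N. 1 / \<rho> i = 1 + b * (\<Sum>j<N. P / N * periodic_green P (i * P / N) (j * P / N) * \<rho> j))"
    by (rule discretized_equation) blast
  \<comment> \<open>Shifts the index so that a discrete solution exists for every
    \<open>n\<close>.\<close>
  define \<nu> where "\<nu> n = n + N0" for n
  have \<nu>0: "\<nu> n > 0" for n using N0 by (simp add: \<nu>_def)
  define S where "S n \<rho> b \<longleftrightarrow> (\<forall>i<\<nu> n. \<rho> i > 0) \<and> (\<Sum>i<\<nu> n. \<rho> i) = \<nu> n \<and> \<beta> \<le> b \<and> b \<le> B \<and>
       (\<forall>i<\<nu> n. 1 / \<rho> i = 1 + b * (\<Sum>j<\<nu> n. P / \<nu> n * periodic_green P (i * P / \<nu> n) (j * P / \<nu> n) * \<rho> j))"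
    for n and \<rho> :: "nat \<Rightarrow> real" and b :: real
  have "\<exists>(\<rho> :: nat \<Rightarrow> real) b. S n \<rho> b" for n
    unfolding S_def by (rule ex) (simp add: \<nu>_def)
  then have "\<forall>n. \<exists>p. S n (fst p) (snd p)" by auto
  then obtain p where p: "\<And>n. S n (fst (p n)) (snd (p n))" by (metis choice)
  define R where "R n = fst (p n)" for n
  define b where "b n = snd (p n)" for n
  have S: "S n (R n) (b n)" for n using p by (simp add: R_def b_def)
  have R: "R n i > 0" if "i < \<nu> n" for n i using S[of n] that by (simp add: S_def)
  have sumR: "(\<Sum>i<\<nu> n. R n i) = \<nu> n" for n using S[of n] by (simp add: S_def)
  have b: "\<beta> \<le> b n" "b n \<le> B" for n using S[of n] by (simp_all add: S_def)
  have eq: "1 / R n i = 1 + b n * (\<Sum>j<\<nu> n. P / \<nu> n * periodic_green P (i * P / \<nu> n) (j * P / \<nu> n) * R n j)"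
    if "i < \<nu> n" for n i using S[of n] that by (simp add: S_def)
  \<comment> \<open>The right-hand side of the discrete equation, evaluated at every
    \<open>t\<close>, interpolates the grid values \<open>1 / R n i\<close> and inherits the
    Lipschitz constant of the kernel.\<close>
  define K where "K n t = 1 + b n * (\<Sum>j<\<nu> n. P / \<nu> n * periodic_green P t (j * P / \<nu> n) * R n j)" for n t
  have Kgrid: "K n (i * P / \<nu> n) = 1 / R n i" if "i < \<nu> n" for n i
    unfolding K_def using eq[OF that] by simp
  have Rgrid: "R n i = 1 / K n (i * P / \<nu> n)" if "i < \<nu> n" for n i
    using Kgrid[OF that] by simp
  define M where "M = B * P * g0"
  have B0: "B > 0" using \<beta> b[of 0] by linarith
  have M0: "M > 0" using B0 P0 g0 by (simp add: M_def)
  have b0: "b n > 0" for n using \<beta> b(1)[of n] by linarith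
  \<comment> \<open>One estimate for two purposes: \<open>a = 1\<close> gives the uniform bound on
    \<open>K n\<close>, \<open>a = \<bar>t - t'\<bar>\<close> the uniform Lipschitz bound. Only the
    total mass of \<open>R n\<close> enters, never its size at a point.\<close>
  have wsum: "\<bar>b n * (\<Sum>j<\<nu> n. P / \<nu> n * f j * R n j)\<bar> \<le> M * a"
    if f: "\<And>j. \<bar>f j\<bar> \<le> g0 * a" and a: "a \<ge> 0" for n f a
  proof -
    have "\<bar>\<Sum>j<\<nu> n. P / \<nu> n * f j * R n j\<bar> \<le> (\<Sum>j<\<nu> n. \<bar>P / \<nu> n * f j * R n j\<bar>)" by (rule sum_abs)
    also have "\<dots> = (\<Sum>j<\<nu> n. P / \<nu> n * \<bar>f j\<bar> * R n j)"
      using R P0 by (intro sum.cong refl) (simp add: abs_mult less_imp_le)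
    also have "\<dots> \<le> (\<Sum>j<\<nu> n. P / \<nu> n * (g0 * a) * R n j)"
      using R P0 f by (intro sum_mono mult_right_mono mult_left_mono) (auto simp: less_imp_le)
    also have "\<dots> = P * g0 * a" unfolding sum_distrib_left[symmetric] sumR using \<nu>0[of n] by simp
    finally have "\<bar>\<Sum>j<\<nu> n. P / \<nu> n * f j * R n j\<bar> \<le> P * g0 * a" .
    then have "b n * \<bar>\<Sum>j<\<nu> n. P / \<nu> n * f j * R n j\<bar> \<le> B * (P * g0 * a)"
      using b(2)[of n] B0 by (intro mult_mono) auto
    then show ?thesis using b0[of n] by (simp add: abs_mult M_def mult_ac)
  qed
  have Klip: "\<bar>K n t - K n t'\<bar> \<le> M * \<bar>t - t'\<bar>" for n t t'
  proof -
    have "K n t - K n t' = b n * (\<Sum>j<\<nu> n. P / \<nu> n * (periodic_green P t (j * P / \<nu> n) - periodic_green P t' (j * P / \<nu> n)) * R n j)"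
      unfolding K_def by (simp add: algebra_simps sum_subtractf)
    also have "\<bar>\<dots>\<bar> \<le> M * \<bar>t - t'\<bar>"
      using periodic_green_lipschitz[OF P] unfolding g0_def[symmetric] by (intro wsum) auto
    finally show ?thesis .
  qed
  have Kbd: "\<bar>K n t\<bar> \<le> 1 + M" for n t
    using wsum[of "\<lambda>j. periodic_green P t (j * P / \<nu> n)" 1 n] periodic_green_bound[OF P]
    unfolding K_def g0_def[symmetric] by (smt (verit))
  obtain k and r :: "nat \<Rightarrow> nat" where kcont: "continuous_on {0..P} k" and r: "strict_mono r"
    and unif: "\<And>e. 0 < e \<Longrightarrow> \<exists>N. \<forall>n x. n \<ge> N \<and> x \<in> {0..P} \<longrightarrow> norm (K (r n) x - k x) < e"
  proof (rule Arzela_Ascoli[of "{0..P}" K "1 + M"])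
    fix x e :: real assume "e > 0"
    show "\<exists>d>0. \<forall>n y. y \<in> {0..P} \<and> norm (x - y) < d \<longrightarrow> norm (K n x - K n y) < e"
    proof (intro exI[of _ "e / M"] conjI allI impI)
      fix n y assume "y \<in> {0..P} \<and> norm (x - y) < e / M"
      then have "M * \<bar>x - y\<bar> < e" using M0 by (simp add: field_simps)
      then show "norm (K n x - K n y) < e" using Klip[of n x y] by simp
    qed (use M0 \<open>e > 0\<close> in simp)
  qed (use Kbd in auto)
  have "compact {\<beta>..B}" by simp
  moreover have "\<forall>n. (b \<circ> r) n \<in> {\<beta>..B}" using b by simp
  ultimately obtain bl q where bl: "bl \<in> {\<beta>..B}" and q: "strict_mono (q :: nat \<Rightarrow> nat)" and blim: "((b \<circ> r) \<circ> q) \<longlonglongrightarrow> bl"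
    unfolding compact_def by metis
  define \<sigma> where "\<sigma> = r \<circ> q"
  have \<sigma>: "strict_mono \<sigma>" unfolding \<sigma>_def using r q by (rule strict_mono_o)
  have blim': "(\<lambda>n. b (\<sigma> n)) \<longlonglongrightarrow> bl" using blim by (simp add: \<sigma>_def o_def)
  have unif': "\<forall>\<^sub>F n in sequentially. \<forall>x\<in>{0..P}. \<bar>K (\<sigma> n) x - k x\<bar> < e" if "e > 0" for e
  proof -
    from unif[OF that] obtain N where N: "\<forall>n x. n \<ge> N \<and> x \<in> {0..P} \<longrightarrow> norm (K (r n) x - k x) < e" by blast
    have "\<forall>x\<in>{0..P}. \<bar>K (\<sigma> n) x - k x\<bar> < e" if "n \<ge> N" for n
    proof -
      have "q n \<ge> N" using seq_suble[OF q, of n] that by linarith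
      then show ?thesis using N by (simp add: \<sigma>_def)
    qed
    then show ?thesis unfolding eventually_sequentially by blast
  qed
  define \<mu> where "\<mu> = \<nu> \<circ> \<sigma>"
  have "strict_mono \<mu>" unfolding \<mu>_def using \<sigma> by (auto simp: strict_mono_def \<nu>_def)
  have \<mu>0: "\<mu> n > 0" for n using \<nu>0 by (simp add: \<mu>_def)
  have riem: "(\<lambda>n. P / \<mu> n * (\<Sum>i<\<mu> n. f (i * P / \<mu> n))) \<longlonglongrightarrow> integral {0..P} f"
    if "continuous_on {0..P} f" for f
    using LIMSEQ_subseq_LIMSEQ[OF riemann_sum_tendsto[OF that P0] \<open>strict_mono \<mu>\<close>] by (simp add: o_def)
  have grid: "i * P / \<mu> n \<in> {0..P}" if "i < \<mu> n" for i n
    using that P0 by (auto simp: field_simps)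
  have ptw: "(\<lambda>n. K (\<sigma> n) x) \<longlonglongrightarrow> k x" if "x \<in> {0..P}" for x
    using unif' that unfolding tendsto_iff dist_real_def by (fastforce elim: eventually_mono)
  have klip: "\<bar>k x - k y\<bar> \<le> M * \<bar>x - y\<bar>" if "x \<in> {0..P}" "y \<in> {0..P}" for x y
    by (rule tendsto_upperbound[OF tendsto_rabs[OF tendsto_diff[OF ptw ptw]]]) (use that Klip in auto)
  \<comment> \<open>If \<open>k p \<le> 0\<close>, then
    \<open>k x \<le> M * \<bar>x - p\<bar>\<close>, and eventually \<open>R\<close> dominates
    \<open>1 / (M * \<bar>x - p\<bar> + e)\<close> on the grid. Its fixed mass then bounds the
    integral of this function by \<open>P\<close> for every \<open>e > 0\<close>, which is
    impossible.\<close>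
  have kpos: "k p > 0" if p: "p \<in> {0..P}" for p
  proof (rule ccontr)
    assume np: "\<not> k p > 0"
    show False
    proof (rule reciprocal_lipschitz_integral_unbounded[OF M0 P0 p, of P])
      fix e :: real assume e: "e > 0"
      define f where "f = (\<lambda>t. 1 / (M * \<bar>t - p\<bar> + e))"
      have den: "M * \<bar>t - p\<bar> + e > 0" for t using M0 e by (intro add_nonneg_pos) auto
      have fc: "continuous_on {0..P} f" unfolding f_def
        using den by (intro continuous_intros) (auto simp: less_imp_neq[symmetric])
      have "\<forall>\<^sub>F n in sequentially. P / \<mu> n * (\<Sum>i<\<mu> n. f (i * P / \<mu> n)) \<le> P"
        using unif'[OF e]
      proof eventually_elim
        case (elim n)
        have "f (i * P / \<mu> n) \<le> R (\<sigma> n) i" if i: "i < \<mu> n" for i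
        proof -
          define x where "x = i * P / \<mu> n"
          have x: "x \<in> {0..P}" unfolding x_def using grid[OF i] .
          have i': "i < \<nu> (\<sigma> n)" using i by (simp add: \<mu>_def)
          have "k x \<le> M * \<bar>x - p\<bar>" using klip[OF x p] np by linarith
          then have "K (\<sigma> n) x \<le> M * \<bar>x - p\<bar> + e" using elim x by (smt (verit))
          moreover have "K (\<sigma> n) x = 1 / R (\<sigma> n) i" using Kgrid[OF i'] by (simp add: x_def \<mu>_def)
          moreover have "R (\<sigma> n) i > 0" by (rule R[OF i'])
          ultimately have "1 / R (\<sigma> n) i \<le> M * \<bar>x - p\<bar> + e" by simp
          then have "1 \<le> (M * \<bar>x - p\<bar> + e) * R (\<sigma> n) i" using \<open>R (\<sigma> n) i > 0\<close> by (simp add: pos_divide_le_eq)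
          then show ?thesis unfolding f_def x_def[symmetric] using den[of x] by (simp add: pos_divide_le_eq mult.commute)
        qed
        then have "(\<Sum>i<\<mu> n. f (i * P / \<mu> n)) \<le> (\<Sum>i<\<mu> n. R (\<sigma> n) i)" by (intro sum_mono) auto
        also have "\<dots> = \<mu> n" using sumR by (simp add: \<mu>_def)
        finally have "P / \<mu> n * (\<Sum>i<\<mu> n. f (i * P / \<mu> n)) \<le> P / \<mu> n * \<mu> n"
          using P0 by (intro mult_left_mono) auto
        then show ?case using \<mu>0[of n] by simp
      qed
      then show "integral {0..P} f \<le> P"
        by (intro tendsto_upperbound[OF riem[OF fc]]) auto
    qed
  qed
  obtain c where c: "c > 0" "\<And>x. x \<in> {0..P} \<Longrightarrow> k x \<ge> c"
  proof -
    have "{0..P} \<noteq> {}" using P0 by simp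
    then obtain x where "x \<in> {0..P}" "\<forall>y\<in>{0..P}. k x \<le> k y"
      using continuous_attains_inf[OF _ _ kcont] by blast
    then show ?thesis using kpos that by blast
  qed
  \<comment> \<open>The sums against \<open>R\<close> differ from ordinary Riemann sums of
    \<open>f / k\<close> by a vanishing amount, because \<open>K\<close> converges to
    \<open>k\<close> uniformly and \<open>k\<close> stays above \<open>c > 0\<close>.\<close>
  have weighted: "(\<lambda>n. P / \<mu> n * (\<Sum>i<\<mu> n. f (i * P / \<mu> n) * R (\<sigma> n) i)) \<longlonglongrightarrow> integral {0..P} (\<lambda>s. f s / k s)"
    if f: "continuous_on {0..P} f" and fb: "\<And>s. s \<in> {0..P} \<Longrightarrow> \<bar>f s\<bar> \<le> A" for f A
  proof -
    have A0: "A \<ge> 0" using fb[of 0] P0 by auto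
    have fk: "continuous_on {0..P} (\<lambda>s. f s / k s)"
      using kpos by (intro continuous_intros f kcont) (auto simp: less_imp_neq[symmetric])
    have "(\<lambda>n. P / \<mu> n * (\<Sum>i<\<mu> n. f (i * P / \<mu> n) * R (\<sigma> n) i) - P / \<mu> n * (\<Sum>i<\<mu> n. f (i * P / \<mu> n) / k (i * P / \<mu> n))) \<longlonglongrightarrow> 0"
    proof (rule tendstoI)
      fix e :: real assume e: "e > 0"
      \<comment> \<open>Chosen so that, with \<open>K\<close> above \<open>c / 2\<close> and
        \<open>k\<close> above \<open>c\<close>, each summand is off by at most
        \<open>e / (2 * P)\<close>, hence the weighted sum by at most \<open>e / 2\<close>.\<close>
      define e' where "e' = e * c * c / (4 * P * (A + 1))"
      have e': "e' > 0" using e c P0 A0 by (simp add: e'_def)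
      have ev: "\<forall>\<^sub>F n in sequentially. \<forall>x\<in>{0..P}. \<bar>K (\<sigma> n) x - k x\<bar> < min e' (c / 2)"
        using e' c by (intro unif') auto
      then show "\<forall>\<^sub>F n in sequentially. dist (P / \<mu> n * (\<Sum>i<\<mu> n. f (i * P / \<mu> n) * R (\<sigma> n) i) - P / \<mu> n * (\<Sum>i<\<mu> n. f (i * P / \<mu> n) / k (i * P / \<mu> n))) 0 < e"
      proof eventually_elim
        case (elim n)
        have tm: "\<bar>f (i * P / \<mu> n) * R (\<sigma> n) i - f (i * P / \<mu> n) / k (i * P / \<mu> n)\<bar> \<le> e / (2 * P)" if i: "i < \<mu> n" for i
        proof -
          define x where "x = i * P / \<mu> n"
          have x: "x \<in> {0..P}" unfolding x_def using grid[OF i] .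
          define y where "y = K (\<sigma> n) x"
          have Ry: "R (\<sigma> n) i = 1 / y" using Rgrid[of i "\<sigma> n"] i by (simp add: x_def y_def \<mu>_def)
          have y: "\<bar>y - k x\<bar> < e'" "\<bar>y - k x\<bar> < c / 2" using elim x by (auto simp: y_def)
          have kx: "k x \<ge> c" using c x by simp
          have yc: "y \<ge> c / 2" using y kx by linarith
          have "f x * (1 / y) - f x / k x = f x * ((k x - y) / (y * k x))"
            using yc kx c by (simp add: field_simps)
          also have "\<bar>\<dots>\<bar> = \<bar>f x\<bar> * (\<bar>y - k x\<bar> / (y * k x))"
            using yc kx c by (simp add: abs_mult abs_minus_commute)
          also have "\<dots> \<le> (A + 1) * (e' / (c / 2 * c))"
            using fb[OF x] y yc kx c A0 e' by (intro mult_mono frac_le) auto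
          also have "\<dots> = e / (2 * P)"
          proof -
            define a where "a = A + 1"
            have "a > 0" using A0 by (simp add: a_def)
            then show ?thesis using c(1) P0 unfolding e'_def a_def[symmetric] by (simp add: field_simps)
          qed
          finally show ?thesis unfolding Ry x_def[symmetric] .
        qed
        have "\<bar>\<Sum>i<\<mu> n. f (i * P / \<mu> n) * R (\<sigma> n) i - f (i * P / \<mu> n) / k (i * P / \<mu> n)\<bar>
          \<le> (\<Sum>i<\<mu> n. \<bar>f (i * P / \<mu> n) * R (\<sigma> n) i - f (i * P / \<mu> n) / k (i * P / \<mu> n)\<bar>)" by (rule sum_abs)
        also have "\<dots> \<le> (\<Sum>i<\<mu> n. e / (2 * P))" using tm by (intro sum_mono) auto
        finally have "P / \<mu> n * \<bar>\<Sum>i<\<mu> n. f (i * P / \<mu> n) * R (\<sigma> n) i - f (i * P / \<mu> n) / k (i * P / \<mu> n)\<bar>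
           \<le> P / \<mu> n * (\<mu> n * (e / (2 * P)))" using P0 by (intro mult_left_mono) auto
        also have "\<dots> < e" using P0 \<mu>0[of n] e by simp
        finally show ?case using P0
          unfolding dist_real_def diff_0_right right_diff_distrib[symmetric] sum_subtractf abs_mult by simp
      qed
    qed
    from tendsto_add[OF this riem[OF fk]] show ?thesis by simp
  qed
  have int1: "integral {0..P} (\<lambda>s. 1 / k s) = P"
  proof (rule LIMSEQ_unique)
    show "(\<lambda>n. P / \<mu> n * (\<Sum>i<\<mu> n. 1 * R (\<sigma> n) i)) \<longlonglongrightarrow> integral {0..P} (\<lambda>s. 1 / k s)"
      by (rule weighted[of _ 1]) auto
    have "P / \<mu> n * (\<Sum>i<\<mu> n. 1 * R (\<sigma> n) i) = P" for n
      using sumR[of "\<sigma> n"] \<mu>0[of n] by (simp add: \<mu>_def)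
    then show "(\<lambda>n. P / \<mu> n * (\<Sum>i<\<mu> n. 1 * R (\<sigma> n) i)) \<longlonglongrightarrow> P" by simp
  qed
  have inteq: "k t = 1 + bl * integral {0..P} (\<lambda>s. periodic_green P t s / k s)" if t: "t \<in> {0..P}" for t
  proof (rule LIMSEQ_unique[OF ptw[OF t]])
    have "(\<lambda>n. 1 + b (\<sigma> n) * (P / \<mu> n * (\<Sum>i<\<mu> n. periodic_green P t (i * P / \<mu> n) * R (\<sigma> n) i)))
       \<longlonglongrightarrow> 1 + bl * integral {0..P} (\<lambda>s. periodic_green P t s / k s)"
      by (intro tendsto_intros blim' weighted[of _ g0] continuous_intros) (simp add: g0_def periodic_green_bound[OF P])
    then show "(\<lambda>n. K (\<sigma> n) t) \<longlonglongrightarrow> 1 + bl * integral {0..P} (\<lambda>s. periodic_green P t s / k s)"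
      unfolding K_def \<mu>_def by (simp add: sum_distrib_left mult.assoc)
  qed
  show ?thesis using that[OF _ kcont kpos inteq int1] bl \<beta> by auto
qed

end

section \<open>Periodic solutions of the curvature equation\<close>

definition periodic_extension :: "real \<Rightarrow> (real \<Rightarrow> real) \<Rightarrow> real \<Rightarrow> real" where
  "periodic_extension P f t = f (t - of_int \<lfloor>t / P\<rfloor> * P)"

lemma floor_remainder_bounds:
  fixes P t :: real
  assumes "P > 0"
  shows "0 \<le> t - of_int \<lfloor>t / P\<rfloor> * P" "t - of_int \<lfloor>t / P\<rfloor> * P < P"
proof -
  have "of_int \<lfloor>t / P\<rfloor> \<le> t / P" "t / P < of_int \<lfloor>t / P\<rfloor> + 1" by linarith+
  then show "0 \<le> t - of_int \<lfloor>t / P\<rfloor> * P" "t - of_int \<lfloor>t / P\<rfloor> * P < P"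
    unfolding pos_le_divide_eq[OF assms] pos_divide_less_eq[OF assms] by (simp_all add: distrib_right)
qed

lemma periodic_extension_add_period:
  assumes "P > 0"
  shows "periodic_extension P f (t + P) = periodic_extension P f t"
proof -
  have "\<lfloor>(t + P) / P\<rfloor> = \<lfloor>t / P\<rfloor> + 1" using assms by (simp add: add_divide_distrib)
  then show ?thesis by (simp add: periodic_extension_def algebra_simps)
qed

text \<open>The right end point is included, at the price of \<open>f 0 = f P\<close>, so that
  neighbouring closed pieces share a point and continuity can be glued across it.\<close>

lemma periodic_extension_eq:
  assumes "P > 0" "f 0 = f P" "t \<in> {of_int j * P..(of_int j + 1) * P}"
  shows "periodic_extension P f t = f (t - of_int j * P)"
proof (cases "t = (of_int j + 1) * P")
  case True
  then have "\<lfloor>t / P\<rfloor> = j + 1" using assms by simp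
  then show ?thesis using True assms(2) by (simp add: periodic_extension_def algebra_simps)
next
  case False
  then have "\<lfloor>t / P\<rfloor> = j" using assms by (intro floor_unique) (auto simp: field_simps)
  then show ?thesis by (simp add: periodic_extension_def)
qed

lemma continuous_on_periodic_extension:
  assumes P: "P > 0" and f: "f 0 = f P" and cont: "continuous_on {0..P} f"
  shows "continuous_on UNIV (periodic_extension P f)"
proof -
  have seg: "continuous_on {of_int j * P..(of_int j + 1) * P} (periodic_extension P f)" for j :: int
  proof -
    have "continuous_on {of_int j * P..(of_int j + 1) * P} (\<lambda>t. f (t - of_int j * P))"
      by (rule continuous_on_compose2[OF cont]) (auto intro!: continuous_intros simp: algebra_simps)
    then show ?thesis
      using periodic_extension_eq[OF P f] by (subst continuous_on_cong[OF refl]) auto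
  qed
  have "isCont (periodic_extension P f) t" for t
  proof -
    define j where "j = \<lfloor>t / P\<rfloor>"
    have "continuous_on ({of_int (j - 1) * P..(of_int (j - 1) + 1) * P} \<union> {of_int j * P..(of_int j + 1) * P}) (periodic_extension P f)"
      by (intro continuous_on_closed_Un seg) auto
    then have "continuous_on {of_int (j - 1) * P<..<(of_int j + 1) * P} (periodic_extension P f)"
      by (rule continuous_on_subset) (use P in \<open>auto simp: algebra_simps\<close>)
    moreover have "t \<in> {of_int (j - 1) * P<..<(of_int j + 1) * P}"
      using floor_remainder_bounds[OF P, of t] P by (auto simp: j_def algebra_simps)
    ultimately show ?thesis by (simp add: continuous_on_eq_continuous_at)
  qed
  then show ?thesis by (simp add: continuous_at_imp_continuous_on)
qed

lemma continuous_has_antiderivative: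
  fixes f :: "real \<Rightarrow> real"
  assumes "continuous_on UNIV f"
  obtains F where "\<And>x. (F has_real_derivative f x) (at x)"
proof -
  have "isCont f x" for x using assms by (simp add: continuous_on_eq_continuous_at)
  then obtain F where "\<forall>x. - \<infinity> < ereal x \<longrightarrow> ereal x < \<infinity> \<longrightarrow> (F has_vector_derivative f x) (at x)"
    using einterval_antiderivative[of "-\<infinity>" \<infinity> f] by auto
  then have "(F has_real_derivative f x) (at x)" for x
    by (simp add: has_real_derivative_iff_has_vector_derivative)
  then show ?thesis by (rule that)
qed

lemma equal_derivatives_equal_increments:
  fixes f g :: "real \<Rightarrow> real"
  assumes "\<And>x. (f has_real_derivative h x) (at x)" "\<And>x. (g has_real_derivative h x) (at x)"
  shows "f x - f y = g x - g y"
proof -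
  have "((\<lambda>x. f x - g x) has_real_derivative 0) (at x)" for x
    using DERIV_diff[OF assms(1)[of x] assms(2)[of x]] by simp
  then have "f x - g x = f y - g y" by (intro DERIV_isconst_all) auto
  then show ?thesis by simp
qed

text \<open>The addition theorem moves the parameter \<open>a\<close> of the kernel
  \<open>cos (s - a)\<close> out of the antiderivative: \<open>C\<close> and \<open>S\<close> are
  fixed, and only explicit trigonometric coefficients depend on \<open>a\<close>.\<close>

lemma DERIV_rotated_pair:
  fixes C S :: "real \<Rightarrow> real"
  assumes "(C has_real_derivative cos \<phi> * \<rho>) (at s)" "(S has_real_derivative sin \<phi> * \<rho>) (at s)"
  shows "((\<lambda>x. cos a * C x + sin a * S x) has_real_derivative cos (\<phi> - a) * \<rho>) (at s)"
  using DERIV_add[OF DERIV_cmult[OF assms(1), of "cos a"] DERIV_cmult[OF assms(2), of "sin a"]]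
  by (simp add: cos_diff algebra_simps)

text \<open>The kernel has a kink at \<open>s = t\<close>, so the integral equation is not
  differentiated directly. For a periodic integrand it equals an integral over the moving window
  \<open>[t - P, t]\<close> with a smooth kernel, and the contribution of the window ends produces
  the source term.\<close>

lemma curvature_ode_solution:
  assumes P: "pi < P" "P < 2 * pi"
  obtains k k' :: "real \<Rightarrow> real" and b :: real where "b > 0" "\<And>t. k t > 0" "\<And>t. k (t + P) = k t"
    "\<And>t. (k has_real_derivative k' t) (at t)"
    "\<And>t. (k' has_real_derivative 1 - k t + b / k t) (at t)"
    "integral {0..P} (\<lambda>s. 1 / k s) = P"
    "\<exists>s t. k s \<noteq> k t"
proof -
  have P0: "P > 0" using P pi_gt_zero by linarith
  obtain k0 :: "real \<Rightarrow> real" and b :: real where b: "b > 0" and kcont: "continuous_on {0..P} k0"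
    and kpos: "\<And>t. t \<in> {0..P} \<Longrightarrow> k0 t > 0"
    and keq: "\<And>t. t \<in> {0..P} \<Longrightarrow> k0 t = 1 + b * integral {0..P} (\<lambda>s. periodic_green P t s / k0 s)"
    and kint: "integral {0..P} (\<lambda>s. 1 / k0 s) = P"
    by (rule integral_equation_solution[OF P]) blast
  define \<sigma> where "\<sigma> = sin (P / 2)"
  have \<sigma>: "\<sigma> > 0" unfolding \<sigma>_def by (rule sin_half_period[OF P])
  \<comment> \<open>At \<open>t = 0\<close> and \<open>t = P\<close> the arguments of the cosine are
    negatives of each other, so the solution closes up.\<close>
  have "integral {0..P} (\<lambda>s. periodic_green P 0 s / k0 s) = integral {0..P} (\<lambda>s. periodic_green P P s / k0 s)"
  proof (rule integral_cong)
    fix s assume "s \<in> {0..P}"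
    then have "cos (\<bar>0 - s\<bar> - P / 2) = cos (\<bar>P - s\<bar> - P / 2)"
      by (subst cos_minus[symmetric], intro arg_cong[of _ _ cos]) auto
    then show "periodic_green P 0 s / k0 s = periodic_green P P s / k0 s"
      unfolding periodic_green_def by (simp only:)
  qed
  then have ends: "k0 0 = k0 P" using keq[of 0] keq[of P] P0 by simp
  define r where "r = periodic_extension P (\<lambda>t. 1 / k0 t)"
  have "continuous_on {0..P} (\<lambda>t. 1 / k0 t)"
    using kpos by (intro continuous_intros kcont) (auto simp: less_imp_neq[symmetric])
  then have rcont: "continuous_on UNIV r" unfolding r_def
    using ends by (intro continuous_on_periodic_extension P0) auto
  have rper: "r (t + P) = r t" for t unfolding r_def by (rule periodic_extension_add_period[OF P0])
  have rper': "r (t - P) = r t" for t using rper[of "t - P"] by simp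
  have r0: "r t = 1 / k0 t" if "t \<in> {0..P}" for t
    using periodic_extension_eq[OF P0, of "\<lambda>t. 1 / k0 t" t 0] that ends by (simp add: r_def)
  have "continuous_on UNIV (\<lambda>x. cos x * r x)" by (intro continuous_intros rcont)
  then obtain C where C: "\<And>x. (C has_real_derivative cos x * r x) (at x)"
    by (rule continuous_has_antiderivative) blast
  have "continuous_on UNIV (\<lambda>x. sin x * r x)" by (intro continuous_intros rcont)
  then obtain S where S: "\<And>x. (S has_real_derivative sin x * r x) (at x)"
    by (rule continuous_has_antiderivative) blast
  have C': "((\<lambda>x. C (x - P)) has_real_derivative cos (x - P) * r x) (at x)" for x
    using DERIV_shift[of C "cos (x - P) * r x" x "- P"] C[of "x - P"] by (simp add: rper')
  have S': "((\<lambda>x. S (x - P)) has_real_derivative sin (x - P) * r x) (at x)" for x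
    using DERIV_shift[of S "sin (x - P) * r x" x "- P"] S[of "x - P"] by (simp add: rper')
  define c where "c = b / (2 * \<sigma>)"
  have c: "c * (2 * \<sigma>) = b" using \<sigma> by (simp add: c_def)
  \<comment> \<open>\<open>K t = 1 + c * (integral of cos (t - s - P / 2) * r s over [t - P, t])\<close>, which is manifestly smooth.\<close>
  define K where "K t = 1 + c * (cos (t - P / 2) * (C t - C (t - P)) + sin (t - P / 2) * (S t - S (t - P)))" for t
  define K' where "K' t = c * (cos (t - P / 2) * (S t - S (t - P)) - sin (t - P / 2) * (C t - C (t - P)))" for t
  have per: "K (t + P) = K t" for t
  proof -
    have add: "cos (t + P - P / 2) = cos (t + P / 2)" "sin (t + P - P / 2) = sin (t + P / 2)"
      by (simp_all add: field_simps)
    have "cos (t + P - P / 2) * C (t + P) + sin (t + P - P / 2) * S (t + P)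
        - (cos (t + P - P / 2) * C (t - P + P) + sin (t + P - P / 2) * S (t - P + P))
      = cos (t - P / 2) * C t + sin (t - P / 2) * S t - (cos (t - P / 2) * C (t - P) + sin (t - P / 2) * S (t - P))"
    proof (rule equal_derivatives_equal_increments[where h = "\<lambda>s. cos (s - (t - P / 2)) * r s"])
      fix s
      have CP: "((\<lambda>x. C (x + P)) has_real_derivative cos (s + P) * r s) (at s)"
        using DERIV_shift[of C "cos (s + P) * r s" s P] C[of "s + P"] by (simp add: rper)
      have SP: "((\<lambda>x. S (x + P)) has_real_derivative sin (s + P) * r s) (at s)"
        using DERIV_shift[of S "sin (s + P) * r s" s P] S[of "s + P"] by (simp add: rper)
      have "s + P - (t + P - P / 2) = s - (t - P / 2)" by simp
      from DERIV_rotated_pair[OF CP SP, of "t + P - P / 2", unfolded this]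
      show "((\<lambda>s. cos (t + P - P / 2) * C (s + P) + sin (t + P - P / 2) * S (s + P))
          has_real_derivative cos (s - (t - P / 2)) * r s) (at s)" .
      show "((\<lambda>s. cos (t - P / 2) * C s + sin (t - P / 2) * S s)
          has_real_derivative cos (s - (t - P / 2)) * r s) (at s)"
        by (rule DERIV_rotated_pair[OF C S])
    qed
    then have "cos (t + P - P / 2) * (C (t + P) - C (t + P - P)) + sin (t + P - P / 2) * (S (t + P) - S (t + P - P))
      = cos (t - P / 2) * (C t - C (t - P)) + sin (t - P / 2) * (S t - S (t - P))"
      by (simp add: algebra_simps)
    then show ?thesis unfolding K_def by (simp only:)
  qed
  \<comment> \<open>The part of the window below 0 is carried by periodicity to
    \<open>[t, P]\<close>. On \<open>[0, t]\<close> and \<open>[t, P]\<close> separately the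
    absolute value in the kernel has a fixed sign.\<close>
  have Kk0: "K t = k0 t" if t: "t \<in> {0..P}" for t
  proof -
    have "((\<lambda>s. cos (s - (t - P / 2)) * r s) has_integral
        (cos (t - P / 2) * C t + sin (t - P / 2) * S t - (cos (t - P / 2) * C 0 + sin (t - P / 2) * S 0))) {0..t}"
      using t
      by (intro fundamental_theorem_of_calculus)
        (auto intro!: has_field_derivative_at_within[OF DERIV_rotated_pair[OF C S]]
          simp: has_real_derivative_iff_has_vector_derivative[symmetric])
    moreover have "2 * \<sigma> * (periodic_green P t s / k0 s) = cos (s - (t - P / 2)) * r s" if "s \<in> {0..t}" for s
    proof -
      have "cos (s - (t - P / 2)) = cos (t - s - P / 2)"
        by (subst cos_minus[symmetric], rule arg_cong[of _ _ cos]) simp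
      then show ?thesis using that t \<sigma> r0[of s] by (simp add: periodic_green_def \<sigma>_def)
    qed
    ultimately have 1: "((\<lambda>s. 2 * \<sigma> * (periodic_green P t s / k0 s)) has_integral
        (cos (t - P / 2) * C t + sin (t - P / 2) * S t - (cos (t - P / 2) * C 0 + sin (t - P / 2) * S 0))) {0..t}"
      by (subst has_integral_cong) auto
    have "((\<lambda>s. cos (s - P - (t - P / 2)) * r s) has_integral
        (cos (t - P / 2) * C (P - P) + sin (t - P / 2) * S (P - P) - (cos (t - P / 2) * C (t - P) + sin (t - P / 2) * S (t - P)))) {t..P}"
    proof (rule fundamental_theorem_of_calculus[where f = "\<lambda>s. cos (t - P / 2) * C (s - P) + sin (t - P / 2) * S (s - P)"])
      show "((\<lambda>s. cos (t - P / 2) * C (s - P) + sin (t - P / 2) * S (s - P)) has_vector_derivative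
          cos (s - P - (t - P / 2)) * r s) (at s within {t..P})" for s
        unfolding has_real_derivative_iff_has_vector_derivative[symmetric]
        by (rule has_field_derivative_at_within[OF DERIV_rotated_pair[OF C' S']])
    qed (use t in simp)
    moreover have "2 * \<sigma> * (periodic_green P t s / k0 s) = cos (s - P - (t - P / 2)) * r s" if "s \<in> {t..P}" for s
    proof -
      have "cos (s - P - (t - P / 2)) = cos (s - t - P / 2)" by (rule arg_cong[of _ _ cos]) simp
      then show ?thesis using that t \<sigma> r0[of s] by (simp add: periodic_green_def \<sigma>_def)
    qed
    ultimately have 2: "((\<lambda>s. 2 * \<sigma> * (periodic_green P t s / k0 s)) has_integral
        (cos (t - P / 2) * C (P - P) + sin (t - P / 2) * S (P - P) - (cos (t - P / 2) * C (t - P) + sin (t - P / 2) * S (t - P)))) {t..P}"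
      by (subst has_integral_cong) auto
    have "((\<lambda>s. 2 * \<sigma> * (periodic_green P t s / k0 s)) has_integral
        (cos (t - P / 2) * (C t - C (t - P)) + sin (t - P / 2) * (S t - S (t - P)))) {0..P}"
      using has_integral_combine[OF _ _ 1 2] t by (simp add: algebra_simps)
    then have "2 * \<sigma> * integral {0..P} (\<lambda>s. periodic_green P t s / k0 s) =
        cos (t - P / 2) * (C t - C (t - P)) + sin (t - P / 2) * (S t - S (t - P))"
      by (subst integral_mult_right[symmetric]) (rule integral_unique)
    then have "integral {0..P} (\<lambda>s. periodic_green P t s / k0 s) =
        (cos (t - P / 2) * (C t - C (t - P)) + sin (t - P / 2) * (S t - S (t - P))) / (2 * \<sigma>)"
      using \<sigma> by (simp add: field_simps)
    then show ?thesis using keq[OF t] by (simp add: K_def c_def)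
  qed
  interpret K: periodic_fun_simple K P by unfold_locales (rule per)
  have Kr: "K t > 0 \<and> r t = 1 / K t" for t
  proof -
    define u where "u = t - of_int \<lfloor>t / P\<rfloor> * P"
    have u: "u \<in> {0..P}" using floor_remainder_bounds[OF P0, of t] by (simp add: u_def)
    have "K u = K t" using K.minus_of_int[of t "\<lfloor>t / P\<rfloor>"] by (simp add: u_def)
    moreover have "r t = 1 / k0 u" by (simp add: r_def periodic_extension_def u_def)
    ultimately show ?thesis using Kk0[OF u] kpos[OF u] by simp
  qed
  \<comment> \<open>Contributions of the two window ends. In the first derivative both are
    \<open>cos (P / 2)\<close> and cancel; in the second they are \<open>sin (P / 2)\<close> and
    \<open>- sin (P / 2)\<close>, whose difference times \<open>c\<close> is \<open>b\<close>, the
    coefficient of \<open>1 / k\<close>.\<close>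
  have trig: "cos (x - P / 2) * cos x + sin (x - P / 2) * sin x = cos (P / 2)"
    "cos (x - P / 2) * cos (x - P) + sin (x - P / 2) * sin (x - P) = cos (P / 2)"
    "cos (x - P / 2) * sin x - sin (x - P / 2) * cos x = sin (P / 2)"
    "cos (x - P / 2) * sin (x - P) - sin (x - P / 2) * cos (x - P) = - sin (P / 2)" for x
    using cos_diff[of "x - P / 2" x] cos_diff[of "x - P / 2" "x - P"] sin_diff[of x "x - P / 2"] sin_diff[of "x - P" "x - P / 2"]
    by (simp_all add: algebra_simps)
  have D1: "(K has_real_derivative K' t) (at t)" for t
  proof -
    have "(K has_real_derivative c * (- sin (t - P / 2) * (C t - C (t - P)) + cos (t - P / 2) * (cos t * r t - cos (t - P) * r t)
        + (cos (t - P / 2) * (S t - S (t - P)) + sin (t - P / 2) * (sin t * r t - sin (t - P) * r t)))) (at t)"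
      unfolding K_def [abs_def] by (auto intro!: derivative_eq_intros C S C' S')
    also have "- sin (t - P / 2) * (C t - C (t - P)) + cos (t - P / 2) * (cos t * r t - cos (t - P) * r t)
        + (cos (t - P / 2) * (S t - S (t - P)) + sin (t - P / 2) * (sin t * r t - sin (t - P) * r t)) =
        cos (t - P / 2) * (S t - S (t - P)) - sin (t - P / 2) * (C t - C (t - P)) +
        ((cos (t - P / 2) * cos t + sin (t - P / 2) * sin t) - (cos (t - P / 2) * cos (t - P) + sin (t - P / 2) * sin (t - P))) * r t"
      by (simp add: algebra_simps)
    also have "c * \<dots> = K' t" unfolding trig K'_def by simp
    finally show ?thesis .
  qed
  have D2: "(K' has_real_derivative 1 - K t + b / K t) (at t)" for t
  proof -
    have "(K' has_real_derivative c * (- sin (t - P / 2) * (S t - S (t - P)) + cos (t - P / 2) * (sin t * r t - sin (t - P) * r t)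
        - (cos (t - P / 2) * (C t - C (t - P)) + sin (t - P / 2) * (cos t * r t - cos (t - P) * r t)))) (at t)"
      unfolding K'_def [abs_def] by (auto intro!: derivative_eq_intros C S C' S')
    also have "- sin (t - P / 2) * (S t - S (t - P)) + cos (t - P / 2) * (sin t * r t - sin (t - P) * r t)
        - (cos (t - P / 2) * (C t - C (t - P)) + sin (t - P / 2) * (cos t * r t - cos (t - P) * r t)) =
        - (cos (t - P / 2) * (C t - C (t - P)) + sin (t - P / 2) * (S t - S (t - P))) +
        ((cos (t - P / 2) * sin t - sin (t - P / 2) * cos t) - (cos (t - P / 2) * sin (t - P) - sin (t - P / 2) * cos (t - P))) * r t"
      by (simp add: algebra_simps)
    also have "c * \<dots> = - (c * (cos (t - P / 2) * (C t - C (t - P)) + sin (t - P / 2) * (S t - S (t - P)))) + c * (2 * \<sigma>) * r t"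
      unfolding trig \<sigma>_def[symmetric] by (simp add: algebra_simps)
    also have "\<dots> = 1 - K t + b / K t" unfolding c K_def[symmetric] using Kr[of t] by (simp add: K_def)
    finally show ?thesis .
  qed
  show ?thesis
  proof (rule that[OF b _ per D1 D2])
    show "K t > 0" for t using Kr by blast
    have "integral {0..P} (\<lambda>s. 1 / K s) = integral {0..P} (\<lambda>s. 1 / k0 s)"
      by (rule integral_cong) (simp add: Kk0)
    then show int1: "integral {0..P} (\<lambda>s. 1 / K s) = P" using kint by simp
    \<comment> \<open>A constant solution equals 1 by the mean condition, and the differential
      equation then gives \<open>b = 0\<close>.\<close>
    show "\<exists>s t. K s \<noteq> K t"
    proof (rule ccontr)
      assume "\<not> (\<exists>s t. K s \<noteq> K t)"
      then have all: "\<forall>s t. K s = K t" by simp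
      have cst: "K s = K 0" for s by (rule all[rule_format])
      have "integral {0..P} (\<lambda>s. 1 / K s) = integral {0..P} (\<lambda>s. 1 / K 0)"
        by (rule integral_cong) (rule arg_cong[OF cst])
      then have "P / K 0 = P" using int1 P0 by simp
      then have K0: "K 0 = 1" using P0 Kr[of 0] by (simp add: field_simps)
      have "K = (\<lambda>s. 1)" by (rule ext) (rule trans[OF cst K0])
      have "((\<lambda>s. 1) has_real_derivative K' t) (at t)" for t
        using D1[of t] unfolding \<open>K = (\<lambda>s. 1)\<close> .
      then have "K' t = 0" for t by (rule DERIV_unique[OF _ DERIV_const])
      then have "K' = (\<lambda>t. 0)" by (rule ext)
      have "((\<lambda>t. 0) has_real_derivative 1 - K 0 + b / K 0) (at 0)"
        using D2[of 0] unfolding \<open>K' = (\<lambda>t. 0)\<close> .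
      from DERIV_unique[OF this DERIV_const] have "1 - 1 + b / 1 = 0" unfolding K0 .
      then show False using b by simp
    qed
  qed
qed

section \<open>Calculus of iterated differentiable functions\<close>

lemma Ck_on_SucD: "Ck_on (Suc k) S f \<Longrightarrow> Ck_on k S f"
proof (induction k arbitrary: f)
  case 0
  then obtain f' where "\<forall>x\<in>S. (f has_derivative f' x) (at x within S)" by auto
  then show ?case by (auto intro: has_derivative_continuous_on)
next
  case (Suc k)
  from Suc.prems obtain f' where "\<forall>x\<in>S. (f has_derivative f' x) (at x within S)"
    and "\<forall>v. Ck_on (Suc k) S (\<lambda>x. f' x v)" by (subst (asm) Ck_on.simps(2)) blast
  then show ?case using Suc.IH unfolding Ck_on.simps(2)[of k S f] by blast
qed

lemma Ck_on_imp_continuous_on: "Ck_on k S f \<Longrightarrow> continuous_on S f"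
proof (induction k)
  case (Suc k)
  show ?case by (rule Suc.IH[OF Ck_on_SucD[OF Suc.prems]])
qed simp

lemma Ck_on_subset: "Ck_on k S f \<Longrightarrow> T \<subseteq> S \<Longrightarrow> Ck_on k T f"
proof (induction k arbitrary: f)
  case 0
  then show ?case by (auto intro: continuous_on_subset)
next
  case (Suc k)
  from Suc.prems(1) obtain f' where f': "\<forall>x\<in>S. (f has_derivative f' x) (at x within S)" "\<forall>v. Ck_on k S (\<lambda>x. f' x v)" by auto
  have "\<forall>x\<in>T. (f has_derivative f' x) (at x within T)"
    using f'(1) Suc.prems(2) by (meson has_derivative_subset subsetD)
  then show ?case using f'(2) Suc by auto
qed

lemma Ck_on_cong: "Ck_on k S f \<Longrightarrow> (\<And>x. x \<in> S \<Longrightarrow> g x = f x) \<Longrightarrow> Ck_on k S g"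
proof (cases k)
  case (Suc j)
  assume "Ck_on k S f" and eq: "\<And>x. x \<in> S \<Longrightarrow> g x = f x"
  then obtain f' where f': "\<forall>x\<in>S. (f has_derivative f' x) (at x within S)" "\<forall>v. Ck_on j S (\<lambda>x. f' x v)"
    unfolding Suc by auto
  have "\<forall>x\<in>S. (g has_derivative f' x) (at x within S)"
    using f'(1) eq by (auto intro: has_derivative_transform)
  then show "Ck_on k S g" using f'(2) unfolding Suc by auto
qed (metis Ck_on.simps(1) continuous_on_cong)

lemma Ck_on_const: "Ck_on k S (\<lambda>x. c)"
proof (induction k arbitrary: c)
  case (Suc k)
  show ?case using Suc by (auto intro!: exI[of _ "\<lambda>x v. 0"])
qed simp

lemma Ck_on_bounded_linear:
  assumes "bounded_linear L"
  shows "Ck_on k S f \<Longrightarrow> Ck_on k S (\<lambda>x. L (f x))"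
proof (induction k arbitrary: f)
  case 0
  then show ?case using assms by (auto intro: bounded_linear.continuous_on)
next
  case (Suc k)
  then obtain f' where f': "\<forall>x\<in>S. (f has_derivative f' x) (at x within S)" "\<forall>v. Ck_on k S (\<lambda>x. f' x v)" by auto
  have "\<forall>x\<in>S. ((\<lambda>x. L (f x)) has_derivative (\<lambda>v. L (f' x v))) (at x within S)"
    using f'(1) bounded_linear.has_derivative[OF assms] by blast
  then show ?case using f'(2) Suc.IH by auto
qed

lemma Ck_on_ident_linear:
  assumes "bounded_linear L"
  shows "Ck_on k S L"
proof (cases k)
  case 0
  then show ?thesis using assms by (auto intro: linear_continuous_on)
next
  case (Suc j)
  have "\<forall>x\<in>S. (L has_derivative L) (at x within S)" using bounded_linear_imp_has_derivative[OF assms] by auto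
  then show ?thesis unfolding Suc by (auto intro!: exI[of _ "\<lambda>x. L"] Ck_on_const)
qed

lemma Ck_on_add: "Ck_on k S f \<Longrightarrow> Ck_on k S g \<Longrightarrow> Ck_on k S (\<lambda>x. f x + g x)"
proof (induction k arbitrary: f g)
  case 0
  then show ?case by (auto intro: continuous_intros)
next
  case (Suc k)
  then obtain f' g' where f': "\<forall>x\<in>S. (f has_derivative f' x) (at x within S)" "\<forall>v. Ck_on k S (\<lambda>x. f' x v)"
    and g': "\<forall>x\<in>S. (g has_derivative g' x) (at x within S)" "\<forall>v. Ck_on k S (\<lambda>x. g' x v)" by auto
  have "\<forall>x\<in>S. ((\<lambda>x. f x + g x) has_derivative (\<lambda>v. f' x v + g' x v)) (at x within S)"
    using f'(1) g'(1) by (auto intro: has_derivative_add)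
  then show ?case using f'(2) g'(2) Suc.IH by (auto intro!: exI[of _ "\<lambda>x v. f' x v + g' x v"])
qed

lemma Ck_on_bilinear:
  fixes B :: "'b::real_normed_vector \<Rightarrow> 'c::real_normed_vector \<Rightarrow> 'd::real_normed_vector"
  assumes "bounded_bilinear B"
  shows "Ck_on k S f \<Longrightarrow> Ck_on k S g \<Longrightarrow> Ck_on k S (\<lambda>x. B (f x) (g x))"
proof (induction k arbitrary: f g)
  case 0
  then show ?case using bounded_bilinear.continuous_on[OF assms] by auto
next
  case (Suc k)
  then obtain f' g' where f': "\<forall>x\<in>S. (f has_derivative f' x) (at x within S)" "\<forall>v. Ck_on k S (\<lambda>x. f' x v)"
    and g': "\<forall>x\<in>S. (g has_derivative g' x) (at x within S)" "\<forall>v. Ck_on k S (\<lambda>x. g' x v)" by auto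
  have "\<forall>x\<in>S. ((\<lambda>x. B (f x) (g x)) has_derivative (\<lambda>v. B (f x) (g' x v) + B (f' x v) (g x))) (at x within S)"
    using f'(1) g'(1) bounded_bilinear.FDERIV[OF assms] by blast
  moreover have "Ck_on k S (\<lambda>x. B (f x) (g' x v) + B (f' x v) (g x))" for v
    by (intro Ck_on_add Suc.IH f'(2)[rule_format] g'(2)[rule_format] Ck_on_SucD[OF Suc.prems(1)] Ck_on_SucD[OF Suc.prems(2)])
  ultimately show ?case by auto
qed

lemmas Ck_on_mult = Ck_on_bilinear[OF bounded_bilinear_mult]
lemmas Ck_on_scaleR = Ck_on_bilinear[OF bounded_bilinear_scaleR]

text \<open>For an outer function of one real variable the chain rule is a scalar multiple of its
  derivative in the fixed direction 1. The induction hypothesis then applies, which speaks only of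
  fixed directions.\<close>

lemma Ck_on_compose_real:
  fixes g :: "real \<Rightarrow> 'b::real_normed_vector"
  shows "Ck_on k T g \<Longrightarrow> Ck_on k S f \<Longrightarrow> f ` S \<subseteq> T \<Longrightarrow> Ck_on k S (\<lambda>x. g (f x))"
proof (induction k arbitrary: g)
  case 0
  then show ?case by (auto intro: continuous_on_compose2)
next
  case (Suc k)
  then obtain f' g' where f': "\<forall>x\<in>S. (f has_derivative f' x) (at x within S)" "\<forall>v. Ck_on k S (\<lambda>x. f' x v)"
    and g': "\<forall>x\<in>T. (g has_derivative g' x) (at x within T)" "\<forall>v. Ck_on k T (\<lambda>x. g' x v)" by auto
  have "((\<lambda>x. g (f x)) has_derivative (\<lambda>v. f' x v *\<^sub>R g' (f x) 1)) (at x within S)" if x: "x \<in> S" for x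
  proof -
    have "((\<lambda>x. g (f x)) has_derivative (\<lambda>v. g' (f x) (f' x v))) (at x within S)"
      using g'(1) f'(1) Suc.prems(3) x by (intro has_derivative_in_compose2[of T g g' f S]) auto
    moreover have "linear (g' (f x))"
      using g'(1) Suc.prems(3) x by (auto intro!: bounded_linear.linear has_derivative_bounded_linear)
    then have "g' (f x) r = r *\<^sub>R g' (f x) 1" for r using linear_cmul[of "g' (f x)" r 1] by simp
    then have "(\<lambda>v. g' (f x) (f' x v)) = (\<lambda>v. f' x v *\<^sub>R g' (f x) 1)" by blast
    ultimately show ?thesis by simp
  qed
  moreover have "Ck_on k S (\<lambda>x. f' x v *\<^sub>R g' (f x) 1)" for v
    by (intro Ck_on_scaleR Suc.IH f'(2)[rule_format] g'(2)[rule_format] Ck_on_SucD[OF Suc.prems(2)] Suc.prems(3))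
  ultimately show ?case by (auto intro!: exI[of _ "\<lambda>x v. f' x v *\<^sub>R g' (f x) 1"])
qed

lemma Ck_on_Suc_real:
  fixes f :: "real \<Rightarrow> 'b::real_normed_vector"
  assumes "\<And>x. x \<in> S \<Longrightarrow> (f has_vector_derivative f' x) (at x within S)" "Ck_on k S f'"
  shows "Ck_on (Suc k) S f"
  using assms by (auto simp: has_vector_derivative_def intro!: exI[of _ "\<lambda>x v. v *\<^sub>R f' x"] Ck_on_scaleR Ck_on_const)

text \<open>The bootstrapping step for functions of angle and time: once the total derivative is
  known, regularity of the two partials gains one order.\<close>

lemma Ck_on_Suc_partials:
  fixes f :: "real \<times> real \<Rightarrow> 'b::real_normed_vector"
  assumes "\<And>x. x \<in> S \<Longrightarrow> (f has_derivative (\<lambda>v. fst v *\<^sub>R fu x + snd v *\<^sub>R ft x)) (at x within S)"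
    "Ck_on k S fu" "Ck_on k S ft"
  shows "Ck_on (Suc k) S f"
  using assms by (auto intro!: exI[of _ "\<lambda>x v. fst v *\<^sub>R fu x + snd v *\<^sub>R ft x"] Ck_on_add Ck_on_scaleR Ck_on_const)

lemma Ck_on_cis: "Ck_on k S (\<lambda>x. c * cis x)"
proof (induction k arbitrary: c)
  case 0
  then show ?case by (auto intro!: continuous_intros)
next
  case (Suc k)
  show ?case
  proof (rule Ck_on_Suc_real)
    show "((\<lambda>x. c * cis x) has_vector_derivative (c * \<i>) * cis x) (at x within S)" for x
      by (auto intro!: derivative_eq_intros simp: has_vector_derivative_def)
  qed (rule Suc.IH)
qed

lemma Ck_on_exp: "Ck_on k S (exp :: real \<Rightarrow> real)"
proof (induction k)
  case 0
  then show ?case by (auto intro!: continuous_intros)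
next
  case (Suc k)
  show ?case
    by (rule Ck_on_Suc_real[OF _ Suc.IH])
      (auto intro!: derivative_eq_intros simp: has_real_derivative_iff_has_vector_derivative[symmetric])
qed

text \<open>The derivative is a polynomial in the function itself, so the induction closes.\<close>

lemma Ck_on_inverse: "Ck_on k {0<..} (inverse :: real \<Rightarrow> real)"
proof (induction k)
  case 0
  then show ?case by (auto intro!: continuous_intros)
next
  case (Suc k)
  show ?case
  proof (rule Ck_on_Suc_real)
    show "(inverse has_vector_derivative (- 1) * (inverse x * inverse x)) (at x within {0<..})" if "x \<in> {0<..}" for x :: real
      using that by (auto intro!: derivative_eq_intros simp: has_real_derivative_iff_has_vector_derivative[symmetric] power2_eq_square)
    show "Ck_on k {0<..} (\<lambda>x::real. (- 1) * (inverse x * inverse x))"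
      by (intro Ck_on_mult Ck_on_const Suc.IH)
  qed
qed

lemma Ck_on_inverse_compose: "Ck_on k S f \<Longrightarrow> (\<And>x. x \<in> S \<Longrightarrow> f x > (0::real)) \<Longrightarrow> Ck_on k S (\<lambda>x. inverse (f x))"
  by (rule Ck_on_compose_real[OF Ck_on_inverse]) auto

lemma continuous_on_slice:
  assumes "continuous_on (A \<times> B) (\<lambda>(x, y). f x y)" "x \<in> A" "C \<subseteq> B"
  shows "continuous_on C (f x)"
proof -
  have "continuous_on C (\<lambda>y. (\<lambda>(x, y). f x y) (x, y))"
    by (rule continuous_on_compose2[OF assms(1) continuous_on_Pair[OF continuous_on_const continuous_on_id]])
      (use assms in auto)
  then show ?thesis by simp
qed

text \<open>The substitution \<open>s = t * r\<close> fixes the domain of integration and turns the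
  upper limit into a parameter of the integrand.\<close>

lemma continuous_on_integral_upper_limit:
  fixes q :: "real \<Rightarrow> real \<Rightarrow> real"
  assumes cont: "continuous_on (UNIV \<times> {0..e}) (\<lambda>(u, s). q u s)"
  shows "continuous_on (UNIV \<times> {0..e}) (\<lambda>(u, t). integral {0..t} (q u))"
proof -
  have eq: "integral {0..t} (q u) = t * integral {0..1} (\<lambda>r. q u (t * r))" if t: "t \<in> {0..e}" for u t
  proof (cases "t = 0")
    case False
    then have t0: "t > 0" using t by simp
    have "continuous_on {0..t} (q u)"
      using t by (intro continuous_on_slice[OF cont]) auto
    then have "(q u has_integral integral {0..t} (q u)) {0..t}"
      by (intro integrable_integral integrable_continuous_real)
    then have "((\<lambda>r. q u (t * r)) has_integral (1 / \<bar>t\<bar>) *\<^sub>R integral {0..t} (q u)) ((\<lambda>x. x / t) ` {0..t})"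
      using t0 by (intro has_integral_stretch_real) auto
    moreover have "(\<lambda>x. x / t) ` {0..t} = {0..1}"
    proof
      show "{0..1} \<subseteq> (\<lambda>x. x / t) ` {0..t}"
      proof
        fix x :: real assume "x \<in> {0..1}"
        then show "x \<in> (\<lambda>x. x / t) ` {0..t}" using t0 by (intro image_eqI[of _ _ "x * t"]) (auto simp: mult_left_le_one_le)
      qed
    qed (use t0 in auto)
    ultimately have "integral {0..1} (\<lambda>r. q u (t * r)) = integral {0..t} (q u) / t" using t0 by (simp add: integral_unique)
    then show ?thesis using t0 by simp
  qed simp
  have "continuous_on ((UNIV \<times> {0..e}) \<times> cbox 0 1) (\<lambda>(x, r). q (fst x) (snd x * r))"
  proof -
    have "continuous_on ((UNIV \<times> {0..e}) \<times> cbox (0::real) 1) (\<lambda>y. (\<lambda>(u, s). q u s) (fst (fst y), snd (fst y) * snd y))"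
    proof (rule continuous_on_compose2[OF cont])
      show "(\<lambda>y. (fst (fst y), snd (fst y) * snd y)) ` ((UNIV \<times> {0..e}) \<times> cbox 0 1) \<subseteq> UNIV \<times> {0..e}"
        by (auto intro!: order_trans[OF mult_left_le])
    qed (intro continuous_intros)
    then show ?thesis by (simp add: split_beta)
  qed
  from integral_continuous_on_param[OF this]
  have "continuous_on (UNIV \<times> {0..e}) (\<lambda>x. snd x * integral {0..1} (\<lambda>r. q (fst x) (snd x * r)))"
    by (auto intro!: continuous_intros)
  then show ?thesis using eq by (subst continuous_on_cong[OF refl]) auto
qed

text \<open>Joint continuity of one partial makes the partials a total derivative. The time partial
  takes this role because in both uses it is known explicitly: as the integrand, or as the
  right-hand side of the flow equation. Time derivatives are one-sided at the ends of
  \<open>J\<close>.\<close>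

lemma has_derivative_partials_product:
  fixes f :: "real \<Rightarrow> real \<Rightarrow> real"
  assumes J: "convex J"
    and fu: "\<And>u t. t \<in> J \<Longrightarrow> ((\<lambda>u. f u t) has_real_derivative fu u t) (at u)"
    and ft: "\<And>u t. t \<in> J \<Longrightarrow> (f u has_real_derivative ft u t) (at t within J)"
    and cont: "continuous_on (UNIV \<times> J) (\<lambda>(u, t). ft u t)"
    and x: "x \<in> UNIV \<times> J"
  shows "((\<lambda>(u, t). f u t) has_derivative (\<lambda>v. fst v *\<^sub>R fu (fst x) (snd x) + snd v *\<^sub>R ft (fst x) (snd x))) (at x within UNIV \<times> J)"
proof -
  obtain u t where xx: "x = (u, t)" and t: "t \<in> J" using x by auto
  have "((\<lambda>(u, t). f u t) has_derivative (\<lambda>(tx, ty). (fu u t * tx) + blinfun_apply (blinfun_mult_right (ft u t)) ty)) (at (u, t) within UNIV \<times> J)"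
  proof (rule has_derivative_partialsI[where fy = "\<lambda>u t. blinfun_mult_right (ft u t)"])
    show "((\<lambda>x. f x t) has_derivative (*) (fu u t)) (at u within UNIV)"
      using fu[OF t] by (simp add: has_field_derivative_def)
    show "(f x has_derivative blinfun_apply (blinfun_mult_right (ft x y))) (at y within J)" if "y \<in> J" for x y
      using ft[OF that] by (simp add: has_field_derivative_def)
    have "continuous_on (UNIV \<times> J) (\<lambda>x. blinfun_mult_right ((\<lambda>(u, t). ft u t) x))"
      by (intro continuous_intros cont)
    moreover have "(\<lambda>x. blinfun_mult_right ((\<lambda>(u, t). ft u t) x)) = (\<lambda>(x, y). blinfun_mult_right (ft x y))"
      by auto
    ultimately show "continuous (at (u, t) within UNIV \<times> J) (\<lambda>(x, y). blinfun_mult_right (ft x y))"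
      using t unfolding continuous_on_eq_continuous_within by (metis UNIV_I mem_Sigma_iff)
  qed (use t J in auto)
  then show ?thesis unfolding xx by (simp add: case_prod_beta' mult.commute)
qed

text \<open>The time partial is the integrand itself, and the angle partial is an integral of the
  same form over a function of one order less; hence the induction with \<open>q\<close>
  arbitrary.\<close>

lemma Ck_on_integral_upper_limit:
  fixes q :: "real \<times> real \<Rightarrow> real"
  assumes "Ck_on k (UNIV \<times> {0..e}) q"
  shows "Ck_on k (UNIV \<times> {0..e}) (\<lambda>(u, t). integral {0..t} (\<lambda>s. q (u, s)))"
  using assms
proof (induction k arbitrary: q)
  case 0
  then show ?case using continuous_on_integral_upper_limit[of e "\<lambda>u s. q (u, s)"] by simp
next
  case (Suc k)
  then obtain q' where q': "\<forall>x\<in>UNIV \<times> {0..e}. (q has_derivative q' x) (at x within UNIV \<times> {0..e})" 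
     "\<forall>v. Ck_on k (UNIV \<times> {0..e}) (\<lambda>x. q' x v)" by auto
  define qu where "qu = (\<lambda>x. q' x (1, 0))"
  have quC: "Ck_on k (UNIV \<times> {0..e}) qu" unfolding qu_def using q'(2) by blast
  have quc: "continuous_on (UNIV \<times> {0..e}) qu" by (rule Ck_on_imp_continuous_on[OF quC])
  have qc: "continuous_on (UNIV \<times> {0..e}) q" by (rule Ck_on_imp_continuous_on[OF Suc.prems])
  have slice: "continuous_on {0..e} (\<lambda>s. q (u, s))" for u
    by (rule continuous_on_slice[of UNIV "{0..e}" "\<lambda>u s. q (u, s)"]) (use qc in auto)
  have qder: "((\<lambda>u. q (u, s)) has_real_derivative qu (u, s)) (at u)" if s: "s \<in> {0..e}" for u s
  proof -
    have "((\<lambda>u. q (u, s)) has_derivative (\<lambda>y. q' (u, s) (y, 0))) (at u within UNIV)"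
      using q'(1) s by (intro has_derivative_in_compose2[of "UNIV \<times> {0..e}" q q' "\<lambda>u. (u, s)"]) (auto intro!: derivative_eq_intros)
    moreover have "(q has_derivative q' (u, s)) (at (u, s) within UNIV \<times> {0..e})" using q'(1) s by auto
    then have "linear (q' (u, s))" by (rule has_derivative_linear)
    then have "q' (u, s) (y, 0) = qu (u, s) * y" for y
      using linear_cmul[of "q' (u, s)" y "(1, 0)"] by (simp add: qu_def)
    ultimately show ?thesis by (simp add: has_field_derivative_def)
  qed
  define I where "I = (\<lambda>u t. integral {0..t} (\<lambda>s. q (u, s)))"
  have Iu: "((\<lambda>u. I u t) has_real_derivative integral {0..t} (\<lambda>s. qu (u, s))) (at u)" if t: "t \<in> {0..e}" for u t
  proof -
    have "((\<lambda>u. integral (cbox 0 t) (\<lambda>s. q (u, s))) has_field_derivative integral (cbox 0 t) (\<lambda>s. qu (u, s))) (at u within UNIV)"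
    proof (rule leibniz_rule_field_derivative)
      show "((\<lambda>x. q (x, s)) has_real_derivative qu (x, s)) (at x within UNIV)" if "s \<in> cbox 0 t" for x s
        using qder that t by auto
      show "(\<lambda>s. q (x, s)) integrable_on cbox 0 t" for x
        using t by (auto intro!: integrable_continuous_real continuous_on_subset[OF slice])
      show "continuous_on (UNIV \<times> cbox 0 t) (\<lambda>(x, s). qu (x, s))"
        using t by (auto intro!: continuous_on_subset[OF quc])
    qed auto
    then show ?thesis by (simp add: I_def)
  qed
  have It: "(I u has_real_derivative q (u, t)) (at t within {0..e})" if t: "t \<in> {0..e}" for u t
    unfolding I_def by (rule integral_has_real_derivative[OF slice t])
  show ?case
  proof (rule Ck_on_Suc_partials)
    show "Ck_on k (UNIV \<times> {0..e}) (\<lambda>(u, t). integral {0..t} (\<lambda>s. qu (u, s)))" by (rule Suc.IH[OF quC])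
    show "Ck_on k (UNIV \<times> {0..e}) q" by (rule Ck_on_SucD[OF Suc.prems])
    show "((\<lambda>(u, t). integral {0..t} (\<lambda>s. q (u, s))) has_derivative
         (\<lambda>v. fst v *\<^sub>R (case x of (u, t) \<Rightarrow> integral {0..t} (\<lambda>s. qu (u, s))) + snd v *\<^sub>R q x)) (at x within UNIV \<times> {0..e})"
      if "x \<in> UNIV \<times> {0..e}" for x
      using has_derivative_partials_product[of "{0..e}" I "\<lambda>u t. integral {0..t} (\<lambda>s. qu (u, s))" "\<lambda>u t. q (u, t)" x] Iu It qc that
      by (simp add: I_def split_beta)
  qed
qed

section \<open>Flows of scalar equations\<close>

lemma linear_ode_unique:
  fixes w p :: "real \<Rightarrow> real"
  assumes p: "continuous_on {0..e} p"
    and w: "\<And>t. t \<in> {0..e} \<Longrightarrow> (w has_real_derivative p t * w t) (at t within {0..e})"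
    and t: "t \<in> {0..e}"
  shows "w t = w 0 * exp (integral {0..t} p)"
proof -
  define E where "E = (\<lambda>t. w t * exp (- integral {0..t} p))"
  have "(E has_derivative (\<lambda>h. 0)) (at s within {0..e})" if s: "s \<in> {0..e}" for s
  proof -
    have "(E has_real_derivative 0) (at s within {0..e})" unfolding E_def
      by (rule derivative_eq_intros w[OF s] integral_has_real_derivative[OF p s] refl)+ simp
    then show ?thesis by (simp add: has_field_derivative_def lambda_zero)
  qed
  then obtain c where c: "\<And>s. s \<in> {0..e} \<Longrightarrow> E s = c"
    using has_derivative_zero_constant[of "{0..e}" E] by auto
  have "E t = E 0" using c[OF t] c[of 0] t by auto
  then show ?thesis by (simp add: E_def exp_minus field_simps)
qed

text \<open>The fixed point is sought for all labels \<open>u\<close> at once, which yields joint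
  continuity directly. The solution is unbounded in \<open>u\<close>, but its displacement from
  \<open>a * u\<close> is bounded, so Banach's theorem applies to bounded continuous displacements
  \<open>D\<close>, with contraction factor \<open>e * L * G\<close>.\<close>

lemma picard_solution:
  fixes v g :: "real \<Rightarrow> real"
  assumes e: "0 \<le> e" and vc: "continuous_on UNIV v" and gc: "continuous_on {0..e} g"
    and vb: "\<And>x. \<bar>v x\<bar> \<le> V" and lip: "\<And>x y. \<bar>v x - v y\<bar> \<le> L * \<bar>x - y\<bar>"
    and gb: "\<And>t. t \<in> {0..e} \<Longrightarrow> \<bar>g t\<bar> \<le> G" and small: "e * L * G < 1"
  obtains \<Theta> :: "real \<Rightarrow> real \<Rightarrow> real" where
    "continuous_on (UNIV \<times> {0..e}) (\<lambda>(u, t). \<Theta> u t)"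
    "\<And>u t. t \<in> {0..e} \<Longrightarrow> \<Theta> u t = a * u + integral {0..t} (\<lambda>s. v (\<Theta> u s) * g s)"
proof -
  have G0: "G \<ge> 0" using gb[of 0] e by auto
  have V0: "V \<ge> 0" using vb[of 0] by auto
  have L0: "L \<ge> 0" using lip[of 0 1] by auto
  \<comment> \<open>The elements of the function space live on the whole plane, so time is projected
    to \<open>[0, e]\<close>.\<close>
  define clamp where "clamp t = min e (max 0 t)" for t :: real
  have clamp: "clamp t \<in> {0..e}" for t using e by (auto simp: clamp_def)
  define T where "T D = (\<lambda>(u, t). integral {0..clamp t} (\<lambda>s. v (a * u + apply_bcontfun D (u, s)) * g s))"
    for D :: "(real \<times> real) \<Rightarrow>\<^sub>C real"
  have joint: "continuous_on (UNIV \<times> {0..e}) (\<lambda>(u, s). v (a * u + apply_bcontfun D (u, s)) * g s)" for D :: "(real \<times> real) \<Rightarrow>\<^sub>C real"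
  proof -
    have "continuous_on (UNIV \<times> {0..e}) (\<lambda>x. v (a * fst x + apply_bcontfun D (fst x, snd x)) * g (snd x))"
      by (intro continuous_intros continuous_on_compose2[OF vc] continuous_on_compose2[OF gc]
         continuous_on_compose2[OF continuous_on_apply_bcontfun[of UNIV]]) auto
    then show ?thesis by (simp add: split_beta)
  qed
  have slice: "continuous_on {0..t} (\<lambda>s. v (a * u + apply_bcontfun D (u, s)) * g s)" if "t \<in> {0..e}" for D :: "(real \<times> real) \<Rightarrow>\<^sub>C real" and u t
    using that by (intro continuous_on_slice[OF joint]) auto
  have Tb: "\<bar>T D x\<bar> \<le> e * (V * G)" for D x
  proof -
    obtain u t where x: "x = (u, t)" by (cases x)
    have "norm (integral {0..clamp t} (\<lambda>s. v (a * u + apply_bcontfun D (u, s)) * g s)) \<le> V * G * (clamp t - 0)"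
    proof (rule integral_bound)
      show "norm (v (a * u + apply_bcontfun D (u, s)) * g s) \<le> V * G" if "s \<in> {0..clamp t}" for s
        using vb gb[of s] that clamp[of t] V0 G0 by (auto simp: abs_mult intro!: mult_mono)
    qed (use clamp[of t] slice in auto)
    also have "\<dots> \<le> V * G * e" using clamp[of t] V0 G0 by (intro mult_left_mono) auto
    finally show ?thesis by (simp add: T_def x mult_ac)
  qed
  have Tcont: "continuous_on UNIV (T D)" for D
  proof -
    have "continuous_on UNIV (\<lambda>x. (\<lambda>(u, t). integral {0..t} (\<lambda>s. v (a * u + apply_bcontfun D (u, s)) * g s)) (fst x, clamp (snd x)))"
      by (rule continuous_on_compose2[OF continuous_on_integral_upper_limit[OF joint]])
        (use clamp in \<open>auto intro!: continuous_intros simp: clamp_def\<close>)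
    then show ?thesis by (simp add: T_def split_beta)
  qed
  have Tin: "T D \<in> bcontfun" for D
    unfolding bcontfun_def using Tcont Tb by (auto simp: bounded_iff intro!: exI[of _ "e * (V * G)"])
  define F where "F D = Bcontfun (T D)" for D
  have FT: "apply_bcontfun (F D) = T D" for D unfolding F_def by (rule Bcontfun_inverse[OF Tin])
  have "dist (F D1) (F D2) \<le> (e * L * G) * dist D1 D2" for D1 D2
  proof (rule dist_bound)
    fix x :: "real \<times> real"
    obtain u t where x: "x = (u, t)" by (cases x)
    let ?i = "\<lambda>D s. v (a * u + apply_bcontfun D (u, s)) * g s"
    have diff: "T D1 x - T D2 x = integral {0..clamp t} (\<lambda>s. ?i D1 s - ?i D2 s)"
      using slice[OF clamp] by (simp add: T_def x integral_diff integrable_continuous_real)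
    have cd: "continuous_on {0..clamp t} (\<lambda>s. ?i D1 s - ?i D2 s)"
      by (intro continuous_on_diff slice clamp)
    have "norm (integral {0..clamp t} (\<lambda>s. ?i D1 s - ?i D2 s)) \<le> (L * dist D1 D2 * G) * (clamp t - 0)"
    proof (rule integral_bound)
      fix s assume s: "s \<in> {0..clamp t}"
      have "\<bar>v (a * u + apply_bcontfun D1 (u, s)) - v (a * u + apply_bcontfun D2 (u, s))\<bar> \<le>
          L * \<bar>apply_bcontfun D1 (u, s) - apply_bcontfun D2 (u, s)\<bar>"
        using lip[of "a * u + apply_bcontfun D1 (u, s)" "a * u + apply_bcontfun D2 (u, s)"] by simp
      also have "\<dots> \<le> L * dist D1 D2" using dist_bounded[of D1 "(u, s)" D2] L0 
        by (intro mult_left_mono) (auto simp: dist_real_def)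
      finally have "\<bar>v (a * u + apply_bcontfun D1 (u, s)) - v (a * u + apply_bcontfun D2 (u, s))\<bar> * \<bar>g s\<bar> \<le> L * dist D1 D2 * G"
        using gb[of s] s clamp[of t] L0 by (intro mult_mono) auto
      then show "norm (?i D1 s - ?i D2 s) \<le> L * dist D1 D2 * G"
        by (simp add: abs_mult flip: left_diff_distrib)
    qed (use clamp[of t] cd in auto)
    also have "\<dots> \<le> (L * dist D1 D2 * G) * e" using clamp[of t] L0 G0 by (intro mult_left_mono) auto
    finally show "dist (apply_bcontfun (F D1) x) (apply_bcontfun (F D2) x) \<le> (e * L * G) * dist D1 D2"
      by (simp add: FT dist_real_def diff mult_ac)
  qed
  then have "\<exists>!D. F D = D"
    using e L0 G0 small by (intro banach_fix_type[of "e * L * G"]) auto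
  then obtain D where D: "F D = D" by blast
  define \<Theta> where "\<Theta> u t = a * u + apply_bcontfun D (u, t)" for u t
  show ?thesis
  proof (rule that)
    have "continuous_on (UNIV \<times> {0..e}) (\<lambda>x. a * fst x + apply_bcontfun D (fst x, snd x))"
      by (intro continuous_intros continuous_on_compose2[OF continuous_on_apply_bcontfun[of UNIV]]) auto
    then show "continuous_on (UNIV \<times> {0..e}) (\<lambda>(u, t). \<Theta> u t)" by (simp add: \<Theta>_def split_beta)
    show "\<Theta> u t = a * u + integral {0..t} (\<lambda>s. v (\<Theta> u s) * g s)" if t: "t \<in> {0..e}" for u t
    proof -
      have "apply_bcontfun D (u, t) = T D (u, t)" using FT[of D] D by simp
      moreover have "clamp t = t" using t by (auto simp: clamp_def)
      ultimately show ?thesis by (simp add: \<Theta>_def T_def)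
    qed
  qed
qed

text \<open>Separated right-hand side \<open>v (\<Theta>) * g t\<close> with initial value
  \<open>a * u\<close>. Later \<open>a = m\<close>: one turn of the label \<open>u\<close> around
  the circle corresponds to m turns of the tangent angle.\<close>

locale scalar_flow =
  fixes v v' g :: "real \<Rightarrow> real" and \<Theta> :: "real \<Rightarrow> real \<Rightarrow> real" and e a :: real
  assumes e0: "0 < e"
    and v_deriv: "\<And>x. (v has_real_derivative v' x) (at x)"
    and v'_smooth: "\<And>k. Ck_on k UNIV v'"
    and g_smooth: "\<And>k. Ck_on k {0..e} g"
    and \<Theta>_cont: "continuous_on (UNIV \<times> {0..e}) (\<lambda>(u, t). \<Theta> u t)"
    and \<Theta>_eq: "\<And>u t. t \<in> {0..e} \<Longrightarrow> \<Theta> u t = a * u + integral {0..t} (\<lambda>s. v (\<Theta> u s) * g s)"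
begin

lemma v_smooth: "Ck_on k UNIV v"
proof (cases k)
  case 0
  then show ?thesis using v_deriv by (auto intro!: DERIV_continuous_on)
next
  case (Suc j)
  show ?thesis unfolding Suc
    by (rule Ck_on_Suc_real[OF _ v'_smooth]) (use v_deriv in \<open>simp add: has_real_derivative_iff_has_vector_derivative\<close>)
qed

lemma v_cont: "continuous_on A v" and v'_cont: "continuous_on A v'" and g_cont: "continuous_on {0..e} g"
  using Ck_on_imp_continuous_on[OF v_smooth[of 0]] Ck_on_imp_continuous_on[OF v'_smooth[of 0]]
    Ck_on_imp_continuous_on[OF g_smooth[of 0]] by (auto intro: continuous_on_subset)

lemma \<Theta>_slice: "continuous_on {0..e} (\<Theta> u)"
  by (rule continuous_on_slice[OF \<Theta>_cont]) auto

lemma \<Theta>_0 [simp]: "\<Theta> u 0 = a * u"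
  using \<Theta>_eq[of 0 u] e0 by simp

lemma \<Theta>_t_deriv:
  assumes t: "t \<in> {0..e}"
  shows "(\<Theta> u has_real_derivative v (\<Theta> u t) * g t) (at t within {0..e})"
proof -
  have "continuous_on {0..e} (\<lambda>s. v (\<Theta> u s) * g s)"
    by (intro continuous_intros continuous_on_compose2[OF v_cont[of UNIV] \<Theta>_slice] g_cont) auto
  from integral_has_real_derivative[OF this t]
  have "((\<lambda>t. a * u + integral {0..t} (\<lambda>s. v (\<Theta> u s) * g s)) has_real_derivative v (\<Theta> u t) * g t) (at t within {0..e})"
    by (auto intro!: derivative_eq_intros)
  then show ?thesis
    by (rule has_field_derivative_transform_within[OF _ zero_less_one t]) (simp add: \<Theta>_eq)
qed

text \<open>
  The difference quotient of \<open>v\<close>, continuous across the diagonal. With it the difference of two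
  solutions solves a linear equation, which yields uniqueness and the derivative in the initial
  value at once.
\<close>
definition slope :: "real \<Rightarrow> real \<Rightarrow> real" where
  "slope x y = integral {0..1} (\<lambda>r. v' (x + r * (y - x)))"

lemma slope_mult: "v y - v x = slope x y * (y - x)"
proof -
  have "((\<lambda>r. v' (x + r * (y - x)) * (y - x)) has_integral v (x + 1 * (y - x)) - v (x + 0 * (y - x))) {0..1}"
  proof (rule fundamental_theorem_of_calculus)
    fix r :: real
    have "((\<lambda>r. v (x + r * (y - x))) has_real_derivative v' (x + r * (y - x)) * (y - x)) (at r within {0..1})"
      by (rule DERIV_chain2[where f = v, OF v_deriv]) (auto intro!: derivative_eq_intros)
    then show "((\<lambda>r. v (x + r * (y - x))) has_vector_derivative v' (x + r * (y - x)) * (y - x)) (at r within {0..1})"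
      by (simp add: has_real_derivative_iff_has_vector_derivative)
  qed simp
  from integral_unique[OF this]
  have "integral {0..1} (\<lambda>r. v' (x + r * (y - x)) * (y - x)) = v y - v x" by simp
  then show ?thesis unfolding slope_def by (simp only: integral_mult_left)
qed

lemma slope_same: "slope x x = v' x"
  by (simp add: slope_def)

lemma slope_cont: "continuous_on A (\<lambda>(x, y). slope x y)"
proof -
  have "continuous_on (A \<times> cbox 0 1) (\<lambda>(z, r). v' (fst z + r * (snd z - fst z)))"
    unfolding split_beta by (intro continuous_on_compose2[OF v'_cont[of UNIV]] continuous_intros) auto
  from integral_continuous_on_param[OF this] show ?thesis by (simp add: slope_def split_beta)
qed

lemma solutions_difference:
  assumes y1: "\<And>t. t \<in> {0..e} \<Longrightarrow> (y1 has_real_derivative v (y1 t) * g t) (at t within {0..e})"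
    and y2: "\<And>t. t \<in> {0..e} \<Longrightarrow> (y2 has_real_derivative v (y2 t) * g t) (at t within {0..e})"
    and t: "t \<in> {0..e}"
  shows "y2 t - y1 t = (y2 0 - y1 0) * exp (integral {0..t} (\<lambda>s. slope (y1 s) (y2 s) * g s))"
proof (rule linear_ode_unique[OF _ _ t, where w = "\<lambda>t. y2 t - y1 t"])
  have "continuous_on {0..e} y1" "continuous_on {0..e} y2"
    by (rule DERIV_continuous_on[OF y1] DERIV_continuous_on[OF y2], assumption)+
  then have "continuous_on {0..e} (\<lambda>s. (\<lambda>(x, y). slope x y) (y1 s, y2 s))"
    by (intro continuous_on_compose2[OF slope_cont[of UNIV]] continuous_intros) auto
  then show "continuous_on {0..e} (\<lambda>s. slope (y1 s) (y2 s) * g s)"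
    by (auto intro!: continuous_intros g_cont)
  show "((\<lambda>t. y2 t - y1 t) has_real_derivative slope (y1 s) (y2 s) * g s * (y2 s - y1 s)) (at s within {0..e})"
    if "s \<in> {0..e}" for s
  proof -
    have "v (y2 s) * g s - v (y1 s) * g s = slope (y1 s) (y2 s) * g s * (y2 s - y1 s)"
      unfolding left_diff_distrib[symmetric] slope_mult by simp
    then show ?thesis using DERIV_diff[OF y2[OF that] y1[OF that]] by simp
  qed
qed

text \<open>By periodicity of \<open>v\<close> the shifted solution solves the same equation; equal
  initial values make the two agree.\<close>

lemma \<Theta>_shift:
  assumes per: "\<And>x. v (x + p) = v x" and q: "a * q = p" and t: "t \<in> {0..e}"
  shows "\<Theta> (u + q) t = \<Theta> u t + p"
proof -
  have "((\<lambda>t. \<Theta> u t + p) has_real_derivative v (\<Theta> u s + p) * g s) (at s within {0..e})" if "s \<in> {0..e}" for s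
    using \<Theta>_t_deriv[OF that] by (auto intro!: derivative_eq_intros simp: per)
  from solutions_difference[OF \<Theta>_t_deriv this t, of "u + q"]
  show ?thesis using q by (simp add: algebra_simps)
qed

text \<open>Solution of the variational equation along the flow. The exponential form shows that it
  keeps the sign of \<open>a\<close>, so the reparametrisation never degenerates.\<close>

definition W :: "real \<Rightarrow> real \<Rightarrow> real" where
  "W u t = a * exp (integral {0..t} (\<lambda>s. v' (\<Theta> u s) * g s))"

lemma \<Theta>_u_deriv:
  assumes t: "t \<in> {0..e}"
  shows "((\<lambda>u. \<Theta> u t) has_real_derivative W u t) (at u)"
proof -
  \<comment> \<open>The difference quotient of the flow in \<open>u\<close> equals
    \<open>E h\<close> exactly, without error term, so only continuity of \<open>E\<close> at 0 is
    left to prove.\<close>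
  define E where "E h = a * exp (integral {0..t} (\<lambda>s. slope (\<Theta> u s) (\<Theta> (u + h) s) * g s))" for h
  have diff: "\<Theta> (u + h) t - \<Theta> u t = h * E h" for h
    using solutions_difference[OF \<Theta>_t_deriv[of _ u] \<Theta>_t_deriv[of _ "u + h"] t] by (simp add: E_def algebra_simps)
  have "continuous_on (UNIV \<times> cbox 0 t) (\<lambda>(h, s). slope (\<Theta> u s) (\<Theta> (u + h) s) * g s)"
  proof -
    have 1: "continuous_on (UNIV \<times> cbox 0 t) (\<lambda>x. \<Theta> u (snd x))"
      using t by (intro continuous_on_compose2[OF \<Theta>_slice]) (auto intro!: continuous_intros)
    have "continuous_on (UNIV \<times> cbox 0 t) (\<lambda>x. (\<lambda>(u, t). \<Theta> u t) (u + fst x, snd x))"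
      using t by (intro continuous_on_compose2[OF \<Theta>_cont]) (auto intro!: continuous_intros)
    then have 2: "continuous_on (UNIV \<times> cbox 0 t) (\<lambda>x. \<Theta> (u + fst x) (snd x))" by simp
    have "continuous_on (UNIV \<times> cbox 0 t) (\<lambda>x. (\<lambda>(x, y). slope x y) (\<Theta> u (snd x), \<Theta> (u + fst x) (snd x)))"
      by (rule continuous_on_compose2[OF slope_cont[of UNIV] continuous_on_Pair[OF 1 2]]) auto
    moreover have "continuous_on (UNIV \<times> cbox 0 t) (\<lambda>x. g (snd x))"
      using t by (intro continuous_on_compose2[OF g_cont]) (auto intro!: continuous_intros)
    ultimately show ?thesis by (auto simp: split_beta intro!: continuous_intros)
  qed
  from integral_continuous_on_param[OF this]
  have "continuous_on UNIV E" unfolding E_def by (auto intro!: continuous_intros)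
  then have "E \<midarrow>0\<rightarrow> E 0" by (simp add: continuous_on_eq_continuous_at isCont_def)
  moreover have "E 0 = W u t" by (simp add: E_def W_def slope_same)
  moreover have "(\<lambda>h. (\<Theta> (u + h) t - \<Theta> u t) / h) \<midarrow>0\<rightarrow> W u t \<longleftrightarrow> E \<midarrow>0\<rightarrow> W u t"
    by (rule LIM_cong) (auto simp: diff)
  ultimately show ?thesis by (simp add: DERIV_def)
qed

text \<open>Bootstrapping: both partials are built from \<open>\<Theta>\<close> by composition with
  smooth functions, products and time integration, so each order of regularity of
  \<open>\<Theta>\<close> yields the next.\<close>

lemma \<Theta>_smooth: "Ck_on k (UNIV \<times> {0..e}) (\<lambda>(u, t). \<Theta> u t)"
proof (induction k)
  case 0
  then show ?case using \<Theta>_cont by simp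
next
  case (Suc k)
  have snd_C: "Ck_on k (UNIV \<times> {0..e}) (\<lambda>x::real \<times> real. g (snd x))"
    by (rule Ck_on_compose_real[OF g_smooth Ck_on_ident_linear[OF bounded_linear_snd]]) auto
  have comp: "Ck_on k (UNIV \<times> {0..e}) (\<lambda>x. h ((\<lambda>(u, t). \<Theta> u t) x) * g (snd x))" if "Ck_on k UNIV h" for h
    by (intro Ck_on_mult snd_C Ck_on_compose_real[OF that Suc.IH]) auto
  have "Ck_on k (UNIV \<times> {0..e}) (\<lambda>(u, t). integral {0..t} (\<lambda>s. v' (\<Theta> u s) * g s))"
    using Ck_on_integral_upper_limit[OF comp[OF v'_smooth]] by simp
  then have "Ck_on k (UNIV \<times> {0..e}) (\<lambda>x. a * exp ((\<lambda>(u, t). integral {0..t} (\<lambda>s. v' (\<Theta> u s) * g s)) x))"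
    by (intro Ck_on_mult Ck_on_const Ck_on_compose_real[OF Ck_on_exp[of k UNIV]]) auto
  then have W_C: "Ck_on k (UNIV \<times> {0..e}) (\<lambda>(u, t). W u t)" by (simp add: W_def case_prod_beta')
  have ft_C: "Ck_on k (UNIV \<times> {0..e}) (\<lambda>(u, t). v (\<Theta> u t) * g t)"
    using comp[OF v_smooth] by (simp add: case_prod_beta')
  show ?case
  proof (rule Ck_on_Suc_partials[OF _ W_C ft_C])
    fix x :: "real \<times> real" assume x: "x \<in> UNIV \<times> {0..e}"
    show "((\<lambda>(u, t). \<Theta> u t) has_derivative (\<lambda>w. fst w *\<^sub>R (case x of (u, t) \<Rightarrow> W u t) + snd w *\<^sub>R (case x of (u, t) \<Rightarrow> v (\<Theta> u t) * g t)))
       (at x within UNIV \<times> {0..e})"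
      using has_derivative_partials_product[of "{0..e}" \<Theta> W "\<lambda>u t. v (\<Theta> u t) * g t" x]
        \<Theta>_u_deriv \<Theta>_t_deriv Ck_on_imp_continuous_on[OF ft_C] x by (simp add: case_prod_beta')
  qed
qed

end

section \<open>The shrinker\<close>

lemma Ck_on_slice:
  fixes f :: "real \<times> real \<Rightarrow> 'b::real_normed_vector"
  shows "Ck_on k (UNIV \<times> J) f \<Longrightarrow> t \<in> J \<Longrightarrow> Ck_on k UNIV (\<lambda>u. f (u, t))"
proof (induction k arbitrary: f)
  case 0
  then have "continuous_on (UNIV \<times> J) f" by simp
  then have "continuous_on UNIV (\<lambda>u. f (u, t))"
    by (rule continuous_on_compose2[OF _ continuous_on_Pair[OF continuous_on_id continuous_on_const]]) (use 0 in auto)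
  then show ?case by simp
next
  case (Suc k)
  then obtain f' where f': "\<forall>x\<in>UNIV \<times> J. (f has_derivative f' x) (at x within UNIV \<times> J)"
     "\<forall>v. Ck_on k (UNIV \<times> J) (\<lambda>x. f' x v)" by auto
  have "((\<lambda>u. f (u, t)) has_derivative (\<lambda>v. f' (u, t) (v, 0))) (at u within UNIV)" for u
    by (rule has_derivative_in_compose2[of "UNIV \<times> J" f f' "\<lambda>u. (u, t)"])
      (use f'(1) Suc.prems(2) in \<open>auto intro!: derivative_eq_intros\<close>)
  moreover have "Ck_on k UNIV (\<lambda>u. f' (u, t) (v, 0))" for v
    using Suc.IH[of "\<lambda>x. f' x (v, 0)"] f'(2) Suc.prems(2) by blast
  ultimately show ?case by (auto intro!: exI[of _ "\<lambda>u v. f' (u, t) (v, 0)"])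
qed

lemma Ck_on_sqrt_linear:
  assumes "b > 0"
  shows "Ck_on k {t. 2 * b * t < 1} (\<lambda>t. sqrt (1 - 2 * b * t))"
proof (induction k)
  case 0
  then show ?case by (auto intro!: continuous_intros)
next
  case (Suc k)
  show ?case
  proof (rule Ck_on_Suc_real)
    show "((\<lambda>t. sqrt (1 - 2 * b * t)) has_vector_derivative (- b) * inverse (sqrt (1 - 2 * b * t))) (at t within {t. 2 * b * t < 1})"
      if "t \<in> {t. 2 * b * t < 1}" for t
      using that by (auto intro!: derivative_eq_intros simp: has_real_derivative_iff_has_vector_derivative[symmetric] field_simps)
    show "Ck_on k {t. 2 * b * t < 1} (\<lambda>t. (- b) * inverse (sqrt (1 - 2 * b * t)))"
      by (intro Ck_on_mult Ck_on_const Ck_on_inverse_compose Suc.IH) auto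
  qed
qed

lemma periodic_continuous_bounded:
  fixes f :: "real \<Rightarrow> real"
  assumes P: "P > 0" and per: "\<And>x. f (x + P) = f x" and cont: "continuous_on UNIV f"
  obtains B where "\<And>x. \<bar>f x\<bar> \<le> B"
proof -
  interpret f: periodic_fun_simple f P by unfold_locales (rule per)
  have "compact (f ` {0..P})" by (intro compact_continuous_image continuous_on_subset[OF cont]) auto
  then obtain B where B: "\<And>y. y \<in> f ` {0..P} \<Longrightarrow> \<bar>y\<bar> \<le> B"
    using compact_imp_bounded bounded_iff by (metis real_norm_def)
  have "\<bar>f x\<bar> \<le> B" for x
  proof -
    define u where "u = x - of_int \<lfloor>x / P\<rfloor> * P"
    have "u \<in> {0..P}" using floor_remainder_bounds[OF P, of x] by (simp add: u_def)
    moreover have "f u = f x" using f.minus_of_int[of x "\<lfloor>x / P\<rfloor>"] by (simp add: u_def)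
    ultimately show ?thesis using B by (metis image_eqI)
  qed
  then show ?thesis by (rule that)
qed

text \<open>Translates derivatives on the circle into ordinary derivatives in the angle; the
  geometric quantities of the evolving curve are computed through it.\<close>

lemma circle_deriv_cis:
  assumes "\<And>u. f (cis u) = \<phi> u" "(\<phi> has_vector_derivative d) (at u)"
  shows "circle_deriv f (cis u) = d"
proof -
  have "((\<phi> \<circ> (\<lambda>s. u + s)) has_vector_derivative 1 *\<^sub>R d) (at 0)"
    by (rule vector_diff_chain_at) (use assms(2) in \<open>auto intro!: derivative_eq_intros\<close>)
  moreover have "(\<lambda>s. f (cis u * cis s)) = \<phi> \<circ> (\<lambda>s. u + s)"
    by (auto simp: cis_mult assms(1))
  ultimately show ?thesis unfolding circle_deriv_def by (simp add: vector_derivative_at)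
qed

lemma unit_circle_cis:
  assumes "z \<in> unit_circle"
  obtains u where "z = cis u"
  using assms by (metis cis_Arg norm_eq_zero dist_0_norm mem_sphere sgn_div_norm scaleR_one inverse_1 zero_neq_one)

lemma unit_circle_eq_range_cis: "unit_circle = range cis"
  by (auto elim: unit_circle_cis)

lemma cis_scaleR_inner_i: "(c *\<^sub>R (\<i> * cis \<theta>)) \<bullet> (\<i> * cis \<theta>) = c"
proof -
  have "(\<i> * cis \<theta>) \<bullet> (\<i> * cis \<theta>) = 1" by (simp add: power2_norm_eq_inner[symmetric] norm_mult)
  then show ?thesis by simp
qed

lemma winding_number_cis_multiple:
  fixes m :: nat
  shows "winding_number (\<lambda>s. cis (of_nat m * (2 * pi * s))) 0 = of_nat m"
proof -
  define p where "p = (\<lambda>s::real. cis (of_nat m * (2 * pi * s)))"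
  have d: "(p has_vector_derivative (of_nat m * 2 * pi * \<i>) * p s) (at s within A)" for s A
    unfolding p_def by (auto intro!: derivative_eq_intros simp: has_vector_derivative_def scaleR_conv_of_real mult_ac)
  have "p C1_differentiable_on {0..1}"
    unfolding C1_differentiable_on_def
    by (intro exI[of _ "\<lambda>s. (of_nat m * 2 * pi * \<i>) * p s"] conjI ballI d)
      (auto simp: p_def intro!: continuous_intros)
  then have v: "valid_path p" unfolding valid_path_def by (rule C1_differentiable_imp_piecewise)
  have z: "0 \<notin> path_image p" by (auto simp: path_image_def p_def)
  have "((\<lambda>w. 1 / (w - 0)) has_contour_integral (of_nat m * 2 * pi * \<i>)) p"
  proof -
    have "((\<lambda>s. 1 / (p s - 0) * vector_derivative p (at s within {0..1})) has_integral (of_nat m * 2 * pi * \<i>)) {0..1}"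
    proof (rule has_integral_eq)
      show "((\<lambda>s::real. of_nat m * 2 * pi * \<i>) has_integral (of_nat m * 2 * pi * \<i>)) {0..1}"
        using has_integral_const_real[of "of_nat m * 2 * pi * \<i>" 0 1] by simp
      show "of_nat m * 2 * pi * \<i> = 1 / (p s - 0) * vector_derivative p (at s within {0..1})" if "s \<in> {0..1}" for s
      proof -
        have "vector_derivative p (at s within {0..1}) = (of_nat m * 2 * pi * \<i>) * p s"
          by (rule vector_derivative_within_closed_interval[OF _ that d]) simp
        then show ?thesis by (simp add: p_def)
      qed
    qed
    then show ?thesis by (simp add: has_contour_integral_def)
  qed
  then have "contour_integral p (\<lambda>w. 1 / (w - 0)) = of_nat m * 2 * pi * \<i>" by (rule contour_integral_unique)
  then show ?thesis using winding_number_valid_path[OF v z] unfolding p_def by simp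
qed

section \<open>The closed curve determined by a periodic curvature function\<close>

locale curvature_profile =
  fixes k k' :: "real \<Rightarrow> real" and b P :: real and m n :: nat
  assumes b: "b > 0" and kpos: "\<And>\<theta>. k \<theta> > 0"
    and per: "\<And>\<theta>. k (\<theta> + P) = k \<theta>"
    and D1: "\<And>\<theta>. (k has_real_derivative k' \<theta>) (at \<theta>)"
    and D2: "\<And>\<theta>. (k' has_real_derivative 1 - k \<theta> + b / k \<theta>) (at \<theta>)"
    and mean: "integral {0..P} (\<lambda>s. 1 / k s) = P"
    and nonconst: "\<exists>s t. k s \<noteq> k t"
    and m0: "m > 0" and n0: "n > 0" and cop: "coprime m n"
    and Pn: "P * n = 2 * pi * m"
begin

lemma P0: "P > 0"
proof -
  have "P * n > 0" unfolding Pn using m0 by simp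
  then show ?thesis using n0 by (simp add: zero_less_mult_iff)
qed

text \<open>The differential equation expresses the derivative of \<open>k'\<close> smoothly through
  \<open>k > 0\<close>, so regularity of both is raised simultaneously.\<close>

lemma k_smooth: "Ck_on j UNIV k" and k'_smooth: "Ck_on j UNIV k'"
proof -
  have "Ck_on j UNIV k \<and> Ck_on j UNIV k'"
  proof (induction j)
    case 0
    show ?case using D1 D2 by (auto intro!: DERIV_continuous_on)
  next
    case (Suc j)
    have "Ck_on j UNIV (\<lambda>\<theta>. (1 + (-1) * k \<theta>) + b * inverse (k \<theta>))"
      using Suc by (intro Ck_on_add Ck_on_mult Ck_on_const Ck_on_inverse_compose kpos) auto
    then have "Ck_on (Suc j) UNIV k'"
      by (rule Ck_on_Suc_real[rotated])
        (use D2 in \<open>simp add: has_real_derivative_iff_has_vector_derivative field_class.field_divide_inverse\<close>)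
    moreover have "Ck_on (Suc j) UNIV k"
      by (rule Ck_on_Suc_real[of _ _ k']) (use D1 Suc in \<open>simp_all add: has_real_derivative_iff_has_vector_derivative\<close>)
    ultimately show ?case by blast
  qed
  then show "Ck_on j UNIV k" "Ck_on j UNIV k'" by auto
qed

lemma k_cont: "continuous_on A k" and k'_cont: "continuous_on A k'"
  using Ck_on_imp_continuous_on[OF k_smooth[of 0]] Ck_on_imp_continuous_on[OF k'_smooth[of 0]]
  by (auto intro: continuous_on_subset)

lemma k'_per: "k' (\<theta> + P) = k' \<theta>"
proof -
  have "((\<lambda>x. k (x + P)) has_real_derivative k' (\<theta> + P)) (at \<theta>)"
    using D1[of "\<theta> + P"] by (simp add: DERIV_shift)
  then show ?thesis using D1[of \<theta>] by (simp add: per DERIV_unique)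
qed

sublocale k: periodic_fun_simple k P by unfold_locales (rule per)
sublocale k': periodic_fun_simple k' P by unfold_locales (rule k'_per)

text \<open>
  The curve with support function \<open>h = (k - 1) / b\<close> (outward normal \<open>- \<i> cis \<theta>\<close>), parametrised by its
  tangent angle; \<open>h'' + h = 1 / k\<close> makes \<open>k\<close> its curvature.
\<close>
definition F :: "real \<Rightarrow> complex" where
  "F \<theta> = cis \<theta> * (of_real (k' \<theta> / b) - \<i> * of_real ((k \<theta> - 1) / b))"

lemma F_deriv: "(F has_vector_derivative (1 / k \<theta>) *\<^sub>R cis \<theta>) (at \<theta> within A)"
proof -
  have 1: "((\<lambda>x. of_real (k' x / b)) has_vector_derivative complex_of_real ((1 - k \<theta> + b / k \<theta>) / b)) (at \<theta> within A)"
    by (rule has_vector_derivative_of_real[OF has_field_derivative_at_within[OF DERIV_cdivide[OF D2]]])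
  have "((\<lambda>x. (k x - 1) / b) has_real_derivative k' \<theta> / b) (at \<theta>)"
    using b by (auto intro!: derivative_eq_intros D1)
  then have 2: "((\<lambda>x. of_real ((k x - 1) / b)) has_vector_derivative complex_of_real (k' \<theta> / b)) (at \<theta> within A)"
    by (rule has_vector_derivative_of_real[OF has_field_derivative_at_within])
  have 3: "(cis has_vector_derivative \<i> * cis \<theta>) (at \<theta> within A)"
    by (auto intro!: derivative_eq_intros simp: has_vector_derivative_def)
  have "(F has_vector_derivative (cis \<theta> * (of_real ((1 - k \<theta> + b / k \<theta>) / b) - \<i> * of_real (k' \<theta> / b))
      + (\<i> * cis \<theta>) * (of_real (k' \<theta> / b) - \<i> * of_real ((k \<theta> - 1) / b)))) (at \<theta> within A)"
    unfolding F_def[abs_def]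
    by (intro has_vector_derivative_mult 3 has_vector_derivative_diff 1 has_vector_derivative_mult_right 2)
  moreover have "cis \<theta> * (of_real ((1 - k \<theta> + b / k \<theta>) / b) - \<i> * of_real (k' \<theta> / b))
      + (\<i> * cis \<theta>) * (of_real (k' \<theta> / b) - \<i> * of_real ((k \<theta> - 1) / b)) = (1 / k \<theta>) *\<^sub>R cis \<theta>"
  proof -
    have "(1 - k \<theta> + b / k \<theta>) / b + (k \<theta> - 1) / b = 1 / k \<theta>" using b kpos[of \<theta>] by (simp add: field_simps)
    then have "complex_of_real ((1 - k \<theta> + b / k \<theta>) / b) + of_real ((k \<theta> - 1) / b) = of_real (1 / k \<theta>)"
      by (metis of_real_add)
    moreover have "c * (x - \<i> * y) + (\<i> * c) * (y - \<i> * z) = (x + z) * c" for c x y z :: complex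
      by (simp add: algebra_simps flip: power2_eq_square)
    ultimately show ?thesis by (simp only: scaleR_conv_of_real)
  qed
  ultimately show ?thesis by simp
qed

lemma F_smooth: "Ck_on j UNIV F"
proof -
  have "Ck_on j UNIV (\<lambda>\<theta>. (1 * cis \<theta>) * (of_real (k' \<theta> * (1 / b)) + (- \<i>) * of_real ((k \<theta> + (- 1)) * (1 / b))))"
    by (intro Ck_on_mult Ck_on_cis Ck_on_add Ck_on_const k_smooth k'_smooth
        Ck_on_bounded_linear[OF bounded_linear_of_real])
  then show ?thesis by (rule Ck_on_cong) (simp add: F_def)
qed

lemma F_shift: "F (\<theta> + of_int j * P) = cis (of_int j * P) * F \<theta>"
  by (simp add: F_def k.plus_of_int k'.plus_of_int cis_mult[symmetric])

lemma F_shift_full: "F (\<theta> + 2 * pi * m) = F \<theta>"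
proof -
  have "of_int (int n) * P = 2 * pi * m" using Pn by (simp add: mult.commute)
  then have "F (\<theta> + 2 * pi * m) = cis (2 * pi * m) * F \<theta>" using F_shift[of \<theta> "int n"] by simp
  then show ?thesis by simp
qed

text \<open>Shifting the tangent angle by \<open>P\<close> rotates the curve by
  \<open>P = 2 pi m / n\<close>. Since m and n are coprime, Bezout gives a multiple of this angle
  that is \<open>2 pi / n\<close> modulo full turns.\<close>

lemma F_image_symmetric: "(\<lambda>p. cis (2 * pi / n) * p) ` range F = range F"
proof -
  have "coprime (int m) (int n)" using cop by simp
  then have "gcd (int m) (int n) = 1" by (rule coprime_imp_gcd_eq_1)
  then obtain j l :: int where jl: "j * int m + l * int n = 1"
    using bezout_int[of "int m" "int n"] by metis
  have "of_int j * P * n = (2 * pi / n - of_int l * (2 * pi)) * n"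
  proof -
    have "real_of_int (j * int m + l * int n) = 1" unfolding jl by simp
    then have "real_of_int j * real m = 1 - real_of_int l * real n" by simp
    moreover have "real_of_int j * P * real n = real_of_int j * (2 * pi * real m)" unfolding Pn[symmetric] by simp
    then have "real_of_int j * P * real n = 2 * pi * (real_of_int j * real m)" by simp
    ultimately have "real_of_int j * P * real n = 2 * pi * (1 - real_of_int l * real n)" by (simp only:)
    also have "\<dots> = (2 * pi / n - of_int l * (2 * pi)) * n" using n0 by (simp add: left_diff_distrib right_diff_distrib)
    finally show ?thesis .
  qed
  then have jP: "of_int j * P = 2 * pi / n - of_int l * (2 * pi)" using n0 by simp
  have one: "cis (of_int l * (2 * pi)) = 1"
    by (subst mult.commute) (rule cis_multiple_2pi[OF Ints_of_int])
  have "cis (of_int j * P) = cis (2 * pi / n)"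
    unfolding jP cis_divide[symmetric] one by simp
  then have sh: "F (\<theta> + of_int j * P) = cis (2 * pi / n) * F \<theta>" for \<theta> using F_shift[of \<theta> j] by simp
  show ?thesis
  proof (intro equalityI subsetI)
    fix z assume "z \<in> (\<lambda>p. cis (2 * pi / n) * p) ` range F"
    then show "z \<in> range F" by (auto simp: sh[symmetric])
  next
    fix z assume "z \<in> range F"
    then obtain \<theta> where "z = F \<theta>" by auto
    then have "z = cis (2 * pi / n) * F (\<theta> - of_int j * P)" using sh[of "\<theta> - of_int j * P"] by simp
    then show "z \<in> (\<lambda>p. cis (2 * pi / n) * p) ` range F" by blast
  qed
qed

text \<open>Differentiating the squared distance to \<open>c\<close> shows that \<open>F - c\<close>
  is normal to the curve; differentiating again, its normal component is \<open>- (1 / k)\<close>; a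
  third derivative shows that this component is constant, contradicting nonconstant
  \<open>k\<close>.\<close>

lemma F_not_in_sphere: "\<not> range F \<subseteq> sphere c r"
proof
  assume sub: "range F \<subseteq> sphere c r"
  have cisD: "((\<lambda>x. cis x) has_vector_derivative \<i> * cis \<theta>) (at \<theta>)" for \<theta>
    by (auto intro!: derivative_eq_intros simp: has_vector_derivative_def)
  have FD: "((\<lambda>x. F x - c) has_vector_derivative (1 / k \<theta>) *\<^sub>R cis \<theta>) (at \<theta>)" for \<theta>
    using has_vector_derivative_diff[OF F_deriv[of \<theta> UNIV] has_vector_derivative_const[of c]] by simp
  have cc: "cis \<theta> \<bullet> cis \<theta> = 1" "cis \<theta> \<bullet> (\<i> * cis \<theta>) = 0" "(\<i> * cis \<theta>) \<bullet> (\<i> * cis \<theta>) = 1" for \<theta>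
    by (simp_all add: inner_complex_def power2_eq_square[symmetric])
  have inn: "((\<lambda>x. f x \<bullet> g x) has_real_derivative (f \<theta> \<bullet> g' + f' \<bullet> g \<theta>)) (at \<theta>)"
    if "(f has_vector_derivative f') (at \<theta>)" "(g has_vector_derivative g') (at \<theta>)" for f g :: "real \<Rightarrow> complex" and f' g' \<theta>
    using bounded_bilinear.has_vector_derivative[OF bounded_bilinear_inner that]
    by (simp add: has_real_derivative_iff_has_vector_derivative)
  have const: "(F \<theta> - c) \<bullet> (F \<theta> - c) = r\<^sup>2" for \<theta>
    using sub by (auto simp: dist_norm norm_minus_commute power2_norm_eq_inner[symmetric] image_subset_iff)
  have A: "(F \<theta> - c) \<bullet> cis \<theta> = 0" for \<theta>
  proof -
    have "((\<lambda>x. (F x - c) \<bullet> (F x - c)) has_real_derivative ((F \<theta> - c) \<bullet> ((1 / k \<theta>) *\<^sub>R cis \<theta>) + ((1 / k \<theta>) *\<^sub>R cis \<theta>) \<bullet> (F \<theta> - c))) (at \<theta>)"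
      by (rule inn[OF FD FD])
    then have "(F \<theta> - c) \<bullet> ((1 / k \<theta>) *\<^sub>R cis \<theta>) + ((1 / k \<theta>) *\<^sub>R cis \<theta>) \<bullet> (F \<theta> - c) = 0"
      unfolding const by (rule DERIV_unique[OF _ DERIV_const])
    then show ?thesis using kpos[of \<theta>] by (simp add: inner_commute)
  qed
  have B: "(F \<theta> - c) \<bullet> (\<i> * cis \<theta>) = - (1 / k \<theta>)" for \<theta>
  proof -
    have "((\<lambda>x. (F x - c) \<bullet> cis x) has_real_derivative ((F \<theta> - c) \<bullet> (\<i> * cis \<theta>) + ((1 / k \<theta>) *\<^sub>R cis \<theta>) \<bullet> cis \<theta>)) (at \<theta>)"
      by (rule inn[OF FD cisD])
    then have "(F \<theta> - c) \<bullet> (\<i> * cis \<theta>) + ((1 / k \<theta>) *\<^sub>R cis \<theta>) \<bullet> cis \<theta> = 0"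
      unfolding A by (rule DERIV_unique[OF _ DERIV_const])
    then show ?thesis using cc by simp
  qed
  have "((\<lambda>x. (F x - c) \<bullet> (\<i> * cis x)) has_real_derivative 0) (at \<theta>)" for \<theta>
  proof -
    have "((\<lambda>x. (F x - c) \<bullet> (\<i> * cis x)) has_real_derivative
       ((F \<theta> - c) \<bullet> (\<i> * (\<i> * cis \<theta>)) + ((1 / k \<theta>) *\<^sub>R cis \<theta>) \<bullet> (\<i> * cis \<theta>))) (at \<theta>)"
      by (rule inn[OF FD has_vector_derivative_mult_right[OF cisD]])
    moreover have "\<i> * (\<i> * cis \<theta>) = - cis \<theta>" by (simp add: complex_eq_iff)
    ultimately show ?thesis using A cc by simp
  qed
  then have "(F s - c) \<bullet> (\<i> * cis s) = (F t - c) \<bullet> (\<i> * cis t)" for s t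
    by (intro DERIV_isconst_all) blast
  then have "k s = k t" for s t unfolding B using kpos[of s] kpos[of t] by simp
  then show False using nonconst by blast
qed

text \<open>
  The homothety \<open>\<psi> F\<close> with \<open>\<psi> = sqrt (1 - 2 b t)\<close> has the right normal velocity; cancelling its tangential
  velocity requires the tangent angle to move by \<open>\<theta>' = k k' / \<psi>^2\<close>.
\<close>
definition v where "v \<theta> = k \<theta> * k' \<theta>"
definition v' where "v' \<theta> = k' \<theta> * k' \<theta> + (k \<theta> + (- 1) * (k \<theta> * k \<theta>) + b)"

lemma v_deriv: "(v has_real_derivative v' \<theta>) (at \<theta>)"
proof -
  have "(v has_real_derivative k' \<theta> * k' \<theta> + (1 - k \<theta> + b / k \<theta>) * k \<theta>) (at \<theta>)"
    unfolding v_def[abs_def] by (rule DERIV_mult[OF D1 D2])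
  also have "k' \<theta> * k' \<theta> + (1 - k \<theta> + b / k \<theta>) * k \<theta> = v' \<theta>"
    using kpos[of \<theta>] by (simp add: v'_def algebra_simps)
  finally show ?thesis .
qed

lemma v'_smooth: "Ck_on j UNIV v'"
  unfolding v'_def[abs_def] by (intro Ck_on_add Ck_on_mult Ck_on_const k_smooth k'_smooth)

lemma v_per: "v (\<theta> + 2 * pi * m) = v \<theta>"
proof -
  have "of_int (int n) * P = 2 * pi * m" using Pn by (simp add: mult.commute)
  then show ?thesis using k.plus_of_int[of \<theta> "int n"] k'.plus_of_int[of \<theta> "int n"] by (simp add: v_def)
qed

text \<open>The factor \<open>1 / \<psi>^2\<close> of the tangent angle equation, written with sums,
  products and \<open>inverse\<close> to fit the closure rules for \<open>Ck_on\<close>.\<close>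

definition g where "g t = inverse (1 + (- 2 * b) * t)"

lemma flow_exists:
  obtains e \<Theta> where "e > 0" "2 * b * e < 1" "scalar_flow v v' g \<Theta> e m"
proof -
  obtain V where V: "\<And>x. \<bar>v x\<bar> \<le> V"
    by (rule periodic_continuous_bounded[OF P0, of v])
      (auto simp: v_def per k'_per intro!: continuous_intros k_cont k'_cont)
  obtain L where L: "\<And>x. \<bar>v' x\<bar> \<le> L"
    by (rule periodic_continuous_bounded[OF P0, of v'])
      (auto simp: v'_def per k'_per intro!: continuous_intros k_cont k'_cont)
  have L0: "L \<ge> 0" using L[of 0] by simp
  have lip: "\<bar>v x - v y\<bar> \<le> L * \<bar>x - y\<bar>" for x y
  proof -
    have "norm (v x - v y) \<le> L * norm (x - y)"
      by (rule field_differentiable_bound[of UNIV v v'])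
        (use v_deriv L in \<open>auto intro: has_field_derivative_at_within\<close>)
    then show ?thesis by simp
  qed
  \<comment> \<open>The first bound gives \<open>g \<le> 2\<close> and keeps the homothety factor
    away from 0; the second makes the Picard factor \<open>e * L * 2\<close> less than 1. A short
    time suffices, as a shrinker only has to evolve on some interval.\<close>
  define e where "e = min (1 / (4 * b)) (1 / (4 * (L + 1)))"
  have e0: "e > 0" using b L0 by (simp add: e_def)
  have "e \<le> 1 / (4 * b)" "e \<le> 1 / (4 * (L + 1))" by (auto simp: e_def)
  then have eb: "b * e \<le> 1 / 4" and eL: "e * (L + 1) \<le> 1 / 4" using b L0 by (auto simp: field_simps)
  have den: "1 + (- 2 * b) * t \<ge> 1 / 2" if "t \<in> {0..e}" for t
  proof -
    have "b * t \<le> b * e" using that b by simp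
    then show ?thesis using eb by simp
  qed
  have gsm: "Ck_on j {0..e} g" for j
    unfolding g_def[abs_def]
  proof (intro Ck_on_inverse_compose Ck_on_add Ck_on_const Ck_on_mult)
    show "Ck_on j {0..e} (\<lambda>x. x)" by (rule Ck_on_ident_linear[OF bounded_linear_ident])
    show "0 < 1 + (- 2 * b) * t" if "t \<in> {0..e}" for t using den[OF that] by linarith
  qed
  have gb: "\<bar>g t\<bar> \<le> 2" if "t \<in> {0..e}" for t
  proof -
    have "inverse (1 + (- 2 * b) * t) \<le> inverse (1 / 2)" using den[OF that] by (intro le_imp_inverse_le) auto
    then show ?thesis using den[OF that] by (simp add: g_def)
  qed
  have small: "e * L * 2 < 1"
  proof -
    have "e * L \<le> e * (L + 1)" using e0 by simp
    then show ?thesis using eL by linarith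
  qed
  have vc: "continuous_on UNIV v" using v_deriv by (auto intro!: DERIV_continuous_on)
  obtain \<Theta> :: "real \<Rightarrow> real \<Rightarrow> real" where \<Theta>: "continuous_on (UNIV \<times> {0..e}) (\<lambda>(u, t). \<Theta> u t)"
    "\<And>u t. t \<in> {0..e} \<Longrightarrow> \<Theta> u t = real m * u + integral {0..t} (\<lambda>s. v (\<Theta> u s) * g s)"
    by (rule picard_solution[OF less_imp_le[OF e0] vc Ck_on_imp_continuous_on[OF gsm[of 0]] V lip gb small, of "real m"]) blast+
  show ?thesis
  proof (rule that[of e \<Theta>])
    show "2 * b * e < 1" using eb by linarith
    show "scalar_flow v v' g \<Theta> e m"
      by unfold_locales (use e0 v_deriv v'_smooth gsm \<Theta> in auto)
  qed (rule e0)
qed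

end

section \<open>The homothetic evolution and its geometry\<close>

lemma cis_eq_iff_shift: "cis a = cis c \<longleftrightarrow> (\<exists>j::int. c = a + of_int j * (2 * pi))"
proof -
  have "cis a = cis c \<longleftrightarrow> sin c = sin a \<and> cos c = cos a" by (auto simp: complex_eq_iff)
  also have "\<dots> \<longleftrightarrow> (\<exists>j::int. c = a + 2 * pi * j)" by (rule sin_cos_eq_iff)
  finally show ?thesis by (simp add: mult.commute)
qed

lemma sgn_pos_scaleR_cis: "c > 0 \<Longrightarrow> sgn (c *\<^sub>R cis \<theta>) = cis \<theta>"
  by (simp add: sgn_scaleR sgn_div_norm)

lemma has_integral_DERIV:
  fixes f f' :: "real \<Rightarrow> real"
  assumes "\<And>x. (f has_real_derivative f' x) (at x)" "a \<le> c"
  shows "(f' has_integral f c - f a) {a..c}"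
  using assms
  by (intro fundamental_theorem_of_calculus)
    (auto simp: has_real_derivative_iff_has_vector_derivative intro: has_vector_derivative_at_within)

lemma time_interval_ereal: "time_interval (ereal e) = {0..<e}"
  by (auto simp: time_interval_def)

locale homothetic_evolution = curvature_profile k k' b P m n + flow: scalar_flow v v' g \<Theta> e m
  for k k' b P m n \<Theta> e +
  assumes be: "2 * b * e < 1"
begin

definition \<psi> where "\<psi> t = sqrt (1 - 2 * b * t)"

text \<open>\<open>Arg\<close> is a mere choice of angle. Its jump is harmless because
  \<open>\<Theta>\<close> changes by \<open>2 pi m\<close> over a full turn and \<open>F\<close> has
  that period.\<close>

definition X :: "complex \<Rightarrow> real \<Rightarrow> complex" where
  "X z t = \<psi> t *\<^sub>R F (\<Theta> (Arg z) t)"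

lemma t_bound: "t \<in> {0..e} \<Longrightarrow> 2 * b * t < 1"
proof -
  assume "t \<in> {0..e}"
  then have "2 * b * t \<le> 2 * b * e" using b by simp
  then show ?thesis using be by linarith
qed

lemma \<psi>_pos: "t \<in> {0..e} \<Longrightarrow> \<psi> t > 0"
  using t_bound[of t] by (simp add: \<psi>_def)

lemma g_\<psi>: "t \<in> {0..e} \<Longrightarrow> g t = 1 / (\<psi> t * \<psi> t)"
  using t_bound[of t] by (simp add: g_def \<psi>_def inverse_eq_divide)

lemma \<psi>_deriv:
  assumes "t \<in> {0..e}"
  shows "(\<psi> has_real_derivative - b / \<psi> t) (at t within A)"
  unfolding \<psi>_def[abs_def] using t_bound[OF assms]
  by (auto intro!: derivative_eq_intros simp: field_simps)

lemma \<Theta>_full_shift: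
  assumes "t \<in> {0..e}"
  shows "\<Theta> (u + 2 * pi) t = \<Theta> u t + 2 * pi * m"
  by (rule flow.\<Theta>_shift[OF v_per _ assms]) simp

lemma X_cis:
  assumes t: "t \<in> {0..e}"
  shows "X (cis u) t = \<psi> t *\<^sub>R F (\<Theta> u t)"
proof -
  interpret F\<Theta>: periodic_fun_simple "\<lambda>u. F (\<Theta> u t)" "2 * pi"
    by unfold_locales (simp only: \<Theta>_full_shift[OF t] F_shift_full)
  have "cis (Arg (cis u)) = cis u" by (simp add: cis_Arg sgn_div_norm)
  then obtain j :: int where "u = Arg (cis u) + of_int j * (2 * pi)"
    unfolding cis_eq_iff_shift by blast
  then have "F (\<Theta> u t) = F (\<Theta> (Arg (cis u)) t)" using F\<Theta>.plus_of_int[of "Arg (cis u)" j] by simp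
  then show ?thesis by (simp add: X_def)
qed

lemma W_pos: "flow.W u t > 0"
  using m0 by (simp add: flow.W_def)

lemma X_u_deriv:
  assumes t: "t \<in> {0..e}"
  shows "((\<lambda>u. \<psi> t *\<^sub>R F (\<Theta> u t)) has_vector_derivative
    (\<psi> t * flow.W u t / k (\<Theta> u t)) *\<^sub>R cis (\<Theta> u t)) (at u)"
proof -
  have "((\<lambda>u. \<Theta> u t) has_vector_derivative flow.W u t) (at u)"
    using flow.\<Theta>_u_deriv[OF t] by (simp add: has_real_derivative_iff_has_vector_derivative)
  from vector_diff_chain_at[OF this F_deriv]
  have "((\<lambda>u. F (\<Theta> u t)) has_vector_derivative flow.W u t *\<^sub>R (1 / k (\<Theta> u t)) *\<^sub>R cis (\<Theta> u t)) (at u)"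
    by (simp add: o_def)
  from bounded_linear.has_vector_derivative[OF bounded_linear_scaleR_right[of "\<psi> t"] this]
  show ?thesis by simp
qed

context
  fixes t assumes t: "t \<in> {0..e}"
begin

lemma circle_deriv_X: "circle_deriv (\<lambda>z. X z t) (cis u) = (\<psi> t * flow.W u t / k (\<Theta> u t)) *\<^sub>R cis (\<Theta> u t)"
  by (rule circle_deriv_cis[OF X_cis[OF t] X_u_deriv[OF t]])

lemma speed_pos: "\<psi> t * flow.W u t / k (\<Theta> u t) > 0"
  using \<psi>_pos[OF t] W_pos kpos by simp

lemma norm_circle_deriv_X: "norm (circle_deriv (\<lambda>z. X z t) (cis u)) = \<psi> t * flow.W u t / k (\<Theta> u t)"
  unfolding circle_deriv_X norm_scaleR norm_cis using speed_pos[of u] by (simp only: abs_of_pos mult_1_right)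

lemma unit_tangent_X: "unit_tangent (\<lambda>z. X z t) (cis u) = cis (\<Theta> u t)"
  unfolding unit_tangent_def circle_deriv_X by (rule sgn_pos_scaleR_cis[OF speed_pos])

lemma circle_deriv_unit_tangent_X:
  "circle_deriv (unit_tangent (\<lambda>z. X z t)) (cis u) = flow.W u t *\<^sub>R (\<i> * cis (\<Theta> u t))"
proof (rule circle_deriv_cis[where \<phi> = "\<lambda>u. cis (\<Theta> u t)"])
  show "unit_tangent (\<lambda>z. X z t) (cis u) = cis (\<Theta> u t)" for u by (rule unit_tangent_X)
  have "((\<lambda>u. \<Theta> u t) has_vector_derivative flow.W u t) (at u)"
    using flow.\<Theta>_u_deriv[OF t] by (simp add: has_real_derivative_iff_has_vector_derivative)
  moreover have "(cis has_vector_derivative \<i> * cis \<theta>) (at \<theta>)" for \<theta>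
    by (auto intro!: derivative_eq_intros simp: has_vector_derivative_def)
  ultimately have "((cis \<circ> (\<lambda>u. \<Theta> u t)) has_vector_derivative flow.W u t *\<^sub>R (\<i> * cis (\<Theta> u t))) (at u)"
    by (rule vector_diff_chain_at)
  then show "((\<lambda>u. cis (\<Theta> u t)) has_vector_derivative flow.W u t *\<^sub>R (\<i> * cis (\<Theta> u t))) (at u)"
    by (simp add: o_def)
qed

lemma curvature_X: "curvature (\<lambda>z. X z t) (cis u) = k (\<Theta> u t) / \<psi> t"
proof -
  have "curvature (\<lambda>z. X z t) (cis u) =
      ((inverse (\<psi> t * flow.W u t / k (\<Theta> u t)) * flow.W u t) *\<^sub>R (\<i> * cis (\<Theta> u t))) \<bullet> (\<i> * cis (\<Theta> u t))"
    unfolding curvature_def arc_length_deriv_def unit_normal_def unit_tangent_X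
      circle_deriv_unit_tangent_X norm_circle_deriv_X by simp
  also have "\<dots> = inverse (\<psi> t * flow.W u t / k (\<Theta> u t)) * flow.W u t" by (rule cis_scaleR_inner_i)
  also have "\<dots> = k (\<Theta> u t) / \<psi> t" using W_pos[of u t] by (simp add: field_simps)
  finally show ?thesis .
qed

text \<open>Curvature times speed is \<open>W\<close>, the derivative of the tangent angle, so the
  integral is the increment of \<open>\<Theta>\<close> over one turn.\<close>

lemma total_curvature_X: "arc_length_integral (\<lambda>z. X z t) (curvature (\<lambda>z. X z t)) = 2 * pi * m"
proof -
  have "((\<lambda>u. flow.W u t) has_integral \<Theta> (2 * pi) t - \<Theta> 0 t) {0..2 * pi}"
    by (rule has_integral_DERIV[OF flow.\<Theta>_u_deriv[OF t]]) simp
  then have "integral {0..2 * pi} (\<lambda>u. flow.W u t) = 2 * pi * m"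
    using \<Theta>_full_shift[OF t, of 0] by (simp add: integral_unique)
  moreover have "k (\<Theta> u t) / \<psi> t * (\<psi> t * flow.W u t / k (\<Theta> u t)) = flow.W u t" for u
    using \<psi>_pos[OF t] kpos[of "\<Theta> u t"] by simp
  ultimately show ?thesis unfolding arc_length_integral_def curvature_X norm_circle_deriv_X by simp
qed

text \<open>Substituting the tangent angle reduces the length to increments of an antiderivative
  \<open>R\<close> of \<open>1 / k\<close>. The mean condition on \<open>1 / k\<close> makes
  \<open>R\<close> advance by exactly \<open>P\<close> per period, so the average curvature becomes
  \<open>1 / \<psi>\<close>, the value that the equation for \<open>k\<close> presupposes.\<close>

lemma curve_length_X: "curve_length (\<lambda>z. X z t) = \<psi> t * (2 * pi * m)"
proof -
  have "continuous_on UNIV (\<lambda>\<theta>. 1 / k \<theta>)"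
    using kpos by (intro continuous_intros k_cont) (auto simp: less_imp_neq[symmetric])
  then obtain R where R: "\<And>\<theta>. (R has_real_derivative 1 / k \<theta>) (at \<theta>)"
    by (rule continuous_has_antiderivative) blast
  have RP: "R (\<theta> + P) = R \<theta> + P" for \<theta>
  proof -
    have "((\<lambda>\<theta>. R (\<theta> + P)) has_real_derivative 1 / k \<theta>) (at \<theta>)" for \<theta>
      using R[of "\<theta> + P"] by (simp add: DERIV_shift per)
    then have "R (\<theta> + P) - R (0 + P) = R \<theta> - R 0"
      by (rule equal_derivatives_equal_increments[OF _ R])
    moreover have "((\<lambda>\<theta>. 1 / k \<theta>) has_integral R P - R 0) {0..P}"
      using P0 by (intro has_integral_DERIV[OF R]) simp
    then have "R P - R 0 = P" using mean by (simp add: integral_unique)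
    ultimately show ?thesis by simp
  qed
  have "R (\<theta> + real j * P) = R \<theta> + real j * P" for \<theta> and j :: nat
  proof (induction j)
    case (Suc j)
    then show ?case using RP[of "\<theta> + real j * P"] by (simp add: algebra_simps)
  qed simp
  from this[of _ n] have Rm: "R (\<theta> + 2 * pi * m) = R \<theta> + 2 * pi * m" for \<theta>
    using Pn by (simp add: mult.commute)
  have "((\<lambda>u. R (\<Theta> u t)) has_real_derivative 1 / k (\<Theta> u t) * flow.W u t) (at u)" for u
    by (rule DERIV_chain2[OF R flow.\<Theta>_u_deriv[OF t]])
  then have "((\<lambda>u. 1 / k (\<Theta> u t) * flow.W u t) has_integral R (\<Theta> (2 * pi) t) - R (\<Theta> 0 t)) {0..2 * pi}"
    by (rule has_integral_DERIV) simp
  then have "((\<lambda>u. 1 / k (\<Theta> u t) * flow.W u t) has_integral 2 * pi * m) {0..2 * pi}"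
    using \<Theta>_full_shift[OF t, of 0] Rm by simp
  from has_integral_mult_right[OF this, of "\<psi> t"]
  have "((\<lambda>u. \<psi> t * (1 / k (\<Theta> u t) * flow.W u t)) has_integral \<psi> t * (2 * pi * m)) {0..2 * pi}" .
  moreover have "(\<lambda>u. \<psi> t * (1 / k (\<Theta> u t) * flow.W u t)) = (\<lambda>u. 1 * (\<psi> t * flow.W u t / k (\<Theta> u t)))" by auto
  ultimately show ?thesis
    unfolding curve_length_def arc_length_integral_def norm_circle_deriv_X by (simp only: integral_unique)
qed

lemma average_curvature_X: "average_curvature (\<lambda>z. X z t) = 1 / \<psi> t"
  unfolding average_curvature_def total_curvature_X curve_length_X
  using m0 \<psi>_pos[OF t] by simp

lemma X_t_deriv:
  "(X (cis u) has_vector_derivative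
     (curvature (\<lambda>z. X z t) (cis u) - average_curvature (\<lambda>z. X z t)) *\<^sub>R unit_normal (\<lambda>z. X z t) (cis u))
   (at t within {0..e})"
proof -
  define \<theta> where "\<theta> = \<Theta> u t"
  have "(\<Theta> u has_vector_derivative v \<theta> * g t) (at t within {0..e})"
    using flow.\<Theta>_t_deriv[OF t] by (simp add: has_real_derivative_iff_has_vector_derivative \<theta>_def)
  from vector_diff_chain_within[OF this F_deriv[of "\<Theta> u t"]]
  have "((\<lambda>s. F (\<Theta> u s)) has_vector_derivative (v \<theta> * g t) *\<^sub>R (1 / k \<theta>) *\<^sub>R cis \<theta>) (at t within {0..e})"
    by (simp add: o_def \<theta>_def)
  from has_vector_derivative_scaleR[OF \<psi>_deriv[OF t] this]
  have "((\<lambda>s. \<psi> s *\<^sub>R F (\<Theta> u s)) has_vector_derivative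
      (\<psi> t *\<^sub>R ((v \<theta> * g t) *\<^sub>R (1 / k \<theta>) *\<^sub>R cis \<theta>) + (- b / \<psi> t) *\<^sub>R F \<theta>)) (at t within {0..e})"
    by (simp add: \<theta>_def)
  moreover have "\<psi> t *\<^sub>R ((v \<theta> * g t) *\<^sub>R (1 / k \<theta>) *\<^sub>R cis \<theta>) + (- b / \<psi> t) *\<^sub>R F \<theta>
      = (k \<theta> / \<psi> t - 1 / \<psi> t) *\<^sub>R (\<i> * cis \<theta>)"
  proof -
    have p: "\<psi> t \<noteq> 0" and kk: "k \<theta> \<noteq> 0" using \<psi>_pos[OF t] kpos[of \<theta>] by auto
    \<comment> \<open>The moving tangent angle contributes the tangential velocity
      \<open>k' / \<psi>\<close>. Scaling contributes its negative together with the normal velocity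
      \<open>(k - 1) / \<psi>\<close>, which is curvature minus average curvature.\<close>
    have 1: "\<psi> t *\<^sub>R ((v \<theta> * g t) *\<^sub>R (1 / k \<theta>) *\<^sub>R cis \<theta>) = (k' \<theta> / \<psi> t) *\<^sub>R cis \<theta>"
      using p kk by (simp add: v_def g_\<psi>[OF t])
    have 2: "(- b / \<psi> t) *\<^sub>R F \<theta> = - ((k' \<theta> / \<psi> t) *\<^sub>R cis \<theta>) + ((k \<theta> - 1) / \<psi> t) *\<^sub>R (\<i> * cis \<theta>)"
      using b p unfolding F_def by (simp add: scaleR_conv_of_real field_simps)
    show ?thesis unfolding 1 2 by (simp add: diff_divide_distrib)
  qed
  ultimately have "((\<lambda>s. \<psi> s *\<^sub>R F (\<Theta> u s)) has_vector_derivative (k \<theta> / \<psi> t - 1 / \<psi> t) *\<^sub>R (\<i> * cis \<theta>)) (at t within {0..e})"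
    by simp
  then have "(X (cis u) has_vector_derivative (k \<theta> / \<psi> t - 1 / \<psi> t) *\<^sub>R (\<i> * cis \<theta>)) (at t within {0..e})"
    by (rule has_vector_derivative_transform[OF t, rotated]) (simp add: X_cis)
  then show ?thesis
    unfolding curvature_X average_curvature_X unit_normal_def unit_tangent_X \<theta>_def .
qed

text \<open>Homothety concerns images, so the reparametrisation must be onto:
  \<open>\<Theta> u t - m * u\<close> is continuous and periodic in \<open>u\<close>, hence bounded,
  and the intermediate value theorem reaches every angle.\<close>

lemma image_X: "(\<lambda>z. X z t) ` unit_circle = (\<lambda>p. \<psi> t *\<^sub>R p) ` range F"
proof -
  have surj: "\<exists>u. \<Theta> u t = y" for y
  proof -
    have dper: "\<Theta> (u + 2 * pi) t - real m * (u + 2 * pi) = \<Theta> u t - real m * u" for u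
      unfolding \<Theta>_full_shift[OF t] by (simp add: algebra_simps)
    have cont: "continuous_on A (\<lambda>u. \<Theta> u t)" for A
      by (rule continuous_on_subset[OF DERIV_continuous_on[of UNIV]])
        (use flow.\<Theta>_u_deriv[OF t] in \<open>auto intro: has_field_derivative_at_within\<close>)
    have dcont: "continuous_on UNIV (\<lambda>u. \<Theta> u t - real m * u)" by (intro continuous_intros cont)
    obtain B where B: "\<And>u. \<bar>\<Theta> u t - real m * u\<bar> \<le> B"
      by (rule periodic_continuous_bounded[of "2 * pi" "\<lambda>u. \<Theta> u t - real m * u", OF _ dper dcont]) auto
    have B0: "B \<ge> 0" using B[of 0] by linarith
    have "\<Theta> ((y - B) / m) t \<le> y" using B[of "(y - B) / m"] m0 by (simp add: abs_le_iff)
    moreover have "y \<le> \<Theta> ((y + B) / m) t" using B[of "(y + B) / m"] m0 by (simp add: abs_le_iff)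
    moreover have "(y - B) / m \<le> (y + B) / m" using B0 by (intro divide_right_mono) auto
    ultimately show ?thesis using IVT'[of "\<lambda>u. \<Theta> u t" "(y - B) / m" y "(y + B) / m"] cont by blast
  qed
  then have onto: "range (\<lambda>u. \<Theta> u t) = UNIV" unfolding surj_def by metis
  have "(\<lambda>z. X z t) ` unit_circle = range (\<lambda>u. \<psi> t *\<^sub>R F (\<Theta> u t))"
    unfolding unit_circle_eq_range_cis by (simp add: image_image X_cis[OF t])
  also have "\<dots> = (\<lambda>y. \<psi> t *\<^sub>R F y) ` range (\<lambda>u. \<Theta> u t)" by (simp add: image_image)
  finally show ?thesis unfolding onto by (simp add: image_image)
qed

end

lemma X_smooth: "Ck_on j (UNIV \<times> {0..e}) (\<lambda>(u, t). X (cis u) t)"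
proof -
  have "Ck_on j (UNIV \<times> {0..e}) (\<lambda>x. \<psi> (snd x) *\<^sub>R F ((\<lambda>(u, t). \<Theta> u t) x))"
  proof (intro Ck_on_scaleR)
    show "Ck_on j (UNIV \<times> {0..e}) (\<lambda>x::real \<times> real. \<psi> (snd x))"
      unfolding \<psi>_def
      by (rule Ck_on_compose_real[OF Ck_on_sqrt_linear[OF b] Ck_on_ident_linear[OF bounded_linear_snd]])
        (use t_bound in auto)
    show "Ck_on j (UNIV \<times> {0..e}) (\<lambda>x. F ((\<lambda>(u, t). \<Theta> u t) x))"
      by (rule Ck_on_compose_real[OF F_smooth flow.\<Theta>_smooth]) auto
  qed
  then show ?thesis by (rule Ck_on_cong) (auto simp: X_cis)
qed

lemma X_immersion:
  assumes t: "t \<in> {0..e}"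
  shows "smooth_immersion (\<lambda>z. X z t)"
  unfolding smooth_immersion_def smooth_on_def
proof (intro conjI allI ballI)
  show "Ck_on j UNIV (\<lambda>u. X (cis u) t)" for j
    using Ck_on_slice[OF X_smooth t] by simp
  show "circle_deriv (\<lambda>z. X z t) z \<noteq> 0" if z: "z \<in> unit_circle" for z
  proof -
    obtain u where "z = cis u" using z by (rule unit_circle_cis)
    then have "norm (circle_deriv (\<lambda>z. X z t) z) > 0"
      using speed_pos[OF t, of u] norm_circle_deriv_X[OF t, of u] by simp
    then show ?thesis by auto
  qed
qed

lemma X_APCSF: "APCSF e X"
  unfolding APCSF_def smooth_family_of_immersions_def time_interval_ereal smooth_on_def
proof (intro conjI allI ballI)
  show "Ck_on j (UNIV \<times> {0..<e}) (\<lambda>(u, t). X (cis u) t)" for j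
    by (rule Ck_on_subset[OF X_smooth]) auto
  show "smooth_immersion (\<lambda>z. X z t)" if "t \<in> {0..<e}" for t
    using that by (intro X_immersion) auto
  fix z t assume z': "z \<in> unit_circle" and t: "t \<in> {0..<e}"
  obtain u where z: "z = cis u" using z' by (rule unit_circle_cis)
  have "t \<in> {0..e}" using t by auto
  from X_t_deriv[OF this, of u]
  show "(X z has_vector_derivative (curvature (\<lambda>w. X w t) z - average_curvature (\<lambda>w. X w t)) *\<^sub>R unit_normal (\<lambda>w. X w t) z)
      (at t within {0..<e})"
    unfolding z by (rule has_vector_derivative_within_subset) auto
qed

lemma X_shrinker: "APCSF_shrinker (\<lambda>z. X z 0)"
proof -
  have t0: "0 \<in> {0..e}" using flow.e0 by simp
  have pos: "\<psi> t > 0" if "t \<in> {0..<e}" for t using that by (intro \<psi>_pos) auto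
  have "continuous_on {0..<e} \<psi>" unfolding \<psi>_def by (intro continuous_intros)
  then have \<psi>'_cont: "continuous_on {0..<e} (\<lambda>t. - b / \<psi> t)"
    using pos by (intro continuous_intros) (auto simp: less_imp_neq[symmetric])
  have "(\<psi> has_real_derivative - b / \<psi> t) (at t within {0..<e})" if "t \<in> {0..<e}" for t
    by (rule \<psi>_deriv) (use that in auto)
  with \<psi>'_cont have C1: "C1_with_deriv (ereal e) \<psi> (\<lambda>t. - b / \<psi> t)"
    unfolding C1_with_deriv_def time_interval_ereal by blast
  have "\<psi> 0 = 1" by (simp add: \<psi>_def)
  then have homothetic: "homothetic_with (ereal e) X \<psi> 0"
    unfolding homothetic_with_def time_interval_ereal using image_X t0 by (auto simp: image_image)
  have shrinking: "\<forall>t\<in>time_interval (ereal e). - b / \<psi> t \<le> 0"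
    unfolding time_interval_ereal using pos b by (auto simp: divide_le_0_iff less_imp_le)
  have "\<exists>T Y \<phi> \<phi>' c. 0 < T \<and> APCSF T Y \<and> (\<forall>z\<in>unit_circle. Y z 0 = X z 0) \<and>
      C1_with_deriv T \<phi> \<phi>' \<and> homothetic_with T Y \<phi> c \<and> (\<forall>t\<in>time_interval T. \<phi>' t \<le> 0)"
    by (rule exI[of _ "ereal e"], rule exI[of _ X], rule exI[of _ \<psi>], rule exI[of _ "\<lambda>t. - b / \<psi> t"], rule exI[of _ 0])
      (use flow.e0 X_APCSF C1 homothetic shrinking in \<open>simp del: divide_minus_left\<close>)
  then show ?thesis unfolding APCSF_shrinker_def using X_immersion[OF t0] by (intro conjI)
qed

lemma image_X_0: "(\<lambda>z. X z 0) ` unit_circle = range F"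
  using image_X[of 0] flow.e0 by (simp add: \<psi>_def)

text \<open>At time 0 the tangent angle is \<open>m * u\<close>, so the unit tangent runs m times
  around the circle at constant speed.\<close>

lemma X_turning: "tangent_turning_index (\<lambda>z. X z 0) = of_nat m"
proof -
  have t0: "0 \<in> {0..e}" using flow.e0 by simp
  have "unit_tangent (\<lambda>z. X z 0) \<circ> circlepath 0 1 = (\<lambda>s. cis (of_nat m * (2 * pi * s)))"
  proof
    fix s
    have "circlepath 0 1 s = cis (2 * pi * s)" by (simp add: circlepath cis_conv_exp mult_ac)
    then show "(unit_tangent (\<lambda>z. X z 0) \<circ> circlepath 0 1) s = cis (of_nat m * (2 * pi * s))"
      using unit_tangent_X[OF t0, of "2 * pi * s"] by simp
  qed
  then show ?thesis unfolding tangent_turning_index_def by (simp only: winding_number_cis_multiple)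
qed

lemma shrinker_exists:
  "\<exists>x. APCSF_shrinker x \<and> non_circular x \<and> strictly_locally_convex x \<and>
     tangent_turning_index x = of_nat m \<and> rotational_symmetry n (x ` unit_circle)"
proof (intro exI[of _ "\<lambda>z. X z 0"] conjI X_shrinker X_turning)
  have t0: "0 \<in> {0..e}" using flow.e0 by simp
  show "non_circular (\<lambda>z. X z 0)"
    unfolding non_circular_def image_X_0 using F_not_in_sphere by blast
  show "strictly_locally_convex (\<lambda>z. X z 0)"
    unfolding strictly_locally_convex_def unit_circle_eq_range_cis
    using \<psi>_pos[OF t0] kpos by (auto simp: curvature_X[OF t0] less_imp_neq[symmetric])
  show "rotational_symmetry n ((\<lambda>z. X z 0) ` unit_circle)"
    unfolding rotational_symmetry_def image_X_0 using F_image_symmetric by (intro exI[of _ 0]) simp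
qed

end

theorem mainTheorem1:
  fixes m n :: nat
  assumes "coprime m n"
    and "1 / 2 < real m / real n"
    and "real m / real n < 1"
  shows "\<exists>x :: complex \<Rightarrow> complex.
           APCSF_shrinker x \<and> non_circular x \<and> strictly_locally_convex x \<and>
           tangent_turning_index x = of_nat m \<and>
           rotational_symmetry n (x ` unit_circle)"
proof -
  have n0: "n > 0" using assms(2) by (cases "n = 0") auto
  have m0: "m > 0" using assms(2) by (cases "m = 0") auto
  \<comment> \<open>The hypotheses on \<open>m / n\<close> are exactly
    \<open>pi < P < 2 * pi\<close>.\<close>
  define P where "P = 2 * pi * (real m / real n)"
  have "2 * pi * (1 / 2) < P" "P < 2 * pi * 1"
    unfolding P_def using assms(2,3) by (intro mult_strict_left_mono; simp)+
  then have P: "pi < P" "P < 2 * pi" by simp_all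
  have Pn: "P * real n = 2 * pi * real m" using n0 by (simp add: P_def)
  obtain k k' :: "real \<Rightarrow> real" and b :: real where k: "b > 0" "\<And>t. k t > 0" "\<And>t. k (t + P) = k t"
    "\<And>t. (k has_real_derivative k' t) (at t)"
    "\<And>t. (k' has_real_derivative 1 - k t + b / k t) (at t)"
    "integral {0..P} (\<lambda>s. 1 / k s) = P"
    "\<exists>s t. k s \<noteq> k t"
    by (rule curvature_ode_solution[OF P]) blast
  interpret curvature_profile k k' b P m n
    by (rule curvature_profile.intro[OF k m0 n0 assms(1) Pn])
  obtain e \<Theta> where "e > 0" and be: "2 * b * e < 1" and flow: "scalar_flow v v' g \<Theta> e m"
    by (rule flow_exists) blast
  interpret homothetic_evolution k k' b P m n \<Theta> e
    by (intro homothetic_evolution.intro homothetic_evolution_axioms.intro curvature_profile_axioms flow be)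
  show ?thesis by (rule shrinker_exists)
qed

end
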